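(* Let $a,b,c$ be real numbers with $c\ge0$, $c+a>0$, $c+b>0$, and assume that $a$ is not an integer. Let $\nu=\nu_{a,b,c}$ be the spectral measure of the Jacobi matrix $J_{III}$ (Model III of associated Jacobi polynomials). Then $\nu$ is absolutely continuous with density $$\frac{d\nu}{dx}(x)=\frac{\Gamma(c+1)\,\Gamma(c+a+b+2)}{\Gamma(c+a+1)\,\Gamma(c+b+1)}\cdot\frac{x^a(1-x)^b}{\left|U(x)+e^{i\pi a}V(x)\right|^2},\qquad 0<x<1,$$ where $$U(x)=\frac{\Gamma(c+1)\Gamma(a+1)}{\Gamma(1+c+a)}\;{}_2F_1(c,-c-a-b-1;-a;x),$$ $$V(x)=\frac{-\pi c\,\Gamma(c+a+b+2)}{\sin(\pi a)\,\Gamma(1+c+b)\,\Gamma(2+a)}\,(1-x)^{1+b}x^{1+a}\;{}_2F_1(1-c,2+c+a+b;2+a;x).$$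
   Context: ${}_2F_1$ is the Gauss hypergeometric function. The matrix $J_{III}$ is the infinite symmetric tridiagonal matrix $$J_{III}=\begin{pmatrix}\hat\lambda_0&\sqrt{\hat\lambda_0\mu_1}\\ \sqrt{\hat\lambda_0\mu_1}&\lambda_1+\mu_1&\sqrt{\lambda_1\mu_2}\\ &\sqrt{\lambda_1\mu_2}&\lambda_2+\mu_2&\ddots\\ &&\ddots&\ddots\end{pmatrix}$$ with $$\hat\lambda_0=\frac{c+a+1}{2c+a+b+2},\quad \lambda_n=\frac{n+c+a+1}{2n+2c+a+b+2}\cdot\frac{n+c+a+b+1}{2n+2c+a+b+1},\quad \mu_n=\frac{n+c}{2n+2c+a+b+1}\cdot\frac{n+c+b}{2n+2c+a+b}\quad(n\ge1).$$ A Jacobi matrix is an infinite symmetric tridiagonal matrix with real diagonal entries and positive off-diagonal entries. The spectral measure of the Jacobi matrix $J_{III}$ (whose entries are bounded) is the unique probability measure $\nu$ on $\mathbb R$ with $\int x^k\,d\nu(x)=(J_{III})^k(1,1)$ for all $k=0,1,2,\dots$.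
   Formalization: The additional assumptions a > -1 and b ≥ -1 are made; without them the claim fails: for a < -1 the measure has an atom at 0 and for b < -1 one at 1 (e.g. a = -1.5, b = 0.7, c = 1.8), or J_III is not a Jacobi matrix. *)

theory Defs
  imports "HOL-Analysis.Analysis" "HOL-Probability.Probability"
begin

section \<open>Infinite tridiagonal matrices and their spectral measures\<close>

text \<open>Infinite matrices are functions of two indices counted from 0, so that the entry
  written \<open>J(1,1)\<close> in the usual 1-based notation is \<open>J 0 0\<close>.\<close>

definition jacobi_matrix :: "(nat \<Rightarrow> nat \<Rightarrow> real) \<Rightarrow> bool" where
  "jacobi_matrix J \<longleftrightarrow>
     (\<forall>i j. J i j = J j i) \<and>
     (\<forall>i j. Suc i < j \<longrightarrow> J i j = 0) \<and>
     (\<forall>i. J i (Suc i) > 0)"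

text \<open>Powers of a matrix with finitely supported rows. Under that condition, which holds for
  every tridiagonal matrix, the sum below is the full matrix product; otherwise the value is
  of no interest.\<close>

fun inf_mat_pow :: "(nat \<Rightarrow> nat \<Rightarrow> real) \<Rightarrow> nat \<Rightarrow> nat \<Rightarrow> nat \<Rightarrow> real" where
  "inf_mat_pow J 0 i j = (if i = j then 1 else 0)"
| "inf_mat_pow J (Suc k) i j = (\<Sum>l | J i l \<noteq> 0. J i l * inf_mat_pow J k l j)"

definition is_spectral_measure :: "(nat \<Rightarrow> nat \<Rightarrow> real) \<Rightarrow> real measure \<Rightarrow> bool" where
  "is_spectral_measure J \<nu> \<longleftrightarrow>
     prob_space \<nu> \<and> sets \<nu> = sets borel \<and>
     (\<forall>k. integrable \<nu> (\<lambda>x. x ^ k) \<and> (\<integral>x. x ^ k \<partial>\<nu>) = inf_mat_pow J k 0 0)"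

definition spectral_measure :: "(nat \<Rightarrow> nat \<Rightarrow> real) \<Rightarrow> real measure" where
  "spectral_measure J = (THE \<nu>. is_spectral_measure J \<nu>)"


section \<open>Model III of the associated Jacobi polynomials\<close>

text \<open>\<open>lam_III a b c 0\<close> is the modified coefficient (written with a hat); it is not
  the value at \<open>n = 0\<close> of the general formula.\<close>

definition lam_III :: "real \<Rightarrow> real \<Rightarrow> real \<Rightarrow> nat \<Rightarrow> real" where
  "lam_III a b c n =
     (if n = 0 then (c + a + 1) / (2 * c + a + b + 2)
      else (real n + c + a + 1) / (2 * real n + 2 * c + a + b + 2) *
           ((real n + c + a + b + 1) / (2 * real n + 2 * c + a + b + 1)))"

text \<open>Only used for \<open>n \<ge> 1\<close>.\<close>

definition mu_III :: "real \<Rightarrow> real \<Rightarrow> real \<Rightarrow> nat \<Rightarrow> real" where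
  "mu_III a b c n =
     (real n + c) / (2 * real n + 2 * c + a + b + 1) *
     ((real n + c + b) / (2 * real n + 2 * c + a + b))"

definition J_III :: "real \<Rightarrow> real \<Rightarrow> real \<Rightarrow> nat \<Rightarrow> nat \<Rightarrow> real" where
  "J_III a b c i j =
     (if i = j then (if i = 0 then lam_III a b c 0 else lam_III a b c i + mu_III a b c i)
      else if j = Suc i then sqrt (lam_III a b c i * mu_III a b c j)
      else if i = Suc j then sqrt (lam_III a b c j * mu_III a b c i)
      else 0)"

text \<open>For these parameters \<open>J_III\<close> is indeed a Jacobi matrix.\<close>

lemma jacobi_matrix_J_III:
  fixes a b c :: real
  assumes "c \<ge> 0" "c + a > 0" "c + b > 0" "a > - 1" "b \<ge> - 1"
  shows "jacobi_matrix (J_III a b c)"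
proof -
  have lam: "lam_III a b c n > 0" for n
    using assms by (cases n) (auto simp: lam_III_def intro!: mult_pos_pos divide_pos_pos)
  have mu: "mu_III a b c (Suc n) > 0" for n
    using assms by (auto simp: mu_III_def intro!: mult_pos_pos divide_pos_pos)
  show ?thesis
    using lam mu by (auto simp: jacobi_matrix_def J_III_def)
qed

text \<open>The Gauss hypergeometric function as the sum of its power series, for real
  \<open>\<bar>x\<bar> < 1\<close> and \<open>r\<close> not a nonpositive integer.\<close>

definition hyp2F1 :: "real \<Rightarrow> real \<Rightarrow> real \<Rightarrow> real \<Rightarrow> real" where
  "hyp2F1 p q r x = eval_fps (fps_hypergeo [p, q] [r] 1) x"

definition U_III :: "real \<Rightarrow> real \<Rightarrow> real \<Rightarrow> real \<Rightarrow> real" where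
  "U_III a b c x =
     Gamma (c + 1) * Gamma (a + 1) / Gamma (1 + c + a) *
     hyp2F1 c (- c - a - b - 1) (- a) x"

definition V_III :: "real \<Rightarrow> real \<Rightarrow> real \<Rightarrow> real \<Rightarrow> real" where
  "V_III a b c x =
     - pi * c * Gamma (c + a + b + 2) / (sin (pi * a) * Gamma (1 + c + b) * Gamma (2 + a)) *
     (1 - x) powr (1 + b) * x powr (1 + a) *
     hyp2F1 (1 - c) (2 + c + a + b) (2 + a) x"

definition density_III :: "real \<Rightarrow> real \<Rightarrow> real \<Rightarrow> real \<Rightarrow> real" where
  "density_III a b c x =
     Gamma (c + 1) * Gamma (c + a + b + 2) / (Gamma (c + a + 1) * Gamma (c + b + 1)) *
     (x powr a * (1 - x) powr b /
      (cmod (complex_of_real (U_III a b c x) +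
             exp (\<i> * complex_of_real (pi * a)) * complex_of_real (V_III a b c x)))\<^sup>2)"

end

theory Submission
  imports Defs "HOL-Complex_Analysis.Complex_Analysis" "HOL-Real_Asymp.Real_Asymp"
begin

text \<open>
  Write \<open>I\<^sub>e(s) = \<integral>\<^sub>0\<^sup>1 t\<^sup>c\<^sup>+\<^sup>a (1 - t)\<^sup>c\<^sup>+\<^sup>b (s + t)\<^sup>-\<^sup>e dt\<close>. Both \<open>J\<close> and \<open>1 - J\<close> are positive, so the moments
  \<open>(J\<^sup>k)\<^sub>0\<^sub>0\<close> solve a Hausdorff moment problem; let \<open>\<nu>\<close> be its solution. Euler integrals with all exponents
  raised by \<open>n\<close> solve the three-term recurrence of \<open>J\<close> with right-hand side \<open>I\<^sub>c(s) e\<^sub>0\<close>, and a Neumann series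
  gives \<open>\<integral> d\<nu>(t) / (s + t) = I\<^sub>c\<^sub>+\<^sub>1(s) / I\<^sub>c(s) = - I\<^sub>c'(s) / (c I\<^sub>c(s))\<close> for large \<open>s\<close>, hence on the plane cut along
  the negative axis. Near \<open>s = 0\<close> the function \<open>I\<^sub>c\<close> is a combination of the two Frobenius solutions of a
  hypergeometric equation in \<open>- s\<close>, proportional at \<open>s = - x + i 0\<close> to \<open>U(x) + e\<^sup>i\<^sup>\<pi>\<^sup>a V(x)\<close>. The imaginary part of
  \<open>I\<^sub>c' / I\<^sub>c\<close> there is a Wronskian, which is an explicit multiple of \<open>x\<^sup>a (1 - x)\<^sup>b\<close>, divided by
  \<open>\<bar>I\<^sub>c\<bar>\<^sup>2\<close>; Stieltjes inversion turns it into the density on \<open>(0, 1)\<close>. Atoms at the end points are excluded by the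
  growth of \<open>I\<^sub>c\<close> at \<open>0\<close> and the symmetry \<open>x \<mapsto> 1 - x\<close>. For \<open>c = 0\<close> the measure is a beta distribution.
\<close>

section \<open>Moment problems on the unit interval\<close>

text \<open>No spectral theorem is used: \<open>J_III\<close> enters only through finitely supported
  vectors, its moments, and one explicit solution of its recurrence. The obstacle is that the
  transform of the measure is first known for large positive \<open>s\<close>, while the density
  sits on the cut, at \<open>s = -x\<close>. The bridge is a pair of power series at the origin, and
  it needs the Frobenius exponents 0 and \<open>1 + a\<close> not to differ by an integer: this is
  the role of the non-integrality of \<open>a\<close>. A second difficulty is that the Euler
  integral in the denominator might vanish. The transform identity is therefore kept as a product
  until a common zero of the integral and its derivative has been excluded. Writing the transform as
  a logarithmic derivative costs a factor \<open>1 / c\<close>, so \<open>c = 0\<close> is a case of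
  its own. The reflection swaps \<open>a\<close> and \<open>b\<close>, so everything it has to
  transport is stated symmetrically for \<open>a >= -1\<close> and \<open>b >= -1\<close>, while
  integrability of \<open>x^a\<close> at 0 asks for \<open>a > -1\<close>.\<close>

lemma real_distribution_eqI_moments:
  fixes M N :: "real measure"
  assumes M: "prob_space M" "sets M = sets borel" and N: "prob_space N" "sets N = sets borel"
    and intM: "\<And>k. integrable M (\<lambda>x. x ^ k)" and intN: "\<And>k. integrable N (\<lambda>x. x ^ k)"
    and eq: "\<And>k. (\<integral>x. x ^ k \<partial>M) = (\<integral>x. x ^ k \<partial>N)"
    and bnd: "\<And>k. (\<integral>x. x ^ (2 * k) \<partial>M) \<le> 1"
  shows "M = N"
proof (rule Levy_uniqueness)
  have dM: "real_distribution M"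
    using M by (simp add: real_distribution_def real_distribution_axioms_def)
  have dN: "real_distribution N"
    using N by (simp add: real_distribution_def real_distribution_axioms_def)
  show "real_distribution M" "real_distribution N" by fact+
  \<comment> \<open>The bound 1 on the even moments makes the Taylor remainder of the characteristic
    function at most \<open>2 |t|^(2k) / (2k)!\<close>. Hence the moments determine it, and only one
    of the two measures has to supply the bound.\<close>
  have lim: "(\<lambda>k. \<Sum>j\<le>2*k. (\<i> * of_real t) ^ j / fact j * of_real (\<integral>x. x ^ j \<partial>M)) \<longlonglongrightarrow> char D t"
    if D: "real_distribution D" and intD: "\<And>k. integrable D (\<lambda>x. x ^ k)"
      and eqD: "\<And>k. (\<integral>x. x ^ k \<partial>M) = (\<integral>x. x ^ k \<partial>D)" for D t
  proof (rule Lim_transform2[OF tendsto_const])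
    let ?S = "\<lambda>k. \<Sum>j\<le>2*k. (\<i> * of_real t) ^ j / fact j * of_real (\<integral>x. x ^ j \<partial>M)"
    have "norm (char D t - ?S k) \<le> 2 * (\<bar>t\<bar> ^ (2*k) / fact (2*k))" for k
    proof -
      have "cmod (char D t - (\<Sum>j \<le> 2*k. ((\<i> * t)^j / fact j) * (\<integral>x. x ^ j \<partial>D)))
          \<le> (2*\<bar>t\<bar>^(2*k) / fact (2*k)) * (\<integral>x. \<bar>x\<bar>^(2*k) \<partial>D)"
        by (rule real_distribution.char_approx1[OF D intD])
      also have "(\<integral>x. \<bar>x\<bar>^(2*k) \<partial>D) = (\<integral>x. x^(2*k) \<partial>M)"
        by (simp add: eqD power_even_abs)
      also have "(2*\<bar>t\<bar>^(2*k) / fact (2*k)) * (\<integral>x. x^(2*k) \<partial>M) \<le> (2*\<bar>t\<bar>^(2*k) / fact (2*k)) * 1"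
        by (rule mult_left_mono[OF bnd]) simp
      finally show ?thesis by (simp add: eqD)
    qed
    moreover have "(\<lambda>k. 2 * (\<bar>t\<bar> ^ (2*k) / fact (2*k))) \<longlonglongrightarrow> 2 * 0"
    proof (rule tendsto_mult[OF tendsto_const])
      have "(\<lambda>n. \<bar>t\<bar> ^ n / fact n) \<longlonglongrightarrow> 0"
        using summable_LIMSEQ_zero[OF summable_exp[of "\<bar>t\<bar>"]] by (simp add: field_simps)
      moreover have "strict_mono (\<lambda>k::nat. 2*k)" by (simp add: strict_mono_def)
      ultimately show "(\<lambda>k. \<bar>t\<bar> ^ (2*k) / fact (2*k)) \<longlonglongrightarrow> 0"
        using LIMSEQ_subseq_LIMSEQ[of "\<lambda>n. \<bar>t\<bar> ^ n / fact n" 0 "\<lambda>k. 2*k"] by (simp add: o_def)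
    qed
    ultimately show "(\<lambda>k. char D t - ?S k) \<longlonglongrightarrow> 0"
      using Lim_null_comparison[of "\<lambda>k. char D t - ?S k" "\<lambda>k. 2 * (\<bar>t\<bar> ^ (2*k) / fact (2*k))" sequentially]
      by simp
  qed
  show "char M = char N"
  proof
    fix t
    show "char M t = char N t"
      by (rule LIMSEQ_unique[OF lim[OF dM intM refl] lim[OF dN intN eq]])
  qed
qed

text \<open>The witnesses are the measures \<open>\<nu>\<^sub>n\<close> putting on \<open>k / n\<close> the mass that the moment functional
  gives to the Bernstein polynomial \<open>(n choose k) x\<^sup>k (1 - x)\<^sup>n\<^sup>-\<^sup>k\<close>; their factorial
  moments are known exactly.\<close>

definition hausdorff_diff :: "(nat \<Rightarrow> real) \<Rightarrow> nat \<Rightarrow> nat \<Rightarrow> real" where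
  "hausdorff_diff m i j = (\<Sum>l\<le>j. (-1) ^ l * real (j choose l) * m (i + l))"

lemma hausdorff_diff_0 [simp]: "hausdorff_diff m i 0 = m i"
  by (simp add: hausdorff_diff_def)

text \<open>Pascal's rule. Under the moment functional, \<open>hausdorff_diff m i j\<close> is the
  value at \<open>x^i (1 - x)^j\<close>; a further factor \<open>1 - x\<close> splits it in
  two.\<close>

lemma hausdorff_diff_Suc:
  "hausdorff_diff m i (Suc j) = hausdorff_diff m i j - hausdorff_diff m (Suc i) j"
proof -
  have "hausdorff_diff m i (Suc j) =
      m i + (\<Sum>l\<le>j. (-1) ^ Suc l * real (Suc j choose Suc l) * m (i + Suc l))"
    unfolding hausdorff_diff_def by (subst sum.atMost_Suc_shift) simp
  also have "(\<Sum>l\<le>j. (-1) ^ Suc l * real (Suc j choose Suc l) * m (i + Suc l)) =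
      (\<Sum>l\<le>j. (-1) ^ Suc l * real (j choose Suc l) * m (i + Suc l)) - hausdorff_diff m (Suc i) j"
    unfolding hausdorff_diff_def sum_subtractf[symmetric] by (intro sum.cong) (simp_all add: algebra_simps)
  also have "m i + ((\<Sum>l\<le>j. (-1) ^ Suc l * real (j choose Suc l) * m (i + Suc l)) - hausdorff_diff m (Suc i) j)
     = (\<Sum>l\<le>Suc j. (-1) ^ l * real (j choose l) * m (i + l)) - hausdorff_diff m (Suc i) j"
    by (subst sum.atMost_Suc_shift) simp
  also have "(\<Sum>l\<le>Suc j. (-1) ^ l * real (j choose l) * m (i + l)) = hausdorff_diff m i j"
    unfolding hausdorff_diff_def by simp
  finally show ?thesis .
qed

text \<open>The Bernstein polynomials form a partition of unity, here multiplied by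
  \<open>x^i\<close>. The induction on \<open>n\<close> raises \<open>i\<close> as well, so
  \<open>i\<close> must be arbitrary.\<close>

lemma sum_choose_hausdorff_diff:
  "(\<Sum>k\<le>n. real (n choose k) * hausdorff_diff m (i + k) (n - k)) = m i"
proof (induction n arbitrary: i)
  case 0
  then show ?case by simp
next
  case (Suc n)
  have "(\<Sum>k\<le>Suc n. real (Suc n choose k) * hausdorff_diff m (i + k) (Suc n - k))
      = hausdorff_diff m i (Suc n) +
        (\<Sum>k\<le>n. real (Suc n choose Suc k) * hausdorff_diff m (i + Suc k) (n - k))"
    by (subst sum.atMost_Suc_shift) simp
  also have "\<dots> = hausdorff_diff m i (Suc n) +
        (\<Sum>k\<le>n. real (n choose Suc k) * hausdorff_diff m (i + Suc k) (n - k)) +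
        (\<Sum>k\<le>n. real (n choose k) * hausdorff_diff m (Suc i + k) (n - k))"
    by (simp add: algebra_simps sum.distrib)
  also have "hausdorff_diff m i (Suc n) +
        (\<Sum>k\<le>n. real (n choose Suc k) * hausdorff_diff m (i + Suc k) (n - k)) =
        (\<Sum>k\<le>Suc n. real (n choose k) * hausdorff_diff m (i + k) (Suc n - k))"
    by (subst sum.atMost_Suc_shift) simp
  also have "\<dots> = (\<Sum>k\<le>n. real (n choose k) * hausdorff_diff m (i + k) (Suc (n - k)))"
    by (simp add: Suc_diff_le)
  also have "\<dots> = (\<Sum>k\<le>n. real (n choose k) * hausdorff_diff m (i + k) (n - k)) -
        (\<Sum>k\<le>n. real (n choose k) * hausdorff_diff m (Suc i + k) (n - k))"
    by (simp add: hausdorff_diff_Suc algebra_simps sum_subtractf)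
  finally show ?case using Suc.IH by simp
qed

text \<open>The falling factorial merges with the binomial coefficient: \<open>(n choose k) (k
  choose r) = (n choose r) (n - r choose k - r)\<close>. What remains is the partition of unity of
  order \<open>n - r\<close> times \<open>x^r\<close>, so these moments are exact at every finite
  \<open>n\<close>.\<close>

lemma fact_moment_hausdorff_diff:
  assumes "r \<le> n"
  shows "(\<Sum>k\<le>n. real (n choose k) * hausdorff_diff m k (n - k) * (\<Prod>i<r. real k - real i))
       = (\<Prod>i<r. real n - real i) * m r"
proof -
  have ff: "(\<Prod>i<r. real k - real i) = fact r * real (k choose r)" for k
  proof -
    have "real (k choose r) = (real k gchoose r)" by (rule binomial_gbinomial)
    also have "\<dots> = (\<Prod>i = 0..<r. real k - real i) / fact r" by (simp add: gbinomial_prod_rev)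
    finally show ?thesis by (simp add: lessThan_atLeast0)
  qed
  have "(\<Sum>k\<le>n. real (n choose k) * hausdorff_diff m k (n - k) * (\<Prod>i<r. real k - real i))
     = (\<Sum>k\<in>{r..n}. real (n choose k) * hausdorff_diff m k (n - k) * (fact r * real (k choose r)))"
    unfolding ff by (rule sum.mono_neutral_right) auto
  also have "\<dots> = (\<Sum>k\<le>n-r. real (n choose (r+k)) * hausdorff_diff m (r+k) (n - (r+k)) * (fact r * real ((r+k) choose r)))"
    by (rule sum.reindex_bij_witness[of _ "\<lambda>k. r + k" "\<lambda>k. k - r"]) (use assms in auto)
  also have "\<dots> = (\<Sum>k\<le>n-r. fact r * real (n choose r) * (real ((n-r) choose k) * hausdorff_diff m (r+k) ((n-r) - k)))"
  proof (rule sum.cong[OF refl])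
    fix k assume "k \<in> {..n-r}"
    then have "(n choose (r+k)) * ((r+k) choose r) = (n choose r) * ((n - r) choose k)"
      using choose_mult[of r "r+k" n] assms by auto
    then have "real (n choose (r+k)) * real ((r+k) choose r) = real (n choose r) * real ((n - r) choose k)"
      by (metis of_nat_mult)
    then show "real (n choose (r+k)) * hausdorff_diff m (r+k) (n - (r+k)) * (fact r * real ((r+k) choose r))
       = fact r * real (n choose r) * (real ((n-r) choose k) * hausdorff_diff m (r+k) ((n-r) - k))"
      by (simp add: mult_ac)
  qed
  also have "\<dots> = fact r * real (n choose r) * m r"
    by (simp only: sum_distrib_left[symmetric] sum_choose_hausdorff_diff)
  finally show ?thesis by (simp add: ff)
qed

text \<open>All approximating measures live on [0,1], so a subsequence converges weakly. Their
  factorial moments of order \<open>k\<close>, rescaled by \<open>n^k\<close>, equal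
  \<open>m k\<close> up to a factor tending to 1 and differ from the power moments by
  O(1/n).\<close>

lemma hausdorff_moment_problem:
  assumes nonneg: "\<And>i j. 0 \<le> hausdorff_diff m i j" and m0: "m 0 = 1"
  obtains \<nu> :: "real measure" where "prob_space \<nu>" "sets \<nu> = sets borel"
    "AE x in \<nu>. x \<in> {0..1}" "\<And>k. (\<integral>x. x ^ k \<partial>\<nu>) = m k"
proof -
  define f where "f n k = (if k \<le> n then real (n choose k) * hausdorff_diff m k (n - k) else 0)" for n k
  define p where "p n = embed_pmf (f n)" for n
  define \<mu> where "\<mu> n = distr (measure_pmf (p n)) borel (\<lambda>k. real k / real n)" for n
  have f_nonneg: "0 \<le> f n k" for n k using nonneg by (simp add: f_def)
  have "(\<integral>\<^sup>+ k. ennreal (f n k) \<partial>count_space UNIV) = 1" for n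
  proof -
    have "(\<integral>\<^sup>+ k. ennreal (f n k) \<partial>count_space UNIV) = (\<Sum>k\<le>n. ennreal (f n k))"
      by (rule nn_integral_count_space') (auto simp: f_def)
    also have "\<dots> = ennreal (\<Sum>k\<le>n. f n k)"
      by (rule sum_ennreal) (rule f_nonneg)
    also have "(\<Sum>k\<le>n. f n k) = m 0"
      using sum_choose_hausdorff_diff[of n m 0] by (simp add: f_def)
    finally show ?thesis by (simp add: m0)
  qed
  then have pmf_p: "pmf (p n) k = f n k" for n k
    unfolding p_def by (intro pmf_embed_pmf f_nonneg)
  have set_p: "set_pmf (p n) \<subseteq> {..n}" for n
    by (auto simp: set_pmf_eq pmf_p f_def split: if_splits)
  have E\<mu>: "(\<integral>x. g x \<partial>\<mu> n) = (\<Sum>k\<le>n. f n k * g (real k / real n))"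
    if "g \<in> borel_measurable borel" for g :: "real \<Rightarrow> real" and n
  proof -
    have "(\<integral>x. g x \<partial>\<mu> n) = (\<integral>k. g (real k / real n) \<partial>measure_pmf (p n))"
      unfolding \<mu>_def using that by (intro integral_distr) auto
    also have "\<dots> = (\<Sum>k\<le>n. g (real k / real n) * pmf (p n) k)"
      by (rule integral_measure_pmf_real) (use set_p in auto)
    finally show ?thesis by (simp add: pmf_p mult.commute)
  qed
  have sum_f: "(\<Sum>k\<le>n. f n k) = 1" for n
    using sum_choose_hausdorff_diff[of n m 0] by (simp add: f_def m0)
  have rd: "real_distribution (\<mu> n)" for n
    unfolding \<mu>_def by (rule prob_space.real_distribution_distr) (auto intro: prob_space_measure_pmf)
  have in01: "real k / real n \<in> {0..1}" if "k \<le> n" for k n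
    using that by (auto simp: divide_simps)
  \<comment> \<open>Tightness is phrased with intervals open on the left, so the left end must lie
    strictly below 0 to catch a possible mass at 0.\<close>
  have "measure (\<mu> n) {-1<..1} = 1" for n
  proof -
    interpret real_distribution "\<mu> n" by (rule rd)
    have "measure (\<mu> n) {-1<..1} = (\<integral>x. indicator {-1<..1} x \<partial>\<mu> n)"
      by simp
    also have "\<dots> = (\<Sum>k\<le>n. f n k * indicator {-1<..1} (real k / real n))"
      by (rule E\<mu>) simp
    also have "\<dots> = (\<Sum>k\<le>n. f n k)"
    proof (rule sum.cong[OF refl])
      fix k assume "k \<in> {..n}"
      then have "0 \<le> real k / real n \<and> real k / real n \<le> 1" using in01[of k n] by auto
      then have "real k / real n \<in> {-1<..1}"
        unfolding greaterThanAtMost_iff by linarith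
      then show "f n k * indicator {-1<..1} (real k / real n) = f n k" by simp
    qed
    finally show ?thesis by (simp add: sum_f)
  qed
  then have "tight \<mu>"
    unfolding tight_def using rd by (intro conjI allI impI exI[of _ "-1"] exI[of _ "1"]) auto
  from tight_imp_convergent_subsubsequence[OF this, of id] obtain r \<nu> where
    r: "strict_mono (r :: nat \<Rightarrow> nat)" and \<nu>: "real_distribution \<nu>" and wc: "weak_conv_m (\<mu> \<circ> r) \<nu>"
    by (auto simp: strict_mono_def o_def)
  interpret \<nu>: real_distribution \<nu> by (rule \<nu>)
  \<comment> \<open>Weak convergence controls bounded continuous test functions only; clamping the
    argument makes the powers bounded without changing their integrals over measures on
    [0,1].\<close>
  define clamp where "clamp x = max 0 (min 1 x)" for x :: real
  have clamp01: "0 \<le> clamp x" "clamp x \<le> 1" for x by (auto simp: clamp_def)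
  have clamp_id: "clamp x = x" if "x \<in> {0..1}" for x using that by (auto simp: clamp_def)
  have clamp_cont: "isCont clamp x" for x
    unfolding clamp_def by (intro continuous_intros)
  have clamp_meas [measurable]: "clamp \<in> borel_measurable borel"
    unfolding clamp_def by measurable
  have conv: "(\<lambda>n. \<integral>x. g x \<partial>\<mu> (r n)) \<longlonglongrightarrow> (\<integral>x. g x \<partial>\<nu>)"
    if "\<And>x. isCont g x" "\<And>x. norm (g x) \<le> 1" for g :: "real \<Rightarrow> real"
    using weak_conv_imp_integral_bdd_continuous_conv[of "\<mu> \<circ> r" \<nu> g 1] rd \<nu> wc that by (simp add: o_def)
  have supp: "AE x in \<nu>. x \<in> {0..1}"
  proof -
    \<comment> \<open>A bounded continuous function vanishing exactly on [0,1]: its integral is 0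
      along the sequence, hence in the limit, and this confines the limit measure to [0,1].\<close>
    define g where "g x = min 1 \<bar>x - clamp x\<bar>" for x
    have gm [measurable]: "g \<in> borel_measurable borel" unfolding g_def by measurable
    have "(\<integral>x. g x \<partial>\<mu> n) = 0" for n
    proof -
      have "f n k * g (real k / real n) = 0" if "k \<le> n" for k
        using clamp_id[OF in01[OF that]] by (simp add: g_def)
      then show ?thesis by (subst E\<mu>) (auto intro!: sum.neutral simp del: mult_eq_0_iff)
    qed
    moreover have "(\<lambda>n. \<integral>x. g x \<partial>\<mu> (r n)) \<longlonglongrightarrow> (\<integral>x. g x \<partial>\<nu>)"
      by (rule conv) (auto simp: g_def intro!: continuous_intros clamp_cont)
    ultimately have "(\<integral>x. g x \<partial>\<nu>) = 0"
      by (simp add: LIMSEQ_const_iff)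
    moreover have "integrable \<nu> g"
      by (rule \<nu>.integrable_const_bound[of _ 1]) (auto simp: g_def)
    ultimately have "AE x in \<nu>. g x = 0"
      by (subst (asm) integral_nonneg_eq_0_iff_AE) (auto simp: g_def)
    then show ?thesis
      by eventually_elim (auto simp: g_def clamp_def min_def max_def split: if_splits)
  qed
  have mom: "(\<integral>x. x ^ k \<partial>\<nu>) = m k" for k
  proof -
    have E1: "(\<integral>x. clamp x ^ k \<partial>\<mu> n) = (\<Sum>j\<le>n. f n j * (real j / real n) ^ k)" for n
      by (subst E\<mu>) (auto intro!: sum.cong simp: clamp_id[OF in01])
    \<comment> \<open>The factorial moment over \<open>n^k\<close>, rewritten in the nodes
      \<open>j / n\<close>: its value is known exactly, and each of the \<open>k\<close> factors is
      within \<open>k / n\<close> of \<open>j / n\<close>.\<close>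
    define A where "A n = (\<Sum>j\<le>n. f n j * (\<Prod>i<k. real j / real n - real i / real n))" for n
    have A: "A n = (\<Prod>i<k. 1 - real i / real n) * m k" if "k \<le> n" "0 < n" for n
    proof -
      have *: "(\<Prod>i<k. x - real i / real n) = (\<Prod>i<k. real n * x - real i) / real n ^ k" for x
      proof -
        have "(\<Prod>i<k. x - real i / real n) = (\<Prod>i<k. (real n * x - real i) / real n)"
          using that by (intro prod.cong) (auto simp: field_simps)
        then show ?thesis by (simp add: prod_dividef)
      qed
      have "A n = (\<Sum>j\<le>n. f n j * (\<Prod>i<k. real j - real i)) / real n ^ k"
        using that unfolding A_def sum_divide_distrib by (intro sum.cong) (auto simp: *)
      also have "(\<Sum>j\<le>n. f n j * (\<Prod>i<k. real j - real i)) = (\<Prod>i<k. real n - real i) * m k"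
        unfolding fact_moment_hausdorff_diff[OF that(1), of m, symmetric] by (intro sum.cong) (auto simp: f_def)
      finally show ?thesis using *[of 1] by simp
    qed
    have bound: "norm ((\<integral>x. clamp x ^ k \<partial>\<mu> n) - A n) \<le> real k * real k / real n" if "k \<le> n" "0 < n" for n
    proof -
      have "norm ((\<integral>x. clamp x ^ k \<partial>\<mu> n) - A n) =
         norm (\<Sum>j\<le>n. f n j * ((real j / real n) ^ k - (\<Prod>i<k. real j / real n - real i / real n)))"
        unfolding E1 A_def by (simp add: sum_subtractf right_diff_distrib)
      also have "\<dots> \<le> (\<Sum>j\<le>n. f n j * (real k * real k / real n))"
      proof (rule sum_norm_le)
        fix j assume j: "j \<in> {..n}"
        \<comment> \<open>Products of factors of modulus at most 1 differ by at most the sum of the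
          differences of the factors; \<open>k <= n\<close> keeps the shifted factors in
          [-1,1].\<close>
        have "norm ((\<Prod>i<k. real j / real n) - (\<Prod>i<k. real j / real n - real i / real n))
            \<le> (\<Sum>i<k. norm (real j / real n - (real j / real n - real i / real n)))"
        proof (rule norm_prod_diff)
          fix i assume i: "i \<in> {..<k}"
          have a: "0 \<le> real j / real n" "real j / real n \<le> 1" using in01[of j n] j by auto
          have b: "0 \<le> real i / real n" "real i / real n \<le> 1" using in01[of i n] i that by auto
          show "norm (real j / real n) \<le> 1" using a by simp
          show "norm (real j / real n - real i / real n) \<le> 1" using a b by (simp only: real_norm_def abs_le_iff) linarith
        qed
        also have "\<dots> \<le> (\<Sum>i<k. real k / real n)"
          by (rule sum_mono) (use that in \<open>auto simp: divide_simps\<close>)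
        finally have "norm ((real j / real n) ^ k - (\<Prod>i<k. real j / real n - real i / real n)) \<le> real k * real k / real n"
          by simp
        then show "norm (f n j * ((real j / real n) ^ k - (\<Prod>i<k. real j / real n - real i / real n)))
           \<le> f n j * (real k * real k / real n)"
          unfolding real_norm_def abs_mult abs_of_nonneg[OF f_nonneg]
          by (intro mult_left_mono f_nonneg)
      qed
      also have "\<dots> = real k * real k / real n"
        by (simp only: sum_distrib_right[symmetric] sum_f mult_1_left)
      finally show ?thesis .
    qed
    have "(\<lambda>n. (\<integral>x. clamp x ^ k \<partial>\<mu> n) - A n) \<longlonglongrightarrow> 0"
    proof (rule Lim_null_comparison)
      show "\<forall>\<^sub>F n in sequentially. norm ((\<integral>x. clamp x ^ k \<partial>\<mu> n) - A n) \<le> real k * real k / real n"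
        using eventually_ge_at_top[of "Suc k"] by eventually_elim (use bound in auto)
      show "(\<lambda>n. real k * real k / real n) \<longlonglongrightarrow> 0" by real_asymp
    qed
    moreover have "A \<longlonglongrightarrow> m k"
    proof -
      have "(\<lambda>n. (\<Prod>i<k. 1 - real i / real n) * m k) \<longlonglongrightarrow> (\<Prod>i<k. 1) * m k"
      proof (intro tendsto_mult tendsto_prod tendsto_const)
        fix i show "(\<lambda>n. 1 - real i / real n) \<longlonglongrightarrow> 1" by real_asymp
      qed
      moreover have "\<forall>\<^sub>F n in sequentially. (\<Prod>i<k. 1 - real i / real n) * m k = A n"
        using eventually_ge_at_top[of "Suc k"] by eventually_elim (use A in auto)
      ultimately show ?thesis using Lim_transform_eventually by force
    qed
    ultimately have "(\<lambda>n. ((\<integral>x. clamp x ^ k \<partial>\<mu> n) - A n) + A n) \<longlonglongrightarrow> 0 + m k"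
      by (rule tendsto_add)
    then have "(\<lambda>n. \<integral>x. clamp x ^ k \<partial>\<mu> n) \<longlonglongrightarrow> m k" by simp
    then have "(\<lambda>n. \<integral>x. clamp x ^ k \<partial>\<mu> (r n)) \<longlonglongrightarrow> m k"
      using LIMSEQ_subseq_LIMSEQ[OF _ r] by (simp add: o_def)
    moreover have "(\<lambda>n. \<integral>x. clamp x ^ k \<partial>\<mu> (r n)) \<longlonglongrightarrow> (\<integral>x. clamp x ^ k \<partial>\<nu>)"
    proof (rule conv)
      fix x show "isCont (\<lambda>x. clamp x ^ k) x" by (intro continuous_intros clamp_cont)
      show "norm (clamp x ^ k) \<le> 1" using clamp01[of x] by (simp add: power_le_one)
    qed
    ultimately have "(\<integral>x. clamp x ^ k \<partial>\<nu>) = m k" by (rule LIMSEQ_unique[rotated])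
    moreover have "(\<integral>x. clamp x ^ k \<partial>\<nu>) = (\<integral>x. x ^ k \<partial>\<nu>)"
    proof (rule integral_cong_AE)
      show "AE x in \<nu>. clamp x ^ k = x ^ k"
        using supp by eventually_elim (simp add: clamp_id)
    qed simp_all
    ultimately show ?thesis by simp
  qed
  show thesis
    by (rule that[OF _ _ supp mom]) (simp_all add: \<nu>.prob_space_axioms)
qed

section \<open>Positivity of the Jacobi matrix\<close>

definition fin_supp :: "(nat \<Rightarrow> real) \<Rightarrow> bool" where
  "fin_supp v \<longleftrightarrow> finite {n. v n \<noteq> 0}"

text \<open>Meant for at least one finitely supported argument, where \<open>suminf\<close> is a
  finite sum; in this form index shifts amount to splitting off the first term.\<close>

definition finner :: "(nat \<Rightarrow> real) \<Rightarrow> (nat \<Rightarrow> real) \<Rightarrow> real" where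
  "finner u v = (\<Sum>n. u n * v n)"

text \<open>The case split is essential: \<open>n - 1\<close> truncates to 0 and would otherwise
  contribute a spurious \<open>s 0 * v 0\<close> to row 0.\<close>

definition tri_op :: "(nat \<Rightarrow> real) \<Rightarrow> (nat \<Rightarrow> real) \<Rightarrow> (nat \<Rightarrow> real) \<Rightarrow> nat \<Rightarrow> real" where
  "tri_op d s v n = (if n = 0 then 0 else s (n - 1) * v (n - 1)) + d n * v n + s n * v (Suc n)"

definition unit0 :: "nat \<Rightarrow> real" where "unit0 n = (if n = 0 then 1 else 0)"

lemma fin_supp_summable:
  assumes "fin_supp u" shows "summable (\<lambda>n. u n * v n)" "summable (\<lambda>n. v n * u n)"
  using assms by (auto intro!: summable_finite[of "{n. u n \<noteq> 0}"] simp: fin_supp_def)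

lemma fin_supp_unit0 [simp]: "fin_supp unit0"
  by (simp add: fin_supp_def unit0_def)

lemma fin_supp_shift: "fin_supp v \<Longrightarrow> fin_supp (\<lambda>n. s n * v (Suc n))"
  unfolding fin_supp_def
  by (rule finite_subset[of _ "(\<lambda>n. n - 1) ` {n. v n \<noteq> 0}"]) (auto intro!: image_eqI[of _ _ "Suc _"])

lemma fin_supp_unshift:
  "fin_supp v \<Longrightarrow> fin_supp (\<lambda>n. if n = 0 then 0 else s (n - 1) * v (n - 1))"
  unfolding fin_supp_def
  by (rule finite_subset[of _ "Suc ` {n. v n \<noteq> 0}"])
     (auto split: if_splits intro!: image_eqI[of _ _ "_ - 1"])

lemma fin_supp_mult: "fin_supp v \<Longrightarrow> fin_supp (\<lambda>n. d n * v n)"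
  unfolding fin_supp_def by (rule finite_subset[of _ "{n. v n \<noteq> 0}"]) auto

lemma fin_supp_add: "fin_supp u \<Longrightarrow> fin_supp v \<Longrightarrow> fin_supp (\<lambda>n. u n + v n)"
  unfolding fin_supp_def
  by (rule finite_subset[of _ "{n. u n \<noteq> 0} \<union> {n. v n \<noteq> 0}"]) auto

lemma fin_supp_tri_op: "fin_supp v \<Longrightarrow> fin_supp (tri_op d s v)"
  unfolding tri_op_def[abs_def] by (intro fin_supp_add fin_supp_mult fin_supp_shift fin_supp_unshift)

lemma finner_tri_op:
  assumes u: "fin_supp u" and v: "fin_supp v"
  shows "finner u (tri_op d s v) =
    (\<Sum>n. s n * (u (Suc n) * v n + u n * v (Suc n))) + (\<Sum>n. d n * (u n * v n))"
proof -
  have s1: "summable (\<lambda>n. u n * (if n = 0 then 0 else s (n - 1) * v (n - 1)))"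
    and s2: "summable (\<lambda>n. u n * (d n * v n))" and s3: "summable (\<lambda>n. u n * (s n * v (Suc n)))"
    by (rule fin_supp_summable[OF u])+
  have s4: "summable (\<lambda>n. u (Suc n) * (s n * v n))"
    using s1 by (subst (asm) summable_Suc_iff[symmetric]) simp
  have "finner u (tri_op d s v) = (\<Sum>n. u n * (if n = 0 then 0 else s (n - 1) * v (n - 1)))
      + (\<Sum>n. u n * (d n * v n)) + (\<Sum>n. u n * (s n * v (Suc n)))"
    unfolding finner_def tri_op_def
    by (simp add: distrib_left suminf_add[symmetric] s1 s2 s3 summable_add)
  also have "(\<Sum>n. u n * (if n = 0 then 0 else s (n - 1) * v (n - 1))) = (\<Sum>n. u (Suc n) * (s n * v n))"
    using suminf_split_head[OF s1] by simp
  also have "(\<Sum>n. u (Suc n) * (s n * v n)) + (\<Sum>n. u n * (d n * v n)) + (\<Sum>n. u n * (s n * v (Suc n)))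
     = (\<Sum>n. u (Suc n) * (s n * v n) + u n * (s n * v (Suc n))) + (\<Sum>n. u n * (d n * v n))"
    using suminf_add[OF s4 s3] by simp
  finally show ?thesis by (simp add: algebra_simps)
qed

lemma finner_commute: "finner u v = finner v u"
  by (simp add: finner_def mult.commute)

lemma finner_tri_op_sym:
  assumes "fin_supp u" and "fin_supp v"
  shows "finner u (tri_op d s v) = finner (tri_op d s u) v"
  unfolding finner_commute[of _ v] finner_tri_op[OF assms] finner_tri_op[OF assms(2,1)]
  by (simp add: algebra_simps)

text \<open>The matrix has a bidiagonal square root: the form is the sum over \<open>n\<close> of
  \<open>(sqrt (lam n) v_n + sqrt (mu (n+1)) v_(n+1))^2\<close>. These squares put
  \<open>lam 0\<close> alone into the first diagonal entry, which is why Model III modifies the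
  coefficient at 0.\<close>

lemma finner_tri_op_nonneg:
  assumes v: "fin_supp v"
    and lm: "\<And>n. 0 \<le> lam n" "\<And>n. 0 \<le> mu n"
    and d: "d 0 = lam 0" "\<And>n. d (Suc n) = lam (Suc n) + mu (Suc n)"
    and s: "\<And>n. s n = sqrt (lam n * mu (Suc n))"
  shows "0 \<le> finner v (tri_op d s v)"
proof -
  have square: "s n * (v (Suc n) * v n + v n * v (Suc n)) + (lam n * (v n * v n) + mu (Suc n) * (v (Suc n) * v (Suc n)))
      = (sqrt (lam n) * v n + sqrt (mu (Suc n)) * v (Suc n))\<^sup>2" for n
  proof -
    have "(sqrt (lam n) * v n + sqrt (mu (Suc n)) * v (Suc n))\<^sup>2 =
      (sqrt (lam n))\<^sup>2 * (v n * v n) + (sqrt (mu (Suc n)))\<^sup>2 * (v (Suc n) * v (Suc n))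
      + (sqrt (lam n) * sqrt (mu (Suc n))) * (v (Suc n) * v n + v n * v (Suc n))"
      by (simp add: power2_eq_square algebra_simps)
    then show ?thesis using lm by (simp add: s real_sqrt_mult)
  qed
  have "summable (\<lambda>n. (s n * v (Suc n)) * v n + (s n * v (Suc n)) * v n)"
    by (intro summable_add fin_supp_summable v)
  then have s1: "summable (\<lambda>n. s n * (v (Suc n) * v n + v n * v (Suc n)))"
    by (simp add: algebra_simps)
  have s2: "summable (\<lambda>n. d n * (v n * v n))"
    using fin_supp_summable(1)[OF v, of "\<lambda>n. d n * v n"] by (simp add: mult_ac)
  have s3: "summable (\<lambda>n. lam n * (v n * v n))"
    using fin_supp_summable(1)[OF v, of "\<lambda>n. lam n * v n"] by (simp add: mult_ac)
  have s4: "summable (\<lambda>n. mu n * (v n * v n))"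
    using fin_supp_summable(1)[OF v, of "\<lambda>n. mu n * v n"] by (simp add: mult_ac)
  have s5: "summable (\<lambda>n. mu (Suc n) * (v (Suc n) * v (Suc n)))"
    using s4 by (subst (asm) summable_Suc_iff[symmetric])
  have s6: "summable (\<lambda>n. lam (Suc n) * (v (Suc n) * v (Suc n)))"
    using s3 by (subst (asm) summable_Suc_iff[symmetric])
  have "(\<Sum>n. d n * (v n * v n)) = (\<Sum>n. d (Suc n) * (v (Suc n) * v (Suc n))) + lam 0 * (v 0 * v 0)"
    using suminf_split_head[OF s2] d by simp
  also have "(\<Sum>n. d (Suc n) * (v (Suc n) * v (Suc n))) = 
    (\<Sum>n. lam (Suc n) * (v (Suc n) * v (Suc n))) + (\<Sum>n. mu (Suc n) * (v (Suc n) * v (Suc n)))"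
    by (simp add: suminf_add[OF s6 s5] d algebra_simps)
  also have "\<dots> + lam 0 * (v 0 * v 0) = (\<Sum>n. lam n * (v n * v n)) + (\<Sum>n. mu (Suc n) * (v (Suc n) * v (Suc n)))"
    using suminf_split_head[OF s3] by simp
  finally have "finner v (tri_op d s v) = 
     (\<Sum>n. s n * (v (Suc n) * v n + v n * v (Suc n)) + (lam n * (v n * v n) + mu (Suc n) * (v (Suc n) * v (Suc n))))"
    unfolding finner_tri_op[OF v v]
    using suminf_add[OF s1 summable_add[OF s3 s5]] suminf_add[OF s3 s5] by simp
  also have "\<dots> = (\<Sum>n. (sqrt (lam n) * v n + sqrt (mu (Suc n)) * v (Suc n))\<^sup>2)"
    by (simp only: square)
  also have "\<dots> \<ge> 0"
  proof (rule suminf_nonneg)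
    have "summable (\<lambda>n. s n * (v (Suc n) * v n + v n * v (Suc n)) + (lam n * (v n * v n) + mu (Suc n) * (v (Suc n) * v (Suc n))))"
      by (intro summable_add s1 s3 s5)
    also have "(\<lambda>n. s n * (v (Suc n) * v n + v n * v (Suc n)) + (lam n * (v n * v n) + mu (Suc n) * (v (Suc n) * v (Suc n)))) = 
      (\<lambda>n. (sqrt (lam n) * v n + sqrt (mu (Suc n)) * v (Suc n))\<^sup>2)"
      by (simp only: square)
    finally show "summable (\<lambda>n. (sqrt (lam n) * v n + sqrt (mu (Suc n)) * v (Suc n))\<^sup>2)" .
  qed simp
  finally show ?thesis .
qed

lemma tri_op_diff: "tri_op d s (\<lambda>n. u n - v n) = (\<lambda>n. tri_op d s u n - tri_op d s v n)"
  by (auto simp: tri_op_def algebra_simps)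

lemma tri_op_add: "tri_op d s (\<lambda>n. u n + v n) = (\<lambda>n. tri_op d s u n + tri_op d s v n)"
  by (auto simp: tri_op_def algebra_simps)

lemma tri_op_cmult: "tri_op d s (\<lambda>n. r * v n) = (\<lambda>n. r * tri_op d s v n)"
  by (auto simp: tri_op_def algebra_simps)

lemma tri_op_compl: "tri_op (\<lambda>n. 1 - d n) (\<lambda>n. - s n) v = (\<lambda>n. v n - tri_op d s v n)"
  by (auto simp: tri_op_def algebra_simps)

text \<open>Conjugation by the diagonal matrix of alternating signs. It relates
  \<open>1 - J\<close>, whose off-diagonal entries are negative, to a genuine Jacobi matrix with the
  same entry at the origin.\<close>

lemma tri_op_flip:
  "tri_op d (\<lambda>n. - s n) (\<lambda>n. (-1) ^ n * v n) = (\<lambda>n. (-1) ^ n * tri_op d s v n)"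
proof
  fix n show "tri_op d (\<lambda>n. - s n) (\<lambda>n. (-1) ^ n * v n) n = (-1) ^ n * tri_op d s v n"
    by (cases n) (auto simp: tri_op_def algebra_simps)
qed

lemma tri_op_funpow_flip:
  "(tri_op d (\<lambda>n. - s n) ^^ k) (\<lambda>n. (-1) ^ n * v n) = (\<lambda>n. (-1) ^ n * (tri_op d s ^^ k) v n)"
  by (induction k) (simp_all add: tri_op_flip)

definition tri_moment :: "(nat \<Rightarrow> real) \<Rightarrow> (nat \<Rightarrow> real) \<Rightarrow> nat \<Rightarrow> real" where
  "tri_moment d s k = (tri_op d s ^^ k) unit0 0"

lemma tri_moment_flip: "tri_moment d (\<lambda>n. - s n) k = tri_moment d s k"
proof -
  have "(\<lambda>n. (-1) ^ n * unit0 n) = unit0" by (auto simp: unit0_def)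
  then show ?thesis
    using tri_op_funpow_flip[of k d s unit0] by (simp add: tri_moment_def)
qed

text \<open>The moment functional at \<open>x^i (1 - x)^j\<close> is the corner entry of
  \<open>J^i (1 - J)^j\<close>: the recursion for the differences is one more application of
  \<open>1 - J\<close>.\<close>

lemma hausdorff_diff_tri_moment:
  "hausdorff_diff (tri_moment d s) i j =
     (tri_op d s ^^ i) ((tri_op (\<lambda>n. 1 - d n) (\<lambda>n. - s n) ^^ j) unit0) 0"
proof (induction j arbitrary: i)
  case 0
  then show ?case by (simp add: tri_moment_def)
next
  case (Suc j)
  let ?w = "(tri_op (\<lambda>n. 1 - d n) (\<lambda>n. - s n) ^^ j) unit0"
  have *: "(tri_op d s ^^ i) (\<lambda>n. u n - v n) = (\<lambda>n. (tri_op d s ^^ i) u n - (tri_op d s ^^ i) v n)" for u v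
    by (induction i) (simp_all add: tri_op_diff)
  show ?case
    unfolding hausdorff_diff_Suc Suc.IH funpow.simps(2) o_apply
    by (subst (2) tri_op_compl) (simp add: * funpow_swap1)
qed

lemma finner_unit0: "finner unit0 v = v 0"
proof -
  have "(\<lambda>n. unit0 n * v n) = (\<lambda>n. if n = 0 then v 0 else 0)" by (auto simp: unit0_def)
  then show ?thesis using sums_single[of 0 "\<lambda>n. v 0"] by (simp add: finner_def sums_iff)
qed

lemma finner_self_nonneg: "fin_supp v \<Longrightarrow> 0 \<le> finner v v"
  unfolding finner_def by (intro suminf_nonneg fin_supp_summable) auto

lemma finner_add_right:
  "fin_supp u \<Longrightarrow> finner u (\<lambda>n. v n + w n) = finner u v + finner u w"
  unfolding finner_def by (simp add: distrib_left suminf_add fin_supp_summable)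

text \<open>\<open>T\<close> and \<open>N = 1 - T\<close> are symmetric and commute, so half of each
  exponent moves to the other side of the inner product. Only the parities of \<open>i\<close> and
  \<open>j\<close> remain, and the one case not covered by the hypotheses or by
  \<open>finner_self_nonneg\<close> is the product \<open>T N\<close>.\<close>

lemma hausdorff_diff_tri_moment_nonneg:
  assumes posT: "\<And>v. fin_supp v \<Longrightarrow> 0 \<le> finner v (tri_op d s v)"
    and posN: "\<And>v. fin_supp v \<Longrightarrow> 0 \<le> finner v (tri_op (\<lambda>n. 1 - d n) (\<lambda>n. - s n) v)"
  shows "0 \<le> hausdorff_diff (tri_moment d s) i j"
proof -
  define T where "T = tri_op d s"
  define N where "N = tri_op (\<lambda>n. 1 - d n) (\<lambda>n. - s n)"
  have N: "N v = (\<lambda>n. v n - T v n)" for v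
    unfolding N_def T_def by (rule tri_op_compl)
  have fsT: "fin_supp (T v)" and fsN: "fin_supp (N v)" if "fin_supp v" for v
    unfolding T_def N_def using that by (auto intro: fin_supp_tri_op)
  have fsTp: "fin_supp ((T ^^ i) v)" and fsNp: "fin_supp ((N ^^ i) v)" if "fin_supp v" for v i
    using that by (induction i) (auto intro: fsT fsN)
  have symT: "finner u (T v) = finner (T u) v" and symN: "finner u (N v) = finner (N u) v"
    if "fin_supp u" "fin_supp v" for u v
    unfolding T_def N_def using that by (auto intro: finner_tri_op_sym)
  have symTp: "finner u ((T ^^ i) v) = finner ((T ^^ i) u) v" if "fin_supp u" "fin_supp v" for u v i
    using that
  proof (induction i arbitrary: u)
    case (Suc i)
    have "finner u ((T ^^ Suc i) v) = finner (T u) ((T ^^ i) v)"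
      using Suc.prems by (simp add: symT fsTp)
    also have "\<dots> = finner ((T ^^ i) (T u)) v"
      by (rule Suc.IH) (use Suc.prems fsT in auto)
    finally show ?case by (simp add: funpow_swap1)
  qed simp
  have symNp: "finner u ((N ^^ i) v) = finner ((N ^^ i) u) v" if "fin_supp u" "fin_supp v" for u v i
    using that
  proof (induction i arbitrary: u)
    case (Suc i)
    have "finner u ((N ^^ Suc i) v) = finner (N u) ((N ^^ i) v)"
      using Suc.prems by (simp add: symN fsNp)
    also have "\<dots> = finner ((N ^^ i) (N u)) v"
      by (rule Suc.IH) (use Suc.prems fsN in auto)
    finally show ?case by (simp add: funpow_swap1)
  qed simp
  have comm: "T (N v) = N (T v)" for v
    unfolding N by (simp add: T_def tri_op_diff)
  have comm1: "T ((N ^^ j) v) = (N ^^ j) (T v)" for v j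
    by (induction j) (simp_all add: comm)
  have comm2: "(T ^^ i) ((N ^^ j) v) = (N ^^ j) ((T ^^ i) v)" for v i j
    by (induction i) (simp_all add: comm1)
  define p i' where "p = i div 2" and "i' = i mod 2"
  define q j' where "q = j div 2" and "j' = j mod 2"
  have i: "i = p + (i' + p)" and j: "j = q + (j' + q)"
    unfolding p_def i'_def q_def j'_def by presburger+
  define w where "w = (T ^^ p) ((N ^^ q) unit0)"
  have fsw: "fin_supp w" by (simp add: w_def fsTp fsNp)
  have "hausdorff_diff (tri_moment d s) i j = finner unit0 ((T ^^ i) ((N ^^ j) unit0))"
    by (simp add: hausdorff_diff_tri_moment finner_unit0 T_def N_def)
  also have "(T ^^ i) ((N ^^ j) unit0) = (T ^^ p) ((N ^^ q) ((T ^^ i') ((N ^^ j') w)))"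
    by (subst i, subst j) (simp add: funpow_add w_def comm2)
  also have "finner unit0 \<dots> = finner ((N ^^ q) ((T ^^ p) unit0)) ((T ^^ i') ((N ^^ j') w))"
    by (simp add: symTp symNp fsTp fsNp fsw)
  also have "(N ^^ q) ((T ^^ p) unit0) = w" by (simp add: w_def comm2)
  also have "0 \<le> finner w ((T ^^ i') ((N ^^ j') w))"
  proof -
    have "i' = 0 \<or> i' = 1" "j' = 0 \<or> j' = 1" by (auto simp: i'_def j'_def)
    moreover have "0 \<le> finner w (T (N w))"
    proof -
      \<comment> \<open>Since \<open>T + N = 1\<close>, one has \<open>T N = T N T + N T N\<close>,
        a sum of conjugates of positive operators. This avoids square roots of operators.\<close>
      have "w = (\<lambda>n. T w n + N w n)" by (simp add: N)
      then have "T (N w) = T (N (\<lambda>n. T w n + N w n))" by simp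
      also have "\<dots> = (\<lambda>n. T (N (T w)) n + N (T (N w)) n)"
        unfolding N_def T_def tri_op_add by (simp add: comm[unfolded N_def T_def])
      finally have eq: "T (N w) = (\<lambda>n. T (N (T w)) n + N (T (N w)) n)" .
      have "finner w (T (N w)) = finner w (T (N (T w))) + finner w (N (T (N w)))"
        by (subst eq) (simp only: finner_add_right[OF fsw])
      also have "\<dots> = finner (T w) (N (T w)) + finner (N w) (T (N w))"
        by (simp add: symT symN fsT fsN fsw)
      also have "\<dots> \<ge> 0"
        using posN[folded N_def, of "T w"] posT[folded T_def, of "N w"] fsw by (simp add: fsT fsN)
      finally show ?thesis .
    qed
    ultimately show ?thesis
      using finner_self_nonneg[OF fsw] posT[folded T_def, OF fsw] posN[folded N_def, OF fsw]
      by auto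
  qed
  finally show ?thesis .
qed

section \<open>The matrix \<open>J_III\<close>: sign structure and the symmetry in \<open>a\<close>
  and \<open>b\<close>\<close>

abbreviation (input) diag_III :: "real \<Rightarrow> real \<Rightarrow> real \<Rightarrow> nat \<Rightarrow> real" where
  "diag_III a b c \<equiv> \<lambda>n. J_III a b c n n"

abbreviation (input) off_III :: "real \<Rightarrow> real \<Rightarrow> real \<Rightarrow> nat \<Rightarrow> real" where
  "off_III a b c \<equiv> \<lambda>n. sqrt (lam_III a b c n * mu_III a b c (Suc n))"

lemma J_III_tri_op:
  "(\<Sum>l | J_III a b c i l \<noteq> 0. J_III a b c i l * v l) = tri_op (diag_III a b c) (off_III a b c) v i"
proof -
  have "(\<Sum>l | J_III a b c i l \<noteq> 0. J_III a b c i l * v l) = (\<Sum>l\<in>{i-1..Suc i}. J_III a b c i l * v l)"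
    by (rule sum.mono_neutral_left) (auto simp: J_III_def split: if_splits)
  also have "\<dots> = tri_op (diag_III a b c) (off_III a b c) v i"
  proof (cases i)
    case 0
    then show ?thesis by (simp add: tri_op_def J_III_def)
  next
    case (Suc j)
    have "{j..Suc (Suc j)} = {j, Suc j, Suc (Suc j)}" by auto
    then show ?thesis using Suc by (simp add: tri_op_def J_III_def)
  qed
  finally show ?thesis .
qed

lemma inf_mat_pow_J_III:
  "inf_mat_pow (J_III a b c) k i 0 = (tri_op (diag_III a b c) (off_III a b c) ^^ k) unit0 i"
proof (induction k arbitrary: i)
  case 0
  then show ?case by (simp add: unit0_def)
next
  case (Suc k)
  show ?case unfolding inf_mat_pow.simps Suc.IH J_III_tri_op by simp
qed

lemma lam_mu_III_nonneg:
  assumes "c \<ge> 0" "c + a > 0" "c + b > 0" "a \<ge> - 1" "b \<ge> - 1"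
  shows "0 \<le> lam_III a b c n" "0 \<le> mu_III a b c n"
proof -
  show "0 \<le> lam_III a b c n"
    using assms by (cases n) (auto simp: lam_III_def intro!: mult_nonneg_nonneg divide_nonneg_nonneg)
  show "0 \<le> mu_III a b c n"
    using assms by (auto simp: mu_III_def intro!: mult_nonneg_nonneg divide_nonneg_nonneg)
qed

text \<open>The reflection \<open>x \<mapsto> 1 - x\<close> of the spectrum exchanges \<open>a\<close> and \<open>b\<close>: up to the signs
  \<open>(-1)\<^sup>n\<close> of the basis vectors, \<open>1 - J_III a b c\<close> is \<open>J_III b a c\<close>.\<close>

lemma diag_III_flip:
  assumes "c \<ge> 0" "c + a > 0" "c + b > 0"
  shows "1 - J_III a b c n n = J_III b a c n n"
proof (cases n)
  case 0
  have "2 * c + a + b + 2 \<noteq> 0" using assms by linarith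
  then show ?thesis using 0 by (simp add: J_III_def lam_III_def field_simps)
next
  case (Suc k)
  define D where "D = 2 * real n + 2 * c + a + b"
  have D: "D > 0" using assms by (simp add: D_def)
  define x y where "x = real n + c" and "y = real n + c + a + b + 1"
  have lam: "lam_III a b c n = (x + a + 1) / (D + 2) * (y / (D + 1))"
    and mu: "mu_III a b c n = x / (D + 1) * ((x + b) / D)"
    and lam': "lam_III b a c n = (x + b + 1) / (D + 2) * (y / (D + 1))"
    and mu': "mu_III b a c n = x / (D + 1) * ((x + a) / D)"
    using Suc by (simp_all add: lam_III_def mu_III_def D_def x_def y_def algebra_simps)
  have e1: "(x + a + 1) + (x + b + 1) = D + 2" and e2: "(x + b) + (x + a) = D" and e3: "x + y = D + 1"
    by (simp_all add: x_def y_def D_def)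
  have "lam_III a b c n + lam_III b a c n = y / (D + 1)"
    "mu_III a b c n + mu_III b a c n = x / (D + 1)"
    unfolding lam mu lam' mu' distrib_right[symmetric] distrib_left[symmetric] add_divide_distrib[symmetric] e1 e2
    using D by simp_all
  moreover have "y / (D + 1) + x / (D + 1) = 1"
    using D e3 by (simp add: divide_simps)
  ultimately show ?thesis using Suc by (simp add: J_III_def)
qed

text \<open>\<open>lam_III\<close> at \<open>n\<close> brings the factor
  \<open>n + c + 1 + a\<close> and \<open>mu_III\<close> at \<open>n + 1\<close> the factor
  \<open>n + c + 1 + b\<close>, over the same denominator; all other factors are symmetric. Row 0 is
  separate because the modified coefficient has a single quotient.\<close>

lemma off_III_flip: "off_III a b c = off_III b a c"
proof
  fix n
  define D x where "D = 2 * real n + 2 * c + a + b" and "x = real n + c"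
  have mu: "mu_III a b c (Suc n) = (x + 1) / (D + 3) * ((x + 1 + b) / (D + 2))"
    "mu_III b a c (Suc n) = (x + 1) / (D + 3) * ((x + 1 + a) / (D + 2))"
    by (simp_all add: mu_III_def D_def x_def algebra_simps)
  have "lam_III a b c n * mu_III a b c (Suc n) = lam_III b a c n * mu_III b a c (Suc n)"
  proof (cases "n = 0")
    case True
    then have "lam_III a b c n = (x + 1 + a) / (D + 2)" "lam_III b a c n = (x + 1 + b) / (D + 2)"
      by (simp_all add: lam_III_def D_def x_def algebra_simps)
    then show ?thesis unfolding mu by simp
  next
    case False
    then have "lam_III a b c n = (x + 1 + a) / (D + 2) * ((x + a + b + 1) / (D + 1))"
       "lam_III b a c n = (x + 1 + b) / (D + 2) * ((x + a + b + 1) / (D + 1))"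
      by (simp_all add: lam_III_def D_def x_def algebra_simps)
    then show ?thesis unfolding mu by simp
  qed
  then show "sqrt (lam_III a b c n * mu_III a b c (Suc n)) = sqrt (lam_III b a c n * mu_III b a c (Suc n))"
    by simp
qed

lemma moments_III_nonneg:
  assumes "c \<ge> 0" "c + a > 0" "c + b > 0" "a \<ge> - 1" "b \<ge> - 1"
  shows "0 \<le> hausdorff_diff (\<lambda>k. inf_mat_pow (J_III a b c) k 0 0) i j"
proof -
  have eq: "(\<lambda>k. inf_mat_pow (J_III a b c) k 0 0) = tri_moment (diag_III a b c) (off_III a b c)"
    by (intro ext) (simp add: tri_moment_def inf_mat_pow_J_III)
  have pos: "0 \<le> finner v (tri_op (diag_III a b c) (off_III a b c) v)"
    if "fin_supp v" "c \<ge> 0" "c + a > 0" "c + b > 0" "a \<ge> - 1" "b \<ge> - 1" for v a b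
    by (rule finner_tri_op_nonneg[OF that(1), of "lam_III a b c" "mu_III a b c"])
       (use that lam_mu_III_nonneg[of c a b] in \<open>auto simp: J_III_def\<close>)
  show ?thesis
    unfolding eq
  proof (rule hausdorff_diff_tri_moment_nonneg)
    fix v assume v: "fin_supp v"
    show "0 \<le> finner v (tri_op (diag_III a b c) (off_III a b c) v)"
      using pos v assms by blast
    define v' where "v' n = (-1) ^ n * v n" for n
    have v': "fin_supp v'" unfolding v'_def by (rule fin_supp_mult[OF v])
    have "0 \<le> finner v' (tri_op (diag_III b a c) (off_III b a c) v')"
      using pos[OF v', of b a] assms by (simp add: add.commute)
    also have "tri_op (diag_III b a c) (off_III b a c) v' =
        (\<lambda>n. (-1) ^ n * tri_op (diag_III b a c) (\<lambda>n. - off_III b a c n) v n)"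
      unfolding v'_def using tri_op_flip[of "diag_III b a c" "\<lambda>n. - off_III b a c n" v] by simp
    also have "finner v' \<dots> = finner v (tri_op (diag_III b a c) (\<lambda>n. - off_III b a c n) v)"
      unfolding finner_def v'_def by (intro suminf_cong) (simp add: minus_one_power_iff)
    finally show "0 \<le> finner v (tri_op (\<lambda>n. 1 - diag_III a b c n) (\<lambda>n. - off_III a b c n) v)"
      by (simp only: diag_III_flip[OF assms(1-3)] off_III_flip[of a b c, THEN fun_cong])
  qed
qed

text \<open>With \<open>i = 0\<close> the differences are the moments of \<open>1 - x\<close>, that
  is of \<open>1 - J\<close>. This transports the absence of an atom from 0 to 1.\<close>

lemma moments_III_flip:
  assumes "c \<ge> 0" "c + a > 0" "c + b > 0"
  shows "hausdorff_diff (\<lambda>k. inf_mat_pow (J_III a b c) k 0 0) 0 j = inf_mat_pow (J_III b a c) j 0 0"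
proof -
  have "hausdorff_diff (\<lambda>k. inf_mat_pow (J_III a b c) k 0 0) 0 j
     = tri_moment (\<lambda>n. 1 - diag_III a b c n) (\<lambda>n. - off_III a b c n) j"
    using hausdorff_diff_tri_moment[of "diag_III a b c" "off_III a b c" 0 j]
    by (simp add: tri_moment_def[abs_def] inf_mat_pow_J_III)
  also have "\<dots> = tri_moment (diag_III b a c) (off_III b a c) j"
    unfolding tri_moment_flip off_III_flip[of a b c] by (simp only: diag_III_flip[OF assms])
  finally show ?thesis by (simp add: tri_moment_def inf_mat_pow_J_III)
qed

section \<open>Existence and uniqueness of the spectral measure\<close>

lemma spectral_measure_III_exists:
  assumes "c \<ge> 0" "c + a > 0" "c + b > 0" "a \<ge> - 1" "b \<ge> - 1"
  obtains \<nu> where "is_spectral_measure (J_III a b c) \<nu>" "AE x in \<nu>. x \<in> {0..1}"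
proof -
  obtain \<nu> :: "real measure" where \<nu>: "prob_space \<nu>" "sets \<nu> = sets borel"
    "AE x in \<nu>. x \<in> {0..1}" "\<And>k. (\<integral>x. x ^ k \<partial>\<nu>) = inf_mat_pow (J_III a b c) k 0 0"
    using hausdorff_moment_problem[OF moments_III_nonneg[OF assms]] by auto
  interpret prob_space \<nu> by fact
  have "integrable \<nu> (\<lambda>x. x ^ k)" for k
  proof (rule integrable_const_bound[of _ 1])
    show "AE x in \<nu>. norm (x ^ k) \<le> 1"
      using \<nu>(3) by eventually_elim (auto simp: power_le_one)
  qed (use \<nu>(2) in simp)
  then show thesis using \<nu> by (intro that[of \<nu>]) (auto simp: is_spectral_measure_def)
qed

text \<open>\<open>is_spectral_measure\<close> does not bound the support, so the competitor
  \<open>\<mu>\<close> is arbitrary. The moment bound is taken from \<open>\<nu>\<close>, and the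
  moments are shared.\<close>

lemma spectral_measure_unique:
  assumes \<nu>: "is_spectral_measure J \<nu>" and supp: "AE x in \<nu>. x \<in> {0..1}"
    and \<mu>: "is_spectral_measure J \<mu>"
  shows "\<mu> = \<nu>"
proof (rule sym, rule real_distribution_eqI_moments)
  interpret prob_space \<nu> using \<nu> by (simp add: is_spectral_measure_def)
  fix k
  have "(\<integral>x. x ^ (2 * k) \<partial>\<nu>) \<le> (\<integral>x. 1 \<partial>\<nu>)"
  proof (rule integral_mono_AE)
    show "AE x in \<nu>. x ^ (2 * k) \<le> 1"
      using supp by eventually_elim (auto intro: power_le_one)
  qed (use \<nu> in \<open>simp_all add: is_spectral_measure_def\<close>)
  then show "(\<integral>x. x ^ (2 * k) \<partial>\<nu>) \<le> 1" by (simp add: prob_space)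
qed (use \<nu> \<mu> in \<open>auto simp: is_spectral_measure_def\<close>)

section \<open>Euler integrals and the recurrence\<close>

definition euler_int :: "real \<Rightarrow> real \<Rightarrow> real \<Rightarrow> real \<Rightarrow> real" where
  "euler_int p q r s = integral {0..1} (\<lambda>t. t powr p * (1 - t) powr q * (s + t) powr (- r))"

lemma euler_int_integrand_continuous:
  assumes "0 < p" "0 < q" "0 < (s::real)"
  shows "continuous_on {0..1} (\<lambda>t. t powr p * (1 - t) powr q * (s + t) powr (- r))"
  using assms by (intro continuous_on_mult continuous_on_powr' continuous_intros) auto

lemma euler_int_has_integral:
  assumes "0 < p" "0 < q" "0 < s"
  shows "((\<lambda>t. t powr p * (1 - t) powr q * (s + t) powr (- r)) has_integral euler_int p q r s) {0..1}"
  unfolding euler_int_def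
  by (intro integrable_integral integrable_continuous_real euler_int_integrand_continuous assms)

lemma powr_add_one: "(x::real) \<ge> 0 \<Longrightarrow> x powr (p + 1) = x powr p * x"
  by (cases "x = 0") (simp_all add: powr_add)

text \<open>The integrand is the derivative of
  \<open>t\<^sup>p\<^sup>+\<^sup>1 (1 - t)\<^sup>q\<^sup>+\<^sup>1 (s + t)\<^sup>-\<^sup>r (l0 + l1 t + l2 t\<^sup>2)\<close>. All contiguous relations below are instances.\<close>

lemma euler_int_exact:
  fixes l0 l1 l2 :: real
  assumes "0 < p" "0 < q" "0 < s"
  shows "((\<lambda>t. t powr p * (1 - t) powr q * (s + t) powr (- (r + 1)) *
      ((((p + 1) * (1 - t) - (q + 1) * t) * (s + t) - r * t * (1 - t)) * (l0 + l1 * t + l2 * t\<^sup>2)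
        + (l1 + 2 * l2 * t) * t * (1 - t) * (s + t))) has_integral 0) {0..1}"
proof -
  define F where "F t = t powr (p + 1) * (1 - t) powr (q + 1) * (s + t) powr (- r) * (l0 + l1 * t + l2 * t\<^sup>2)" for t
  have "((\<lambda>t. t powr p * (1 - t) powr q * (s + t) powr (- (r + 1)) *
      ((((p + 1) * (1 - t) - (q + 1) * t) * (s + t) - r * t * (1 - t)) * (l0 + l1 * t + l2 * t\<^sup>2)
        + (l1 + 2 * l2 * t) * t * (1 - t) * (s + t))) has_integral F 1 - F 0) {0..1}"
  proof (rule fundamental_theorem_of_calculus_interior)
    show "continuous_on {0..1} F"
      unfolding F_def[abs_def] using assms
      by (intro continuous_on_mult continuous_on_powr' continuous_intros) auto
    fix t :: real assume t: "t \<in> {0<..<1}"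
    define X Y Z where "X = t powr p" and "Y = (1 - t) powr q" and "Z = (s + t) powr (- (r + 1))"
    have d1: "((\<lambda>t. t powr (p + 1)) has_real_derivative (p + 1) * X) (at t)"
      unfolding X_def using t by (auto intro!: derivative_eq_intros)
    have d2: "((\<lambda>t. (1 - t) powr (q + 1)) has_real_derivative - ((q + 1) * Y)) (at t)"
      unfolding Y_def using t by (auto intro!: derivative_eq_intros)
    have d3: "((\<lambda>t. (s + t) powr (- r)) has_real_derivative (- r) * Z) (at t)"
    proof -
      have "Z = (s + t) powr (- r - 1)"
        unfolding Z_def by (rule arg_cong[where f = "\<lambda>x. (s + t) powr x"]) simp
      then show ?thesis using t assms by (auto intro!: derivative_eq_intros)
    qed
    have d4: "((\<lambda>t. l0 + l1 * t + l2 * t\<^sup>2) has_real_derivative l1 + 2 * l2 * t) (at t)"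
      by (auto intro!: derivative_eq_intros)
    have e1: "t powr (p + 1) = X * t" and e2: "(1 - t) powr (q + 1) = Y * (1 - t)"
      unfolding X_def Y_def using t by (simp_all add: powr_add_one)
    have e3: "(s + t) powr (- r) = Z * (s + t)"
    proof -
      have "- (r + 1) + 1 = - r" by simp
      then show ?thesis
        unfolding Z_def using powr_add_one[of "s + t" "- (r + 1)"] t assms by (simp only:) simp
    qed
    have "(F has_real_derivative X * Y * Z *
      ((((p + 1) * (1 - t) - (q + 1) * t) * (s + t) - r * t * (1 - t)) * (l0 + l1 * t + l2 * t\<^sup>2)
        + (l1 + 2 * l2 * t) * t * (1 - t) * (s + t))) (at t)"
      unfolding F_def[abs_def]
      by (rule DERIV_cong[OF DERIV_mult[OF DERIV_mult[OF DERIV_mult[OF d1 d2] d3] d4]], unfold e1 e2 e3)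
         (simp add: algebra_simps power2_eq_square)
    then show "(F has_vector_derivative t powr p * (1 - t) powr q * (s + t) powr (- (r + 1)) *
      ((((p + 1) * (1 - t) - (q + 1) * t) * (s + t) - r * t * (1 - t)) * (l0 + l1 * t + l2 * t\<^sup>2)
        + (l1 + 2 * l2 * t) * t * (1 - t) * (s + t))) (at t)"
      unfolding X_def Y_def Z_def by (simp only: has_real_derivative_iff_has_vector_derivative)
  qed simp
  moreover have "F 1 - F 0 = 0" by (simp add: F_def)
  ultimately show ?thesis by simp
qed

text \<open>All integrands of the contiguous relations over one common factor, so that the relations
  become polynomial identities in \<open>t\<close>.\<close>

lemma euler_int_shift_integrands:
  assumes "t \<in> {0..1}" "0 < (s::real)"
  shows "t powr (p + 1) * (1 - t) powr (q + 1) * (s + t) powr (- (r + 1)) =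
      t powr p * (1 - t) powr q * (s + t) powr (- (r + 2)) * (t * (1 - t) * (s + t))"
    and "t powr p * (1 - t) powr q * (s + t) powr (- r) =
      t powr p * (1 - t) powr q * (s + t) powr (- (r + 2)) * (s + t)\<^sup>2"
    and "t powr p * (1 - t) powr q * (s + t) powr (- (r + 1)) =
      t powr p * (1 - t) powr q * (s + t) powr (- (r + 2)) * (s + t)"
    and "t powr (p + 1) * (1 - t) powr (q + 1) * (s + t) powr (- (r + 2)) =
      t powr p * (1 - t) powr q * (s + t) powr (- (r + 2)) * (t * (1 - t))"
    and "t powr (p + 2) * (1 - t) powr (q + 2) * (s + t) powr (- (r + 2)) =
      t powr p * (1 - t) powr q * (s + t) powr (- (r + 2)) * (t\<^sup>2 * (1 - t)\<^sup>2)"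
proof -
  have t: "0 \<le> t" "0 \<le> 1 - t" "0 \<le> s + t" using assms by auto
  have e: "- (r + 2) + 1 = - (r + 1)" "- (r + 1) + 1 = - r" by simp_all
  have a: "(s + t) powr (- (r + 1)) = (s + t) powr (- (r + 2)) * (s + t)"
    using powr_add_one[OF t(3), of "- (r + 2)"] unfolding e .
  have b: "(s + t) powr (- r) = (s + t) powr (- (r + 2)) * (s + t) * (s + t)"
    using powr_add_one[OF t(3), of "- (r + 1)"] unfolding e a .
  have c: "t powr (p + 1) = t powr p * t" "(1 - t) powr (q + 1) = (1 - t) powr q * (1 - t)"
    using t by (simp_all add: powr_add_one)
  have d: "t powr (p + 2) = t powr p * t * t" "(1 - t) powr (q + 2) = (1 - t) powr q * (1 - t) * (1 - t)"
    using powr_add_one[OF t(1), of "p + 1"] powr_add_one[OF t(2), of "q + 1"] c by (simp_all add: add.assoc)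
  show "t powr (p + 1) * (1 - t) powr (q + 1) * (s + t) powr (- (r + 1)) =
      t powr p * (1 - t) powr q * (s + t) powr (- (r + 2)) * (t * (1 - t) * (s + t))"
    "t powr p * (1 - t) powr q * (s + t) powr (- r) =
      t powr p * (1 - t) powr q * (s + t) powr (- (r + 2)) * (s + t)\<^sup>2"
    "t powr p * (1 - t) powr q * (s + t) powr (- (r + 1)) =
      t powr p * (1 - t) powr q * (s + t) powr (- (r + 2)) * (s + t)"
    "t powr (p + 1) * (1 - t) powr (q + 1) * (s + t) powr (- (r + 2)) =
      t powr p * (1 - t) powr q * (s + t) powr (- (r + 2)) * (t * (1 - t))"
    "t powr (p + 2) * (1 - t) powr (q + 2) * (s + t) powr (- (r + 2)) =
      t powr p * (1 - t) powr q * (s + t) powr (- (r + 2)) * (t\<^sup>2 * (1 - t)\<^sup>2)"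
    unfolding a b c d by (simp_all only: power2_eq_square mult_ac)
qed

text \<open>Row 0 of the recurrence. A constant polynomial suffices in
  \<open>euler_int_exact\<close>, and the value \<open>-1 / C\<close> normalises the coefficient of
  the first integral to 1.\<close>

lemma euler_int_rec_0:
  assumes p: "0 < p" "0 < q" "0 < s" and C: "C = p + q + 2" and r: "r \<ge> 0"
  shows "euler_int p q r s - (s + (p + 1) / C) * euler_int p q (r + 1) s + (r + 1) / C * euler_int (p + 1) (q + 1) (r + 2) s = 0"
proof -
  have C0: "C \<noteq> 0" using p C by auto
  let ?w = "\<lambda>t. t powr p * (1 - t) powr q * (s + t) powr (- (r + 2))"
  have "((\<lambda>t. t powr p * (1 - t) powr q * (s + t) powr (- r)
      - (s + (p + 1) / C) * (t powr p * (1 - t) powr q * (s + t) powr (- (r + 1)))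
      + (r + 1) / C * (t powr (p + 1) * (1 - t) powr (q + 1) * (s + t) powr (- (r + 2)))) has_integral
    euler_int p q r s - (s + (p + 1) / C) * euler_int p q (r + 1) s + (r + 1) / C * euler_int (p + 1) (q + 1) (r + 2) s) {0..1}"
    using p by (intro has_integral_add has_integral_diff has_integral_mult_right euler_int_has_integral) auto
  moreover have "((\<lambda>t. t powr p * (1 - t) powr q * (s + t) powr (- r)
      - (s + (p + 1) / C) * (t powr p * (1 - t) powr q * (s + t) powr (- (r + 1)))
      + (r + 1) / C * (t powr (p + 1) * (1 - t) powr (q + 1) * (s + t) powr (- (r + 2)))) has_integral 0) {0..1}"
  proof (rule has_integral_eq[OF _ euler_int_exact[OF p, of "r + 1" "- 1 / C" 0 0]])
    fix t :: real assume t: "t \<in> {0..1}"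
    have *: "((p + 1) * (1 - t) - (q + 1) * t) * (s + t) - (r + 1) * t * (1 - t)
       = - C * ((s + t)\<^sup>2 - (s + (p + 1) / C) * (s + t) + (r + 1) / C * (t * (1 - t)))"
    proof -
      have "- C * ((s + t)\<^sup>2 - (s + (p + 1) / C) * (s + t) + (r + 1) / C * (t * (1 - t)))
        = - C * (s + t)\<^sup>2 + (C * s + (p + 1)) * (s + t) - (r + 1) * (t * (1 - t))"
        using C0 by (simp add: field_simps)
      then show ?thesis unfolding C by (simp add: algebra_simps power2_eq_square)
    qed
    have "?w t * ((((p + 1) * (1 - t) - (q + 1) * t) * (s + t) - (r + 1) * t * (1 - t)) * (- 1 / C))
       = ?w t * ((s + t)\<^sup>2 - (s + (p + 1) / C) * (s + t) + (r + 1) / C * (t * (1 - t)))"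
      unfolding * using C0 by simp
    also have "\<dots> = t powr p * (1 - t) powr q * (s + t) powr (- r)
      - (s + (p + 1) / C) * (t powr p * (1 - t) powr q * (s + t) powr (- (r + 1)))
      + (r + 1) / C * (t powr (p + 1) * (1 - t) powr (q + 1) * (s + t) powr (- (r + 2)))"
    proof -
      have "W * (x - u * y + v * z) = W * x - u * (W * y) + v * (W * z)" for W x u y v z :: real
        by algebra
      then show ?thesis unfolding euler_int_shift_integrands(2-4)[OF t p(3), of p q r] .
    qed
    finally have fin: "?w t * ((((p + 1) * (1 - t) - (q + 1) * t) * (s + t) - (r + 1) * t * (1 - t)) * (- 1 / C)) = \<dots>" .
    have r2: "r + 1 + 1 = r + 2" by simp
    show "t powr p * (1 - t) powr q * (s + t) powr (- (r + 1 + 1)) *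
      ((((p + 1) * (1 - t) - (q + 1) * t) * (s + t) - (r + 1) * t * (1 - t)) * (- 1 / C + 0 * t + 0 * t\<^sup>2)
        + (0 + 2 * 0 * t) * t * (1 - t) * (s + t)) = t powr p * (1 - t) powr q * (s + t) powr (- r)
      - (s + (p + 1) / C) * (t powr p * (1 - t) powr q * (s + t) powr (- (r + 1)))
      + (r + 1) / C * (t powr (p + 1) * (1 - t) powr (q + 1) * (s + t) powr (- (r + 2)))"
      by (simp only: r2 mult_zero_left mult_zero_right add_0_right fin)
  qed
  ultimately show ?thesis by (rule has_integral_unique)
qed

text \<open>The coefficients \<open>l0\<close>, \<open>l1\<close>, \<open>l2\<close> come from comparing the powers \<open>t\<^sup>0\<close>, \<open>t\<^sup>1\<close>, \<open>t\<^sup>4\<close>.\<close>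

lemma euler_int_rec_Suc_poly:
  fixes A B r s t :: real
  assumes S: "S = A + B" "S > 0"
  defines "d \<equiv> (A + 1) * (S - r + 2) / ((S + 2) * (S + 1)) + (r - 1) * B / (S * (S + 1))"
    and "\<sigma> \<equiv> (S - r + 2) * r / ((S + 2) * (S + 1))"
    and "l0 \<equiv> - s * B / (S * (S + 1))"
    and "l1 \<equiv> s / (S + 1) + (S - r + 2) / ((S + 2) * (S + 1)) - B / (S * (S + 1))"
    and "l2 \<equiv> r / ((S + 1) * (S + 2))"
  shows "((A * (1 - t) - B * t) * (s + t) - r * t * (1 - t)) * (l0 + l1 * t + l2 * t\<^sup>2)
        + (l1 + 2 * l2 * t) * t * (1 - t) * (s + t)
      = - (A * B / (S * (S + 1))) * (s + t)\<^sup>2 + (s + d) * (t * (1 - t) * (s + t)) - \<sigma> * (t\<^sup>2 * (1 - t)\<^sup>2)"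
proof -
  \<comment> \<open>The common denominator: multiplying by it leaves a polynomial identity.\<close>
  define k where "k = S * (S + 1) * (S + 2)"
  have nz: "S \<noteq> 0" "S + 1 \<noteq> 0" "S + 2 \<noteq> 0" "k \<noteq> 0" using S by (auto simp: k_def)
  have k_eq: "k = S * ((S + 2) * (S + 1))" "k = (S + 2) * (S * (S + 1))"
      "k = S * ((S + 1) * (S + 2))" "k = S * (S + 2) * (S + 1)"
    by (simp_all add: k_def)
  have mul: "k * (u / ((S + 2) * (S + 1))) = S * u" "k * (u / (S * (S + 1))) = (S + 2) * u"
      "k * (u / ((S + 1) * (S + 2))) = S * u" "k * (u / (S + 1)) = S * (S + 2) * u" for u
    by (subst k_eq(1), use nz in simp, subst k_eq(2), use nz in simp, subst k_eq(3), use nz in simp,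
        subst k_eq(4), use nz in simp)
  have kd: "k * d = S * ((A + 1) * (S - r + 2)) + (S + 2) * ((r - 1) * B)"
    unfolding d_def distrib_left[of k] mul ..
  have ks: "k * \<sigma> = S * ((S - r + 2) * r)"
    unfolding \<sigma>_def mul ..
  have k0: "k * l0 = - (S + 2) * (s * B)"
    unfolding l0_def mul by algebra
  have k1: "k * l1 = S * (S + 2) * s + S * (S - r + 2) - (S + 2) * B"
    unfolding l1_def right_diff_distrib[of k] distrib_left[of k] mul ..
  have k2: "k * l2 = S * r"
    unfolding l2_def mul ..
  have kab: "k * (A * B / (S * (S + 1))) = (S + 2) * (A * B)"
    unfolding mul ..
  have "k * (((A * (1 - t) - B * t) * (s + t) - r * t * (1 - t)) * (l0 + l1 * t + l2 * t\<^sup>2)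
        + (l1 + 2 * l2 * t) * t * (1 - t) * (s + t)) =
     ((A * (1 - t) - B * t) * (s + t) - r * t * (1 - t)) * (k * l0 + (k * l1) * t + (k * l2) * t\<^sup>2)
        + (k * l1 + 2 * (k * l2) * t) * t * (1 - t) * (s + t)"
    by algebra
  also have "\<dots> = - ((S + 2) * (A * B)) * (s + t)\<^sup>2 + (k * s + k * d) * (t * (1 - t) * (s + t)) - (k * \<sigma>) * (t\<^sup>2 * (1 - t)\<^sup>2)"
    unfolding kd ks k0 k1 k2 unfolding k_def S(1) by algebra
  also have "\<dots> = k * (- (A * B / (S * (S + 1))) * (s + t)\<^sup>2 + (s + d) * (t * (1 - t) * (s + t)) - \<sigma> * (t\<^sup>2 * (1 - t)\<^sup>2))"
    unfolding kab[symmetric] by algebra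
  finally show ?thesis using nz(4) by simp
qed

text \<open>The rows \<open>n >= 1\<close>. Over the common factor the three integrands are
  \<open>(s + t)^2\<close>, \<open>t (1 - t) (s + t)\<close> and \<open>t^2 (1 - t)^2\<close>, and
  \<open>euler_int_rec_Suc_poly\<close> identifies their combination with an exact
  derivative.\<close>

lemma euler_int_rec_Suc:
  assumes p: "0 < p" "0 < q" "0 < s"
    and A: "A = p + 1" and B: "B = q + 1" and S: "S = A + B"
  shows "- (A * B / (S * (S + 1))) * euler_int p q r s
     + (s + ((A + 1) * (S - (r + 1) + 2) / ((S + 2) * (S + 1)) + r * B / (S * (S + 1)))) * euler_int (p + 1) (q + 1) (r + 1) s
     - (S - (r + 1) + 2) * (r + 1) / ((S + 2) * (S + 1)) * euler_int (p + 2) (q + 2) (r + 2) s = 0"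
proof -
  let ?w = "\<lambda>t. t powr p * (1 - t) powr q * (s + t) powr (- (r + 2))"
  let ?d = "(A + 1) * (S - (r + 1) + 2) / ((S + 2) * (S + 1)) + r * B / (S * (S + 1))"
  let ?g = "(S - (r + 1) + 2) * (r + 1) / ((S + 2) * (S + 1))"
  let ?l0 = "- s * B / (S * (S + 1))"
  let ?l1 = "s / (S + 1) + (S - (r + 1) + 2) / ((S + 2) * (S + 1)) - B / (S * (S + 1))"
  let ?l2 = "(r + 1) / ((S + 1) * (S + 2))"
  let ?f = "\<lambda>t. - (A * B / (S * (S + 1))) * (t powr p * (1 - t) powr q * (s + t) powr (- r))
      + (s + ?d) * (t powr (p + 1) * (1 - t) powr (q + 1) * (s + t) powr (- (r + 1)))
      - ?g * (t powr (p + 2) * (1 - t) powr (q + 2) * (s + t) powr (- (r + 2)))"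
  have "(?f has_integral - (A * B / (S * (S + 1))) * euler_int p q r s
     + (s + ?d) * euler_int (p + 1) (q + 1) (r + 1) s - ?g * euler_int (p + 2) (q + 2) (r + 2) s) {0..1}"
    using p by (intro has_integral_add has_integral_diff has_integral_mult_right euler_int_has_integral) auto
  moreover have "(?f has_integral 0) {0..1}"
  proof (rule has_integral_eq[OF _ euler_int_exact[OF p, of "r + 1" ?l0 ?l1 ?l2]])
    fix t :: real assume t: "t \<in> {0..1}"
    have S0: "S > 0" using p A B S by simp
    have "?f t = ?w t * (- (A * B / (S * (S + 1))) * (s + t)\<^sup>2 + (s + ?d) * (t * (1 - t) * (s + t)) - ?g * (t\<^sup>2 * (1 - t)\<^sup>2))"
    proof -
      have "- v * (W * x) + u * (W * y) - g * (W * z) = W * (- v * x + u * y - g * z)" for W x u y v z g :: real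
        by algebra
      then show ?thesis
        unfolding euler_int_shift_integrands(1)[OF t p(3), of p q r] euler_int_shift_integrands(2)[OF t p(3), of p q r] euler_int_shift_integrands(5)[OF t p(3), of p q r] .
    qed
    also have "\<dots> = ?w t * (((A * (1 - t) - B * t) * (s + t) - (r + 1) * t * (1 - t)) * (?l0 + ?l1 * t + ?l2 * t\<^sup>2)
        + (?l1 + 2 * ?l2 * t) * t * (1 - t) * (s + t))"
      unfolding euler_int_rec_Suc_poly[OF S S0, of t s "r + 1"] by (simp only: add_diff_cancel_right')
    finally have fin: "?w t * (((A * (1 - t) - B * t) * (s + t) - (r + 1) * t * (1 - t)) * (?l0 + ?l1 * t + ?l2 * t\<^sup>2)
        + (?l1 + 2 * ?l2 * t) * t * (1 - t) * (s + t)) = ?f t" by (rule sym)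
    have r2: "r + 1 + 1 = r + 2" by simp
    show "t powr p * (1 - t) powr q * (s + t) powr (- (r + 1 + 1)) *
      ((((p + 1) * (1 - t) - (q + 1) * t) * (s + t) - (r + 1) * t * (1 - t)) * (?l0 + ?l1 * t + ?l2 * t\<^sup>2)
        + (?l1 + 2 * ?l2 * t) * t * (1 - t) * (s + t)) = ?f t"
      using fin by (simp only: r2 A B)
  qed
  ultimately show ?thesis by (rule has_integral_unique)
qed

section \<open>Size of the matrix entries and of the recessive solution\<close>

lemma diag_III_bounds:
  assumes "c \<ge> 0" "c + a > 0" "c + b > 0" "a \<ge> - 1" "b \<ge> - 1"
  shows "0 \<le> J_III a b c n n" "J_III a b c n n \<le> 1"
proof -
  have *: "0 \<le> J_III a b c n n" if "c \<ge> 0" "c + a > 0" "c + b > 0" "a \<ge> - 1" "b \<ge> - 1" for a b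
    using lam_mu_III_nonneg[OF that] by (simp add: J_III_def)
  show "0 \<le> J_III a b c n n" using * assms by simp
  have "0 \<le> J_III b a c n n" using * assms by simp
  then show "J_III a b c n n \<le> 1" using diag_III_flip[OF assms(1-3), of n] by linarith
qed

lemma off_III_bounds:
  assumes "c \<ge> 0" "c + a > 0" "c + b > 0" "a \<ge> - 1" "b \<ge> - 1"
  shows "0 \<le> off_III a b c n" "off_III a b c n \<le> 1"
proof -
  have nn: "0 \<le> lam_III a b c n" "0 \<le> mu_III a b c n" for n using lam_mu_III_nonneg[OF assms] by auto
  have "lam_III a b c n \<le> 1"
    using diag_III_bounds(2)[OF assms, of n] nn(2)[of n] by (auto simp: J_III_def split: if_splits)
  moreover have "mu_III a b c (Suc n) \<le> 1"
    using diag_III_bounds(2)[OF assms, of "Suc n"] nn(1)[of "Suc n"] by (auto simp: J_III_def)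
  ultimately show "off_III a b c n \<le> 1" using nn by (simp add: mult_le_one)
  show "0 \<le> off_III a b c n" using nn by simp
qed

lemma euler_int_nonneg:
  assumes "0 < p" "0 < q" "0 < s"
  shows "0 \<le> euler_int p q r s"
  by (rule has_integral_nonneg[OF euler_int_has_integral[OF assms]]) auto

text \<open>Pointwise \<open>t (1 - t) / (s + t) <= 1 / s\<close>: raising all three exponents gains
  a factor \<open>1 / s\<close>, which for large \<open>s\<close> beats the growth of
  \<open>kap_III\<close>.\<close>

lemma euler_int_shift_le:
  assumes "0 < p" "0 < q" "0 < s"
  shows "euler_int (p + 1) (q + 1) (r + 1) s \<le> euler_int p q r s / s"
proof -
  have "euler_int (p + 1) (q + 1) (r + 1) s \<le> euler_int p q r s * (1 / s)"
  proof (rule has_integral_le[OF euler_int_has_integral has_integral_mult_left[OF euler_int_has_integral[OF assms]]])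
    fix t :: real assume t: "t \<in> {0..1}"
    have "t * (1 - t) * s \<le> 1 * (s + t)"
    proof -
      have "t * (1 - t) \<le> 1 * 1" using t by (intro mult_mono) auto
      then have "t * (1 - t) * s \<le> 1 * s" using assms by (intro mult_right_mono) auto
      then show ?thesis using t by auto
    qed
    then have le: "t * (1 - t) / (s + t) \<le> 1 / s"
      using t assms by (simp add: divide_simps mult.commute)
    have "(s + t) powr (- r) = (s + t) powr (- (r + 1)) * (s + t)"
      using powr_add_one[of "s + t" "- (r + 1)"] t assms by simp
    then have "(s + t) powr (- (r + 1)) = (s + t) powr (- r) / (s + t)"
      using t assms by simp
    then have "t powr (p + 1) * (1 - t) powr (q + 1) * (s + t) powr (- (r + 1)) =
       t powr p * (1 - t) powr q * (s + t) powr (- r) * (t * (1 - t) / (s + t))"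
      using t by (simp add: powr_add_one)
    also have "\<dots> \<le> t powr p * (1 - t) powr q * (s + t) powr (- r) * (1 / s)"
      by (intro mult_left_mono le) auto
    finally show "t powr (p + 1) * (1 - t) powr (q + 1) * (s + t) powr (- (r + 1))
      \<le> t powr p * (1 - t) powr q * (s + t) powr (- r) * (1 / s)" .
  qed (use assms in auto)
  then show ?thesis by simp
qed

text \<open>The reciprocal of the coefficient \<open>A * B / (S * (S + 1))\<close> of the lowest
  integral in \<open>euler_int_rec_Suc\<close>, taken for row \<open>n + 1\<close>.\<close>

definition rho_III :: "real \<Rightarrow> real \<Rightarrow> real \<Rightarrow> nat \<Rightarrow> real" where
  "rho_III a b c n = (2 * c + a + b + 2 + 2 * real n) * (2 * c + a + b + 3 + 2 * real n) /
     ((c + a + 1 + real n) * (c + b + 1 + real n))"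

fun kap_III :: "real \<Rightarrow> real \<Rightarrow> real \<Rightarrow> nat \<Rightarrow> real" where
  "kap_III a b c 0 = 1"
| "kap_III a b c (Suc n) = - kap_III a b c n * off_III a b c n * rho_III a b c n"

text \<open>The recessive solution of the recurrence; the factors \<^term>\<open>kap_III\<close> are dictated by
  the contiguous relations \<open>euler_int_rec_0\<close> and \<open>euler_int_rec_Suc\<close>.\<close>

definition psi_III :: "real \<Rightarrow> real \<Rightarrow> real \<Rightarrow> real \<Rightarrow> nat \<Rightarrow> real" where
  "psi_III a b c s n = kap_III a b c n * euler_int (c + a + real n) (c + b + real n) (c + 1 + real n) s"

text \<open>Row 0 has no lower neighbour, so the lowest integral of its contiguous relation is left
  over as the inhomogeneity. \<open>kap_III\<close> carries one off-diagonal factor per step: the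
  coupling to the next row then contains its square, which is rational, and the coupling to the
  previous row contains none.\<close>

lemma psi_III_recurrence:
  assumes c: "c \<ge> 0" "c + a > 0" "c + b > 0" "a \<ge> - 1" "b \<ge> - 1" and s: "s > 0"
  shows "tri_op (diag_III a b c) (off_III a b c) (psi_III a b c s) n
     = euler_int (c + a) (c + b) c s * unit0 n - s * psi_III a b c s n"
proof -
  define S where "S = 2 * c + a + b + 2 * real n"
  have nn: "0 \<le> lam_III a b c n" "0 \<le> mu_III a b c n" for n using lam_mu_III_nonneg[OF c] by auto
  have off2: "off_III a b c n * (off_III a b c n * x) = lam_III a b c n * mu_III a b c (Suc n) * x" for n x
    using nn by (simp flip: mult.assoc)
  show ?thesis
  proof (cases n)
    case 0
    let ?E0 = "euler_int (c + a) (c + b) (c + 1) s" and ?E1 = "euler_int (c + a + 1) (c + b + 1) (c + 2) s"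
    let ?C = "2 * c + a + b + 2"
    have C0: "?C > 0" "?C + 1 > 0" "c + a + 1 > 0" "c + b + 1 > 0" using c by linarith+
    have eq: "lam_III a b c 0 * mu_III a b c (Suc 0) * rho_III a b c 0 = (c + 1) / ?C"
    proof -
      have "lam_III a b c 0 = (c + a + 1) / ?C" "mu_III a b c (Suc 0) = (c + 1) / (?C + 1) * ((c + b + 1) / ?C)"
        "rho_III a b c 0 = (?C / (c + a + 1)) * ((?C + 1) / (c + b + 1))"
        by (simp_all add: lam_III_def mu_III_def rho_III_def algebra_simps)
      then show ?thesis using C0 by simp
    qed
    have "euler_int (c + a) (c + b) c s - (s + (c + a + 1) / ?C) * ?E0 + (c + 1) / ?C * ?E1 = 0"
      by (rule euler_int_rec_0) (use c s in auto)
    moreover have "tri_op (diag_III a b c) (off_III a b c) (psi_III a b c s) n =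
       (c + a + 1) / ?C * ?E0 - (lam_III a b c 0 * mu_III a b c (Suc 0) * rho_III a b c 0) * ?E1"
    proof -
      have "off_III a b c 0 * (kap_III a b c (Suc 0) * x) = - (lam_III a b c 0 * mu_III a b c (Suc 0) * rho_III a b c 0) * x" for x
        using off2[of 0 "rho_III a b c 0 * x"] by (simp add: mult.assoc)
      moreover have "psi_III a b c s (Suc 0) = kap_III a b c (Suc 0) * ?E1"
        by (simp add: psi_III_def add_ac del: kap_III.simps)
      ultimately have "off_III a b c 0 * psi_III a b c s (Suc 0) = - (lam_III a b c 0 * mu_III a b c (Suc 0) * rho_III a b c 0) * ?E1"
        by (simp only:)
      moreover have "psi_III a b c s 0 = ?E0" by (simp add: psi_III_def)
      moreover have "J_III a b c 0 0 = (c + a + 1) / ?C" by (simp add: J_III_def lam_III_def)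
      ultimately show ?thesis using 0 by (simp add: tri_op_def)
    qed
    moreover have "psi_III a b c s 0 = ?E0" by (simp add: psi_III_def)
    ultimately show ?thesis unfolding eq using 0 by (simp add: unit0_def algebra_simps)
  next
    case (Suc m)
    define p q r where "p = c + a + real m" and "q = c + b + real m" and "r = c + 1 + real m"
    have p: "p > 0" "q > 0" using c by (auto simp: p_def q_def)
    have Sp: "S = (p + 1) + (q + 1)" using Suc by (simp add: S_def p_def q_def)
    have S0: "S > 0" using p Sp by simp
    have k: "kap_III a b c n = - kap_III a b c m * off_III a b c m * rho_III a b c m" using Suc by simp
    have rho: "rho_III a b c m = S * (S + 1) / ((p + 1) * (q + 1))"
      by (simp add: rho_III_def S_def p_def q_def Suc algebra_simps)
    have eq1: "off_III a b c m * (kap_III a b c m * x) = - kap_III a b c n * ((p + 1) * (q + 1) / (S * (S + 1)) * x)" for x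
      unfolding k rho using p S0 by simp
    have lamn: "lam_III a b c n = (p + 1 + 1) * (S - (r + 1) + 2) / ((S + 2) * (S + 1))"
      and mun: "mu_III a b c n = r * (q + 1) / (S * (S + 1))"
      by (simp_all add: lam_III_def mu_III_def S_def p_def q_def r_def Suc algebra_simps)
    have eq2: "off_III a b c n * (kap_III a b c (Suc n) * x) = - kap_III a b c n * ((S - (r + 1) + 2) * (r + 1) / ((S + 2) * (S + 1)) * x)" for x
    proof -
      have muS: "mu_III a b c (Suc n) = (r + 1) / (S + 3) * ((q + 2) / (S + 2))"
        by (simp add: mu_III_def S_def q_def r_def Suc algebra_simps)
      have rhon: "rho_III a b c n = ((S + 2) * (S + 3)) / ((p + 2) * (q + 2))"
        by (simp add: rho_III_def S_def p_def q_def Suc algebra_simps)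
      have lam': "lam_III a b c n = (p + 2) * (S - (r + 1) + 2) / ((S + 2) * (S + 1))"
        unfolding lamn by (simp add: add.assoc)
      have "off_III a b c n * (kap_III a b c (Suc n) * x) = - kap_III a b c n * (lam_III a b c n * mu_III a b c (Suc n) * (rho_III a b c n * x))"
        unfolding off2[symmetric] by (simp add: mult.left_commute mult.commute)
      also have "lam_III a b c n * mu_III a b c (Suc n) * (rho_III a b c n * x) = (S - (r + 1) + 2) * (r + 1) / ((S + 2) * (S + 1)) * x"
      proof -
        have nz: "p + 2 \<noteq> 0" "q + 2 \<noteq> 0" "S + 2 \<noteq> 0" "S + 3 \<noteq> 0" "S + 1 \<noteq> 0" using p S0 by auto
        have "P * T / (S2 * S1) * (R / S3 * (Q / S2)) * (S2 * S3 / (P * Q) * x) = T * R / (S2 * S1) * x"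
          if "P \<noteq> 0" "Q \<noteq> 0" "S2 \<noteq> 0" "S3 \<noteq> 0" "S1 \<noteq> 0" for P Q S1 S2 S3 T R :: real
          using that by (simp add: field_simps)
        from this[OF nz] show ?thesis unfolding muS rhon lam' .
      qed
      finally show ?thesis .
    qed
    have psi: "psi_III a b c s m = kap_III a b c m * euler_int p q r s"
       "psi_III a b c s n = kap_III a b c n * euler_int (p + 1) (q + 1) (r + 1) s"
       "psi_III a b c s (Suc n) = kap_III a b c (Suc n) * euler_int (p + 2) (q + 2) (r + 2) s"
      by (simp_all add: psi_III_def p_def q_def r_def Suc add_ac del: kap_III.simps)
    have Jn: "J_III a b c n n = (p + 1 + 1) * (S - (r + 1) + 2) / ((S + 2) * (S + 1)) + r * (q + 1) / (S * (S + 1))"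
      using Suc lamn mun by (simp add: J_III_def)
    have "tri_op (diag_III a b c) (off_III a b c) (psi_III a b c s) n + s * psi_III a b c s n =
       off_III a b c m * psi_III a b c s m + J_III a b c n n * psi_III a b c s n
       + off_III a b c n * psi_III a b c s (Suc n) + s * psi_III a b c s n"
      using Suc by (simp add: tri_op_def)
    also have "\<dots> = kap_III a b c n * (- ((p + 1) * (q + 1) / (S * (S + 1))) * euler_int p q r s
     + (s + ((p + 1 + 1) * (S - (r + 1) + 2) / ((S + 2) * (S + 1)) + r * (q + 1) / (S * (S + 1)))) * euler_int (p + 1) (q + 1) (r + 1) s
     - (S - (r + 1) + 2) * (r + 1) / ((S + 2) * (S + 1)) * euler_int (p + 2) (q + 2) (r + 2) s)"
      unfolding psi eq1 eq2 Jn by algebra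
    also have "\<dots> = 0"
      unfolding euler_int_rec_Suc[OF p s refl refl Sp] by simp
    finally show ?thesis using Suc by (simp add: unit0_def)
  qed
qed

text \<open>Both \<open>A\<close> and \<open>B\<close> are at least 1 and at least \<open>n\<close>,
  so each quotient is at most the constant of its numerator plus 2. The bound is the threshold for
  \<open>s\<close> in the Neumann argument.\<close>

lemma rho_III_bound:
  assumes c: "c \<ge> 0" "c + a > 0" "c + b > 0"
  shows "0 \<le> rho_III a b c n" "rho_III a b c n \<le> (2 * c + a + b + 4) * (2 * c + a + b + 5)"
proof -
  define A B where "A = c + a + 1 + real n" and "B = c + b + 1 + real n"
  have AB: "A \<ge> 1" "B \<ge> 1" using c by (auto simp: A_def B_def)
  let ?C = "2 * c + a + b + 2"
  have C: "?C > 0" using c by linarith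
  have rho: "rho_III a b c n = ((?C + 2 * real n) / A) * ((?C + 1 + 2 * real n) / B)"
    by (simp add: rho_III_def A_def B_def)
  have "?C * 1 \<le> ?C * A" "?C * 1 \<le> ?C * B" using C AB by (intro mult_left_mono; simp)+
  moreover have "real n \<le> A" "real n \<le> B" using c by (auto simp: A_def B_def)
  ultimately have "?C + 2 * real n \<le> (?C + 2) * A" "?C + 1 + 2 * real n \<le> (?C + 3) * B"
    using AB by (simp_all add: distrib_right)
  then have "(?C + 2 * real n) / A \<le> ?C + 2" "(?C + 1 + 2 * real n) / B \<le> ?C + 3"
    using AB by (simp_all add: divide_le_eq)
  then have "rho_III a b c n \<le> (?C + 2) * (?C + 3)"
    unfolding rho using C AB by (intro mult_mono) auto
  then show "rho_III a b c n \<le> (2 * c + a + b + 4) * (2 * c + a + b + 5)"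
    by (simp add: add.commute add.left_commute)
  show "0 \<le> rho_III a b c n" unfolding rho using C AB by simp
qed

text \<open>One step multiplies by an off-diagonal entry of size at most 1 and by
  \<open>rho_III\<close>, which is at most \<open>s\<close>, while the integral loses a factor
  \<open>1 / s\<close>.\<close>

lemma psi_III_bound:
  assumes c: "c \<ge> 0" "c + a > 0" "c + b > 0" "a \<ge> - 1" "b \<ge> - 1"
    and s: "s > 0" "s \<ge> (2 * c + a + b + 4) * (2 * c + a + b + 5)"
  shows "\<bar>psi_III a b c s n\<bar> \<le> psi_III a b c s 0"
proof (induction n)
  case 0
  have "0 \<le> euler_int (c + a) (c + b) (c + 1) s" using c s by (intro euler_int_nonneg) auto
  then show ?case by (simp add: psi_III_def)
next
  case (Suc n)
  let ?p = "c + a + real n" and ?q = "c + b + real n" and ?r = "c + 1 + real n"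
  have pq: "?p > 0" "?q > 0" using c by auto
  let ?E = "euler_int ?p ?q ?r s" and ?E' = "euler_int (?p + 1) (?q + 1) (?r + 1) s"
  have E: "0 \<le> ?E'" "?E' \<le> ?E / s" "0 \<le> ?E"
    using euler_int_nonneg[of "?p + 1" "?q + 1" s] euler_int_nonneg[OF pq s(1)] euler_int_shift_le[OF pq s(1), of ?r] pq s by auto
  have "\<bar>psi_III a b c s (Suc n)\<bar> = \<bar>kap_III a b c n\<bar> * off_III a b c n * rho_III a b c n * ?E'"
    using E(1) off_III_bounds(1)[OF c, of n] rho_III_bound(1)[OF c(1-3), of n]
    by (simp add: psi_III_def abs_mult add_ac)
  also have "\<dots> \<le> \<bar>kap_III a b c n\<bar> * 1 * s * (?E / s)"
    using off_III_bounds[OF c, of n] rho_III_bound[OF c(1-3), of n] E s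
    by (intro mult_mono mult_nonneg_nonneg) auto
  also have "\<dots> = \<bar>psi_III a b c s n\<bar>"
    using s E by (simp add: psi_III_def abs_mult)
  also note Suc.IH
  finally show ?case .
qed

lemma tri_op_bound:
  assumes "\<And>n. \<bar>d n\<bar> \<le> 1" "\<And>n. \<bar>s n\<bar> \<le> 1" and v: "\<And>n. \<bar>v n\<bar> \<le> B"
  shows "\<bar>tri_op d s v n\<bar> \<le> 3 * B"
proof -
  have *: "\<bar>x * v m\<bar> \<le> B" if "\<bar>x\<bar> \<le> 1" for x m
    using mult_mono[OF that v[of m]] by (simp add: abs_mult)
  have "\<bar>if n = 0 then 0 else s (n - 1) * v (n - 1)\<bar> \<le> B"
    using *[OF assms(2)] v[of 0] by auto
  moreover have "\<bar>d n * v n\<bar> \<le> B" "\<bar>s n * v (Suc n)\<bar> \<le> B" using * assms by auto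
  ultimately show ?thesis unfolding tri_op_def by linarith
qed

lemma tri_op_funpow_bound:
  assumes "\<And>n. \<bar>d n\<bar> \<le> 1" "\<And>n. \<bar>s n\<bar> \<le> 1" and "\<And>n. \<bar>v n\<bar> \<le> B"
  shows "\<bar>(tri_op d s ^^ k) v n\<bar> \<le> 3 ^ k * B"
proof (induction k arbitrary: n)
  case (Suc k)
  have "\<bar>tri_op d s ((tri_op d s ^^ k) v) n\<bar> \<le> 3 * (3 ^ k * B)"
    by (rule tri_op_bound) (use assms Suc.IH in auto)
  then show ?case by simp
qed (use assms in simp)

lemma tri_op_funpow_linear:
  "(tri_op d s ^^ k) (\<lambda>n. x * u n - y * v n) n = x * (tri_op d s ^^ k) u n - y * (tri_op d s ^^ k) v n"
proof (induction k arbitrary: n)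
  case (Suc k)
  have "(tri_op d s ^^ k) (\<lambda>n. x * u n - y * v n) = (\<lambda>n. x * (tri_op d s ^^ k) u n - y * (tri_op d s ^^ k) v n)"
    using Suc.IH by auto
  then show ?case by (simp add: tri_op_diff tri_op_cmult)
qed simp

section \<open>Stieltjes transforms on the positive axis\<close>

definition stieltjes_moment :: "real measure \<Rightarrow> nat \<Rightarrow> real \<Rightarrow> real" where
  "stieltjes_moment \<nu> k s = (\<integral>t. t ^ k / (s + t) \<partial>\<nu>)"

text \<open>The recursion is one step of polynomial division,
  \<open>t^(k+1) = t^k (s + t) - s t^k\<close>.\<close>

lemma
  fixes \<nu> :: "real measure"
  assumes \<nu>: "prob_space \<nu>" "sets \<nu> = sets borel" and supp: "AE x in \<nu>. x \<in> {0..1}" and s: "s > 0"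
  shows stieltjes_moment_integrable: "integrable \<nu> (\<lambda>t. t ^ k / (s + t))"
    and stieltjes_moment_Suc: "stieltjes_moment \<nu> (Suc k) s = (\<integral>t. t ^ k \<partial>\<nu>) - s * stieltjes_moment \<nu> k s"
    and stieltjes_moment_bound: "\<bar>stieltjes_moment \<nu> k s\<bar> \<le> 1 / s"
proof -
  interpret prob_space \<nu> by fact
  have [measurable_cong]: "sets \<nu> = sets borel" by fact
  have ai: "AE t in \<nu>. norm (t ^ k / (s + t)) \<le> 1 / s" for k
    using supp
  proof eventually_elim
    case (elim t)
    then have "t ^ k \<le> 1" by (simp add: power_le_one)
    then show ?case using elim s by (auto simp: abs_mult intro!: frac_le)
  qed
  show int: "integrable \<nu> (\<lambda>t. t ^ k / (s + t))" for k
    by (rule integrable_const_bound[OF ai]) simp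
  have int': "integrable \<nu> (\<lambda>t. t ^ k)" for k
  proof (rule integrable_const_bound[of _ 1])
    show "AE t in \<nu>. norm (t ^ k) \<le> 1" using supp by eventually_elim (simp add: power_le_one)
  qed simp
  have "stieltjes_moment \<nu> (Suc k) s = (\<integral>t. t ^ k - s * (t ^ k / (s + t)) \<partial>\<nu>)"
    unfolding stieltjes_moment_def
  proof (rule integral_cong_AE)
    show "AE t in \<nu>. t ^ Suc k / (s + t) = t ^ k - s * (t ^ k / (s + t))"
      using supp
    proof eventually_elim
      case (elim t)
      then have "s + t \<noteq> 0" using s by auto
      then show ?case by (simp add: field_simps)
    qed
  qed simp_all
  then show "stieltjes_moment \<nu> (Suc k) s = (\<integral>t. t ^ k \<partial>\<nu>) - s * stieltjes_moment \<nu> k s"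
    using Bochner_Integration.integral_diff[of \<nu> "\<lambda>t. t ^ k" "\<lambda>t. s * (t ^ k / (s + t))"] int[of k] int'[of k]
    unfolding stieltjes_moment_def by (simp only: integrable_mult_right integral_mult_right_zero)
  have "norm (stieltjes_moment \<nu> k s) \<le> (\<integral>t. norm (t ^ k / (s + t)) \<partial>\<nu>)" unfolding stieltjes_moment_def by (rule integral_norm_bound)
  also have "\<dots> \<le> (\<integral>t. 1 / s \<partial>\<nu>)" by (intro integral_mono_AE ai integrable_norm int) simp
  finally show "\<bar>stieltjes_moment \<nu> k s\<bar> \<le> 1 / s" by (simp add: prob_space)
qed

text \<open>The moments are peeled off at infinity: if the transforms of order \<open>k\<close>
  agree, the recursion bounds the difference of the \<open>k\<close>-th moments by
  \<open>2 / s\<close> for all large \<open>s\<close>, so it is 0, and then the transforms of order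
  \<open>k + 1\<close> agree as well.\<close>

lemma stieltjes_moments_eq:
  fixes \<nu> \<mu> :: "real measure"
  assumes \<nu>: "prob_space \<nu>" "sets \<nu> = sets borel" "AE x in \<nu>. x \<in> {0..1}"
    and \<mu>: "prob_space \<mu>" "sets \<mu> = sets borel" "AE x in \<mu>. x \<in> {0..1}"
    and K: "K > 0" and eq: "\<And>s. s \<ge> K \<Longrightarrow> (\<integral>t. 1 / (s + t) \<partial>\<nu>) = (\<integral>t. 1 / (s + t) \<partial>\<mu>)"
  shows "(\<integral>t. t ^ k \<partial>\<nu>) = (\<integral>t. t ^ k \<partial>\<mu>)"
proof -
  let ?d = "\<lambda>k. (\<integral>t. t ^ k \<partial>\<nu>) - (\<integral>t. t ^ k \<partial>\<mu>)"
  have step: "?d k = 0" if k: "\<And>s. s \<ge> K \<Longrightarrow> stieltjes_moment \<nu> k s = stieltjes_moment \<mu> k s" for k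
  proof (rule ccontr)
    assume nz: "?d k \<noteq> 0"
    define s where "s = max K (4 / \<bar>?d k\<bar>)"
    have s: "s \<ge> K" "s > 0" "s \<ge> 4 / \<bar>?d k\<bar>" using K by (auto simp: s_def)
    have "?d k = stieltjes_moment \<nu> (Suc k) s - stieltjes_moment \<mu> (Suc k) s"
      unfolding stieltjes_moment_Suc[OF \<nu> s(2)] stieltjes_moment_Suc[OF \<mu> s(2)] k[OF s(1)] by simp
    then have "\<bar>?d k\<bar> \<le> 2 / s"
      using stieltjes_moment_bound[OF \<nu> s(2), of "Suc k"] stieltjes_moment_bound[OF \<mu> s(2), of "Suc k"] by linarith
    then have "s * \<bar>?d k\<bar> \<le> 2" using s(2) by (simp add: pos_le_divide_eq mult.commute)
    moreover have "4 \<le> s * \<bar>?d k\<bar>" using s(3) nz by (simp add: pos_divide_le_eq)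
    ultimately show False by linarith
  qed
  have "stieltjes_moment \<nu> k s = stieltjes_moment \<mu> k s" if "s \<ge> K" for s
    using that
  proof (induction k arbitrary: s)
    case 0
    then show ?case using eq by (simp add: stieltjes_moment_def)
  next
    case (Suc k)
    then have "s > 0" using K by simp
    then show ?case using step[OF Suc.IH] Suc by (simp add: stieltjes_moment_Suc[OF \<nu>] stieltjes_moment_Suc[OF \<mu>])
  qed
  then show ?thesis using step by simp
qed

text \<open>Both sides satisfy \<open>x\<^sub>k\<^sub>+\<^sub>1 = I m\<^sub>k - s x\<^sub>k\<close>, where \<open>m\<^sub>k\<close> are the moments and \<open>I\<close> is the Euler
  integral on the right: the left one because \<^term>\<open>psi_III\<close> solves the inhomogeneous recurrence. Hence the
  difference grows like \<open>s\<^sup>k\<close>, while both sides are \<open>O(3\<^sup>k)\<close>.\<close>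

lemma spectral_measure_III_transform_large:
  assumes c: "c \<ge> 0" "c + a > 0" "c + b > 0" "a \<ge> - 1" "b \<ge> - 1"
    and \<nu>: "is_spectral_measure (J_III a b c) \<nu>" and supp: "AE x in \<nu>. x \<in> {0..1}"
    and s: "s \<ge> 4" "s \<ge> (2 * c + a + b + 4) * (2 * c + a + b + 5)"
  shows "euler_int (c + a) (c + b) (c + 1) s = euler_int (c + a) (c + b) c s * (\<integral>t. 1 / (s + t) \<partial>\<nu>)"
proof -
  have \<nu>': "prob_space \<nu>" "sets \<nu> = sets borel" using \<nu> by (simp_all add: is_spectral_measure_def)
  define T where "T = tri_op (diag_III a b c) (off_III a b c)"
  define m where "m k = inf_mat_pow (J_III a b c) k 0 0" for k
  define I0 where "I0 = euler_int (c + a) (c + b) c s"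
  define \<Psi> where "\<Psi> = psi_III a b c s"
  define A where "A k = (T ^^ k) \<Psi> 0" for k
  define P where "P k = stieltjes_moment \<nu> k s" for k
  have s0: "s > 0" using s by simp
  have "T \<Psi> = (\<lambda>n. I0 * unit0 n - s * \<Psi> n)"
    unfolding T_def \<Psi>_def I0_def using psi_III_recurrence[OF c s0] by auto
  then have A_Suc: "A (Suc k) = I0 * m k - s * A k" for k
    unfolding A_def funpow_Suc_right o_apply
    by (simp add: T_def tri_op_funpow_linear m_def inf_mat_pow_J_III)
  have P_Suc: "P (Suc k) = m k - s * P k" and P_bound: "\<bar>P k\<bar> \<le> 1 / s" for k
    using stieltjes_moment_Suc[OF \<nu>' supp s0, of k] stieltjes_moment_bound[OF \<nu>' supp s0, of k] \<nu>
    by (simp_all add: P_def m_def is_spectral_measure_def)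
  define B where "B = \<Psi> 0 + \<bar>I0\<bar> * (1 / s)"
  have A_bound: "\<bar>A k\<bar> \<le> 3 ^ k * \<Psi> 0" for k
    unfolding A_def T_def
    by (rule tri_op_funpow_bound)
       (use diag_III_bounds[OF c] off_III_bounds[OF c] psi_III_bound[OF c s0 s(2)] in \<open>auto simp: \<Psi>_def abs_le_iff intro: order_trans[of _ 0]\<close>)
  have e: "A 0 - I0 * P 0 = (A k - I0 * P k) / (- s) ^ k" for k
  proof (induction k)
    case (Suc k)
    have "A (Suc k) - I0 * P (Suc k) = - s * (A k - I0 * P k)"
      unfolding A_Suc P_Suc by (simp add: algebra_simps)
    then show ?case using Suc s0 by simp
  qed simp
  have "norm (A 0 - I0 * P 0) \<le> B * (3 / s) ^ k" for k
  proof -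
    have "\<bar>I0 * P k\<bar> \<le> \<bar>I0\<bar> * (1 / s)" unfolding abs_mult by (intro mult_left_mono P_bound) simp
    also have "\<dots> \<le> 3 ^ k * (\<bar>I0\<bar> * (1 / s))"
      using s0 mult_right_mono[of 1 "3 ^ k" "\<bar>I0\<bar> * (1 / s)"] by simp
    finally have "\<bar>A k - I0 * P k\<bar> \<le> 3 ^ k * B"
      using A_bound[of k] unfolding B_def distrib_left by linarith
    then show ?thesis
      unfolding e[of k] using s0 by (simp add: power_divide abs_divide power_abs divide_simps mult.commute)
  qed
  \<comment> \<open>Here \<open>s >= 4\<close> is used: the ratio \<open>3 / s\<close> must be below
    1.\<close>
  moreover have "(\<lambda>k. B * (3 / s) ^ k) \<longlonglongrightarrow> B * 0"
    using s by (intro tendsto_mult tendsto_const LIMSEQ_power_zero) auto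
  ultimately have "norm (A 0 - I0 * P 0) \<le> 0"
    by (intro LIMSEQ_le_const[of "\<lambda>k. B * (3 / s) ^ k"]) auto
  then show ?thesis
    by (simp add: A_def P_def stieltjes_moment_def I0_def \<Psi>_def psi_III_def)
qed

section \<open>Stieltjes transform of the spectral measure\<close>

definition euler_intc :: "real \<Rightarrow> real \<Rightarrow> real \<Rightarrow> complex \<Rightarrow> complex" where
  "euler_intc p q r s = integral {0..1}
     (\<lambda>t. of_real (t powr p * (1 - t) powr q) * (s + of_real t) powr of_real (- r))"

lemma slit_plane_iff: "(s::complex) \<notin> \<real>\<^sub>\<le>\<^sub>0 \<longleftrightarrow> Re s > 0 \<or> Im s \<noteq> 0"
  by (auto simp: complex_nonpos_Reals_iff)

lemma slit_plane_add: "(s::complex) \<notin> \<real>\<^sub>\<le>\<^sub>0 \<Longrightarrow> t \<ge> 0 \<Longrightarrow> s + of_real t \<notin> \<real>\<^sub>\<le>\<^sub>0"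
  by (auto simp: slit_plane_iff)

lemma euler_intc_integrand_continuous:
  fixes U :: "complex set"
  assumes "0 < p" "0 < q" "U \<inter> \<real>\<^sub>\<le>\<^sub>0 = {}"
  shows "continuous_on (U \<times> {0..1})
    (\<lambda>(s, t). of_real (t powr p * (1 - t) powr q) * (s + of_real t) powr of_real e)"
  unfolding split_beta
proof (rule continuous_on_mult)
  show "continuous_on (U \<times> {0..1}) (\<lambda>x. complex_of_real (snd x powr p * (1 - snd x) powr q))"
    using assms by (intro continuous_on_of_real continuous_on_mult continuous_on_powr' continuous_intros) auto
  show "continuous_on (U \<times> {0..1}) (\<lambda>x. (fst x + of_real (snd x)) powr complex_of_real e)"
  proof (rule continuous_on_powr_complex)
    show "U \<times> {0..1} \<subseteq> {x. 0 \<le> Re (fst x + of_real (snd x)) \<or> Im (fst x + of_real (snd x)) \<noteq> 0}"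
      using assms(3) by (force simp: slit_plane_iff disjoint_iff)
    fix x :: "complex \<times> real" assume x: "x \<in> U \<times> {0..1}" "fst x + of_real (snd x) = 0"
    then have "fst x \<in> \<real>\<^sub>\<le>\<^sub>0" by (auto simp: complex_nonpos_Reals_iff complex_eq_iff)
    then show "0 < Re (of_real e)" using assms(3) x by auto
  qed (intro continuous_intros)+
qed

lemma euler_intc_integrand_continuous':
  fixes s :: complex
  assumes "0 < p" "0 < q" "s \<notin> \<real>\<^sub>\<le>\<^sub>0"
  shows "continuous_on {0..1} (\<lambda>t. of_real (t powr p * (1 - t) powr q) * (s + of_real t) powr of_real e)"
proof -
  have "continuous_on {0..1} (\<lambda>t. case (s, t) of (s, t) \<Rightarrow>
      of_real (t powr p * (1 - t) powr q) * (s + of_real t) powr of_real e)"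
    by (rule continuous_on_compose2[OF euler_intc_integrand_continuous[of p q "{s}" e]])
       (use assms in \<open>auto intro!: continuous_intros\<close>)
  then show ?thesis by simp
qed

lemma euler_intc_has_integral:
  assumes "0 < p" "0 < q" "s \<notin> \<real>\<^sub>\<le>\<^sub>0"
  shows "((\<lambda>t. of_real (t powr p * (1 - t) powr q) * (s + of_real t) powr of_real (- r)) has_integral euler_intc p q r s) {0..1}"
  unfolding euler_intc_def
  by (intro integrable_integral integrable_continuous_real euler_intc_integrand_continuous' assms)

lemma euler_intc_has_field_derivative:
  assumes p: "0 < p" "0 < q" and s: "s \<notin> \<real>\<^sub>\<le>\<^sub>0"
  shows "(euler_intc p q r has_field_derivative - of_real r * euler_intc p q (r + 1) s) (at s)"
proof -
  have "open (- \<real>\<^sub>\<le>\<^sub>0 :: complex set)" by (simp add: open_Compl)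
  then obtain e where e: "e > 0" "ball s e \<subseteq> - \<real>\<^sub>\<le>\<^sub>0"
    using s openE[of "- \<real>\<^sub>\<le>\<^sub>0" s] by auto
  let ?f = "\<lambda>s t. of_real (t powr p * (1 - t) powr q) * (s + of_real t) powr of_real (- r) :: complex"
  let ?f' = "\<lambda>s t. - of_real r * (of_real (t powr p * (1 - t) powr q) * (s + of_real t) powr of_real (- (r + 1))) :: complex"
  have "((\<lambda>s. integral (cbox 0 1) (?f s)) has_field_derivative integral (cbox 0 1) (?f' s)) (at s within ball s e)"
  proof (rule leibniz_rule_field_derivative)
    fix w :: complex and t :: real assume w: "w \<in> ball s e" and t: "t \<in> cbox 0 1"
    have ode_weight: "w + of_real t \<notin> \<real>\<^sub>\<le>\<^sub>0" using slit_plane_add[of w t] e w t by auto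
    have "- of_real r - 1 = (of_real (- (r + 1)) :: complex)" by simp
    then have "((\<lambda>s. (s + of_real t) powr of_real (- r)) has_field_derivative - of_real r * (w + of_real t) powr of_real (- (r + 1))) (at w)"
      using ode_weight by (auto intro!: derivative_eq_intros)
    from DERIV_cong[OF DERIV_cmult[OF this, of "of_real (t powr p * (1 - t) powr q)"] mult.left_commute]
    show "((\<lambda>s. ?f s t) has_field_derivative ?f' w t) (at w within ball s e)"
      by (rule has_field_derivative_at_within)
  next
    fix w assume "w \<in> ball s e"
    then show "?f w integrable_on cbox 0 1"
      using euler_intc_has_integral[OF p, of w r] e by (auto simp: has_integral_iff)
  next
    have "continuous_on (ball s e \<times> {0..1}) (\<lambda>x. - of_real r * (case x of (s, t) \<Rightarrow> of_real (t powr p * (1 - t) powr q) * (s + of_real t) powr of_real (- (r + 1))))"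
      by (intro continuous_on_mult continuous_on_const euler_intc_integrand_continuous p) (use e in auto)
    then show "continuous_on (ball s e \<times> cbox 0 1) (\<lambda>(s, t). ?f' s t)"
      by (simp add: split_beta)
  qed (use e in auto)
  also have "at s within ball s e = at s" using e by (intro at_within_open) auto
  finally show ?thesis
    unfolding euler_intc_def[abs_def] by simp
qed

lemma euler_intc_holomorphic:
  assumes "0 < p" "0 < q"
  shows "euler_intc p q r holomorphic_on (- \<real>\<^sub>\<le>\<^sub>0)"
  unfolding holomorphic_on_def field_differentiable_def
proof
  fix s :: complex assume "s \<in> - \<real>\<^sub>\<le>\<^sub>0"
  then have "(euler_intc p q r has_field_derivative - of_real r * euler_intc p q (r + 1) s) (at s)"
    using euler_intc_has_field_derivative[OF assms, of s r] by simp
  then show "\<exists>f'. (euler_intc p q r has_field_derivative f') (at s within - \<real>\<^sub>\<le>\<^sub>0)"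
    using has_field_derivative_at_within by blast
qed

lemma euler_intc_of_real:
  assumes "0 < p" "0 < q" "0 < s"
  shows "euler_intc p q r (of_real s) = of_real (euler_int p q r s)"
proof -
  have "((\<lambda>t. of_real (t powr p * (1 - t) powr q * (s + t) powr (- r)) :: complex) has_integral of_real (euler_int p q r s)) {0..1}"
    by (intro has_integral_of_real euler_int_has_integral assms)
  moreover have "of_real (t powr p * (1 - t) powr q * (s + t) powr (- r)) =
      (of_real (t powr p * (1 - t) powr q) * (of_real s + of_real t) powr of_real (- r) :: complex)" if "t \<in> {0..1}" for t
    using that assms powr_of_real[of "s + t" "- r"] by simp
  ultimately have "((\<lambda>t. of_real (t powr p * (1 - t) powr q) * (of_real s + of_real t) powr of_real (- r) :: complex) has_integral of_real (euler_int p q r s)) {0..1}"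
    by (rule has_integral_eq[rotated])
  moreover have "of_real s \<notin> (\<real>\<^sub>\<le>\<^sub>0 :: complex set)" using assms by (simp add: slit_plane_iff)
  ultimately show ?thesis
    using euler_intc_has_integral[OF assms(1,2), of "of_real s" r] has_integral_unique by blast
qed

text \<open>The antiderivative is taken as a function of a complex variable, so that the complex
  product and chain rules apply, and is then restricted to the real segment; it vanishes at both
  ends.\<close>

lemma euler_intc_exact:
  fixes s :: complex
  assumes p: "0 < p" "0 < q" and s: "s \<notin> \<real>\<^sub>\<le>\<^sub>0"
  shows "((\<lambda>t. of_real (t powr p * (1 - t) powr q) * (s + of_real t) powr of_real (- (r + 1)) *
      (of_real ((p + 1) * (1 - t) - (q + 1) * t) * (s + of_real t) - of_real (r * t * (1 - t)))) has_integral 0) {0..1}"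
proof -
  define F where "F z = z powr of_real (p + 1) * (1 - z) powr of_real (q + 1) * (s + z) powr of_real (- r)" for z :: complex
  have F_eq: "F (of_real t) = of_real (t powr (p + 1) * (1 - t) powr (q + 1)) * (s + of_real t) powr of_real (- r)"
    if "t \<in> {0..1}" for t
    using that powr_of_real[of t "p + 1"] powr_of_real[of "1 - t" "q + 1"] by (simp add: F_def)
  have "((\<lambda>t. of_real (t powr p * (1 - t) powr q) * (s + of_real t) powr of_real (- (r + 1)) *
      (of_real ((p + 1) * (1 - t) - (q + 1) * t) * (s + of_real t) - of_real (r * t * (1 - t)))) has_integral F (of_real 1) - F (of_real 0)) {0..1}"
  proof (rule fundamental_theorem_of_calculus_interior)
    have "continuous_on {0..1} (\<lambda>t. of_real (t powr (p + 1) * (1 - t) powr (q + 1)) * (s + of_real t) powr of_real (- r))"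
      using p s by (intro euler_intc_integrand_continuous') auto
    then show "continuous_on {0..1} (\<lambda>t. F (of_real t))"
      by (rule continuous_on_eq) (simp add: F_eq)
    fix t :: real assume t: "t \<in> {0<..<1}"
    define X Y Z where "X = complex_of_real (t powr p)" and "Y = complex_of_real ((1 - t) powr q)"
      and "Z = (s + of_real t) powr of_real (- (r + 1))"
    have tn: "complex_of_real t \<notin> \<real>\<^sub>\<le>\<^sub>0" "1 - complex_of_real t \<notin> \<real>\<^sub>\<le>\<^sub>0" "s + of_real t \<notin> \<real>\<^sub>\<le>\<^sub>0"
      using t slit_plane_add[OF s] by (auto simp: slit_plane_iff)
    have X: "X = of_real t powr of_real p" and Y: "Y = (1 - of_real t) powr of_real q"
      using t powr_of_real[of t p] powr_of_real[of "1 - t" q] by (simp_all add: X_def Y_def)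
    have a1: "z powr of_real (e + 1) = z powr of_real e * z" if "z \<notin> \<real>\<^sub>\<le>\<^sub>0" for z :: complex and e :: real
      using that by (cases "z = 0") (auto simp: powr_add)
    have d1: "((\<lambda>z. z powr of_real (p + 1)) has_field_derivative of_real (p + 1) * X) (at (of_real t))"
      unfolding X using tn by (auto intro!: derivative_eq_intros)
    have d2: "((\<lambda>z. (1 - z) powr of_real (q + 1)) has_field_derivative - (of_real (q + 1) * Y)) (at (of_real t))"
      unfolding Y using tn by (auto intro!: derivative_eq_intros)
    have m: "- of_real r - 1 = (of_real (- (r + 1)) :: complex)" by simp
    have d3: "((\<lambda>z. (s + z) powr of_real (- r)) has_field_derivative - of_real r * Z) (at (of_real t))"
      unfolding Z_def m[symmetric] using tn by (auto intro!: derivative_eq_intros)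
    have e1: "of_real t powr of_real (p + 1) = X * of_real t"
      and e2: "(1 - of_real t) powr of_real (q + 1) = Y * (1 - of_real t)"
      unfolding X Y by (rule a1, rule tn)+
    have e3: "(s + of_real t) powr of_real (- r) = Z * (s + of_real t)"
    proof -
      have "- (r + 1) + 1 = - r" by simp
      then show ?thesis using a1[OF tn(3), of "- (r + 1)"] unfolding Z_def by (simp only:)
    qed
    have "(F has_field_derivative X * Y * Z *
      (of_real ((p + 1) * (1 - t) - (q + 1) * t) * (s + of_real t) - of_real (r * t * (1 - t)))) (at (of_real t))"
      unfolding F_def[abs_def]
      by (rule DERIV_cong[OF DERIV_mult[OF DERIV_mult[OF d1 d2] d3]], unfold e1 e2 e3)
         (simp add: algebra_simps)
    then have "((\<lambda>t. F (of_real t)) has_vector_derivative X * Y * Z *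
      (of_real ((p + 1) * (1 - t) - (q + 1) * t) * (s + of_real t) - of_real (r * t * (1 - t)))) (at t)"
      by (rule has_vector_derivative_real_field)
    then show "((\<lambda>t. F (of_real t)) has_vector_derivative of_real (t powr p * (1 - t) powr q) * (s + of_real t) powr of_real (- (r + 1)) *
      (of_real ((p + 1) * (1 - t) - (q + 1) * t) * (s + of_real t) - of_real (r * t * (1 - t)))) (at t)"
      unfolding X_def Y_def Z_def by simp
  qed simp
  moreover have "F (of_real 1) - F (of_real 0) = 0" by (simp add: F_def)
  ultimately show ?thesis by simp
qed

text \<open>Since \<open>I_c' = -c I_(c+1)\<close> and \<open>I_(c+1)' = -(c+1) I_(c+2)\<close>,
  multiplication by \<open>c\<close> gives
  \<open>s (1 + s) y'' - (a + (a + b) s) y' - c (c + a + b + 1) y = 0\<close> for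
  \<open>y = I_c\<close>: the hypergeometric equation in \<open>-s\<close> with parameters
  \<open>c\<close>, \<open>-c-a-b-1\<close>, \<open>-a\<close>.\<close>

lemma euler_intc_ode:
  assumes p: "0 < c + a" "0 < c + b" and s: "s \<notin> \<real>\<^sub>\<le>\<^sub>0"
  shows "of_real (c + 1) * (s * (1 + s)) * euler_intc (c + a) (c + b) (c + 2) s
     + (of_real a + of_real (a + b) * s) * euler_intc (c + a) (c + b) (c + 1) s
     - of_real (c + a + b + 1) * euler_intc (c + a) (c + b) c s = 0"
proof -
  let ?W = "\<lambda>t. of_real (t powr (c + a) * (1 - t) powr (c + b)) :: complex"
  let ?f = "\<lambda>t. of_real (c + 1) * (s * (1 + s)) * (?W t * (s + of_real t) powr of_real (- (c + 2)))
     + (of_real a + of_real (a + b) * s) * (?W t * (s + of_real t) powr of_real (- (c + 1)))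
     - of_real (c + a + b + 1) * (?W t * (s + of_real t) powr of_real (- c))"
  have "(?f has_integral of_real (c + 1) * (s * (1 + s)) * euler_intc (c + a) (c + b) (c + 2) s
     + (of_real a + of_real (a + b) * s) * euler_intc (c + a) (c + b) (c + 1) s
     - of_real (c + a + b + 1) * euler_intc (c + a) (c + b) c s) {0..1}"
    by (intro has_integral_add has_integral_diff has_integral_mult_right euler_intc_has_integral p s)
  moreover have "(?f has_integral 0) {0..1}"
  proof (rule has_integral_eq[OF _ euler_intc_exact[OF p s, of "c + 1"]])
    fix t :: real assume t: "t \<in> {0..1}"
    have tn: "s + of_real t \<notin> \<real>\<^sub>\<le>\<^sub>0" using slit_plane_add[OF s] t by auto
    have a1: "z powr of_real (e + 1) = z powr of_real e * z" if "z \<notin> \<real>\<^sub>\<le>\<^sub>0" for z :: complex and e :: real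
      using that by (cases "z = 0") (auto simp: powr_add)
    have ee: "- (c + 2) + 1 = - (c + 1)" "- (c + 1) + 1 = - c" "c + 1 + 1 = c + 2" by simp_all
    define Z where "Z = (s + of_real t) powr of_real (- (c + 2))"
    have z1: "(s + of_real t) powr of_real (- (c + 1)) = Z * (s + of_real t)"
      using a1[OF tn, of "- (c + 2)"] unfolding Z_def ee .
    have z2: "(s + of_real t) powr of_real (- c) = Z * (s + of_real t) * (s + of_real t)"
      using a1[OF tn, of "- (c + 1)"] unfolding ee z1 .
    define T A B C where "T = complex_of_real t" and "A = complex_of_real a" and "B = complex_of_real b" and "C = complex_of_real c"
    show "?W t * (s + of_real t) powr of_real (- (c + 1 + 1)) *
      (of_real ((c + a + 1) * (1 - t) - (c + b + 1) * t) * (s + of_real t) - of_real ((c + 1) * t * (1 - t))) = ?f t"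
      unfolding ee z1 z2 unfolding Z_def[symmetric]
      unfolding of_real_add of_real_mult of_real_diff of_real_1 T_def[symmetric] A_def[symmetric] B_def[symmetric] C_def[symmetric]
      by algebra
  qed
  ultimately show ?thesis by (rule has_integral_unique)
qed

section \<open>Analytic continuation to the slit plane\<close>

definition stieltjes :: "real measure \<Rightarrow> complex \<Rightarrow> complex" where
  "stieltjes \<nu> s = (\<integral>t. 1 / (s + of_real t) \<partial>\<nu>)"

lemma stieltjes_kernel_bound:
  fixes s :: complex
  assumes "s \<notin> \<real>\<^sub>\<le>\<^sub>0"
  obtains \<delta> where "\<delta> > 0" "\<And>w t. w \<in> ball s \<delta> \<Longrightarrow> t \<ge> 0 \<Longrightarrow> norm (w + of_real t) \<ge> \<delta>"
proof -
  have "open (- \<real>\<^sub>\<le>\<^sub>0 :: complex set)" by (simp add: open_Compl)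
  then obtain e where e: "e > 0" "ball s e \<subseteq> - \<real>\<^sub>\<le>\<^sub>0"
    using assms openE[of "- \<real>\<^sub>\<le>\<^sub>0" s] by auto
  show ?thesis
  proof (rule that[of "e / 2"])
    fix w t assume w: "w \<in> ball s (e / 2)" and t: "(t::real) \<ge> 0"
    show "norm (w + of_real t) \<ge> e / 2"
    proof (rule ccontr)
      assume "\<not> norm (w + of_real t) \<ge> e / 2"
      then have "dist w (- of_real t) < e / 2" by (simp add: dist_norm)
      then have "dist s (- of_real t) < e" using w dist_triangle[of s "- of_real t" w] unfolding mem_ball by linarith
      then have "- of_real t \<in> - (\<real>\<^sub>\<le>\<^sub>0 :: complex set)" using e by auto
      then show False using t by (auto simp: complex_nonpos_Reals_iff)
    qed
  qed (use e in auto)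
qed

lemma stieltjes_integrable:
  fixes s :: complex
  assumes "prob_space \<nu>" "sets \<nu> = sets borel" "AE t in \<nu>. t \<in> {0..1}" and s: "s \<notin> \<real>\<^sub>\<le>\<^sub>0"
  shows "integrable \<nu> (\<lambda>t. 1 / (s + of_real t))"
proof -
  interpret prob_space \<nu> by fact
  have [measurable_cong]: "sets \<nu> = sets borel" by fact
  obtain \<delta> where \<delta>: "\<delta> > 0" "\<And>w t. w \<in> ball s \<delta> \<Longrightarrow> t \<ge> 0 \<Longrightarrow> norm (w + of_real t) \<ge> \<delta>"
    using stieltjes_kernel_bound[OF s] by metis
  show ?thesis
  proof (rule integrable_const_bound)
    show "AE t in \<nu>. norm (1 / (s + of_real t)) \<le> 1 / \<delta>"
      using assms(3)
    proof eventually_elim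
      case (elim t)
      then show ?case using \<delta>(2)[of s t] \<delta>(1) by (simp add: norm_divide frac_le)
    qed
  qed simp
qed

text \<open>The difference quotient of the kernel misses its derivative by
  \<open>(w - s) / (x y^2)\<close> with \<open>x = w + t\<close> and \<open>y = s + t\<close>. Both
  moduli are at least \<open>\<delta>\<close>, so the error is at most
  \<open>|w - s| / \<delta>^3\<close> uniformly in \<open>t\<close>.\<close>

lemma stieltjes_holomorphic:
  assumes \<nu>: "prob_space \<nu>" "sets \<nu> = sets borel" "AE t in \<nu>. t \<in> {0..1}"
  shows "stieltjes \<nu> holomorphic_on (- \<real>\<^sub>\<le>\<^sub>0)"
proof -
  interpret prob_space \<nu> by fact
  have [measurable_cong]: "sets \<nu> = sets borel" by fact
  have "stieltjes \<nu> field_differentiable at s" if s: "s \<notin> \<real>\<^sub>\<le>\<^sub>0" for s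
  proof -
    obtain \<delta> where \<delta>: "\<delta> > 0" "\<And>w t. w \<in> ball s \<delta> \<Longrightarrow> t \<ge> 0 \<Longrightarrow> norm (w + of_real t) \<ge> \<delta>"
      using stieltjes_kernel_bound[OF s] by metis
    have nz: "w + of_real t \<noteq> 0" if "w \<in> ball s \<delta>" "t \<ge> 0" for w t using \<delta>(2)[OF that] \<delta>(1) by auto
    have ball: "w \<notin> \<real>\<^sub>\<le>\<^sub>0" if "w \<in> ball s \<delta>" for w
    proof
      assume "w \<in> \<real>\<^sub>\<le>\<^sub>0"
      then obtain r where "r \<le> 0" "w = of_real r" by (auto simp: nonpos_Reals_def)
      then show False using nz[OF that, of "- r"] by simp
    qed
    define L where "L = (\<integral>t. - 1 / (s + of_real t)\<^sup>2 \<partial>\<nu>)"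
    have "((\<lambda>w. (stieltjes \<nu> w - stieltjes \<nu> s) / (w - s) - L) \<longlongrightarrow> 0) (at s)"
    proof (rule Lim_null_comparison)
      show "\<forall>\<^sub>F w in at s. norm ((stieltjes \<nu> w - stieltjes \<nu> s) / (w - s) - L) \<le> norm (w - s) / \<delta> ^ 3"
        unfolding eventually_at
      proof (intro exI[of _ \<delta>] conjI ballI impI \<delta>(1))
        fix w assume w: "w \<noteq> s \<and> dist w s < \<delta>"
        then have wb: "w \<in> ball s \<delta>" and ws: "w - s \<noteq> 0" by (auto simp: dist_commute)
        have sb: "s \<in> ball s \<delta>" using \<delta> by simp
        have i1: "integrable \<nu> (\<lambda>t. 1 / (w + of_real t))" "integrable \<nu> (\<lambda>t. 1 / (s + of_real t))"
          using stieltjes_integrable[OF \<nu>] ball wb s by auto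
        have i2: "integrable \<nu> (\<lambda>t. - 1 / (s + of_real t)\<^sup>2)"
        proof (rule integrable_const_bound)
          show "AE t in \<nu>. norm (- 1 / (s + of_real t)\<^sup>2) \<le> 1 / \<delta>\<^sup>2"
            using \<nu>(3)
          proof eventually_elim
            case (elim t)
            then have "\<delta>\<^sup>2 \<le> norm (s + of_real t) ^ 2" using \<delta> sb by (intro power_mono) auto
            then show ?case using \<delta>(1) by (auto simp: norm_divide norm_power intro!: frac_le)
          qed
        qed simp
        have "(stieltjes \<nu> w - stieltjes \<nu> s) / (w - s) - L =
           (\<integral>t. (1 / (w + of_real t) - 1 / (s + of_real t)) / (w - s) - (- 1 / (s + of_real t)\<^sup>2) \<partial>\<nu>)"
          unfolding stieltjes_def L_def using i1 i2 by simp
        also have "norm \<dots> \<le> (\<integral>t. norm (w - s) / \<delta> ^ 3 \<partial>\<nu>)"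
        proof (rule order_trans[OF integral_norm_bound integral_mono_AE])
          show "AE t in \<nu>. norm ((1 / (w + of_real t) - 1 / (s + of_real t)) / (w - s) - (- 1 / (s + of_real t)\<^sup>2)) \<le> norm (w - s) / \<delta> ^ 3"
            using \<nu>(3)
          proof eventually_elim
            case (elim t)
            define x y where "x = w + of_real t" and "y = s + of_real t"
            have xy: "x \<noteq> 0" "y \<noteq> 0" "x - y = w - s" "norm x \<ge> \<delta>" "norm y \<ge> \<delta>"
              using nz[OF wb, of t] nz[OF sb, of t] elim \<delta>(2)[OF wb, of t] \<delta>(2)[OF sb, of t] by (auto simp: x_def y_def)
            have "(1 / x - 1 / y) / (w - s) - (- 1 / y\<^sup>2) = (w - s) / (x * y\<^sup>2)"
            proof -
              have "1 / x - 1 / y = - ((x - y) / (x * y))" using xy(1,2) by (simp add: field_simps)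
              moreover have "x - y \<noteq> 0" unfolding xy(3) by (rule ws)
              ultimately have "(1 / x - 1 / y) / (x - y) = - (1 / (x * y))" by simp
              then have "(1 / x - 1 / y) / (x - y) - (- 1 / y\<^sup>2) = (x - y) / (x * y\<^sup>2)"
              proof -
                have "1 / (x * y) = y / (x * y\<^sup>2)" "1 / y\<^sup>2 = x / (x * y\<^sup>2)"
                  using xy(1,2) by (simp_all add: power2_eq_square)
                then show ?thesis
                  using \<open>(1 / x - 1 / y) / (x - y) = - (1 / (x * y))\<close> by (simp add: diff_divide_distrib)
              qed
              then show ?thesis unfolding xy(3) .
            qed
            then have "norm ((1 / x - 1 / y) / (w - s) - (- 1 / y\<^sup>2)) = norm (w - s) / (norm x * norm y ^ 2)"
              by (simp add: norm_divide norm_mult norm_power)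
            also have "\<dots> \<le> norm (w - s) / (\<delta> * \<delta> ^ 2)"
              using xy \<delta>(1) by (intro divide_left_mono mult_mono power_mono mult_pos_pos) auto
            finally show ?case by (simp add: x_def y_def power2_eq_square power3_eq_cube)
          qed
        qed (use i1 i2 in auto)
        finally show "norm ((stieltjes \<nu> w - stieltjes \<nu> s) / (w - s) - L) \<le> norm (w - s) / \<delta> ^ 3"
          by (simp add: prob_space)
      qed
      have "((\<lambda>w. norm (w - s) / \<delta> ^ 3) \<longlongrightarrow> norm (s - s) / \<delta> ^ 3) (at s)"
        by (intro tendsto_intros) (use \<delta> in auto)
      then show "((\<lambda>w. norm (w - s) / \<delta> ^ 3) \<longlongrightarrow> 0) (at s)" by simp
    qed
    then have "(stieltjes \<nu> has_field_derivative L) (at s)"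
      unfolding has_field_derivative_iff by (rule LIM_zero_cancel)
    then show ?thesis by (auto simp: field_differentiable_def)
  qed
  then show ?thesis
    unfolding holomorphic_on_def by (simp add: field_differentiable_at_within)
qed

lemma connected_slit_plane: "connected (- \<real>\<^sub>\<le>\<^sub>0 :: complex set)"
proof -
  have "\<real>\<^sub>\<le>\<^sub>0 = complex_of_real ` {..0}" by (auto simp: nonpos_Reals_def)
  then show ?thesis
    using starlike_imp_connected[OF starlike_slotted_complex_plane_left[of 0]] by simp
qed

lemma islimpt_of_real_ray: "x > K \<Longrightarrow> complex_of_real x islimpt of_real ` {K<..}"
  unfolding islimpt_approachable
proof (intro allI impI)
  fix e :: real assume "x > K" "e > 0"
  then show "\<exists>x'\<in>complex_of_real ` {K<..}. x' \<noteq> of_real x \<and> dist x' (of_real x) < e"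
    by (intro bexI[of _ "of_real (x + e / 2)"]) (auto simp: dist_norm simp del: of_real_add of_real_divide simp flip: of_real_diff)
qed

text \<open>The identity theorem, started from the ray where the Neumann argument works. The product
  form is deliberate: zeros of the Euler integral away from that ray are not yet excluded.\<close>

lemma spectral_measure_III_transform:
  assumes c: "c \<ge> 0" "c + a > 0" "c + b > 0" "a \<ge> - 1" "b \<ge> - 1"
    and \<nu>: "is_spectral_measure (J_III a b c) \<nu>" and supp: "AE x in \<nu>. x \<in> {0..1}"
    and s: "s \<notin> \<real>\<^sub>\<le>\<^sub>0"
  shows "euler_intc (c + a) (c + b) (c + 1) s = euler_intc (c + a) (c + b) c s * stieltjes \<nu> s"
proof -
  have \<nu>': "prob_space \<nu>" "sets \<nu> = sets borel" using \<nu> by (auto simp: is_spectral_measure_def)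
  define K where "K = max 4 ((2 * c + a + b + 4) * (2 * c + a + b + 5))"
  define f where "f s = euler_intc (c + a) (c + b) (c + 1) s - euler_intc (c + a) (c + b) c s * stieltjes \<nu> s" for s
  have "f s = 0"
  proof (rule analytic_continuation[of f "- \<real>\<^sub>\<le>\<^sub>0" "of_real ` {K<..}" "of_real (K + 1)"])
    show "f holomorphic_on - \<real>\<^sub>\<le>\<^sub>0"
      unfolding f_def by (intro holomorphic_intros euler_intc_holomorphic stieltjes_holomorphic \<nu>' supp c)
    show "complex_of_real (K + 1) islimpt of_real ` {K<..}" by (rule islimpt_of_real_ray) simp
    show "complex_of_real ` {K<..} \<subseteq> - \<real>\<^sub>\<le>\<^sub>0" by (auto simp: slit_plane_iff K_def)
    show "complex_of_real (K + 1) \<in> - \<real>\<^sub>\<le>\<^sub>0" by (auto simp: slit_plane_iff K_def)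
    fix z assume "z \<in> complex_of_real ` {K<..}"
    then obtain x where x: "x > K" "z = of_real x" by auto
    then have x4: "x \<ge> 4" "x \<ge> (2 * c + a + b + 4) * (2 * c + a + b + 5)" by (auto simp: K_def)
    have "stieltjes \<nu> z = of_real (\<integral>t. 1 / (x + t) \<partial>\<nu>)"
      unfolding stieltjes_def x(2) integral_complex_of_real[symmetric] by simp
    then show "f z = 0"
      using spectral_measure_III_transform_large[OF c \<nu> supp x4] x4 c
      by (simp add: f_def x(2) euler_intc_of_real flip: of_real_mult)
  qed (use s in \<open>auto simp: connected_slit_plane open_Compl\<close>)
  then show ?thesis by (simp add: f_def)
qed

section \<open>The hypergeometric equation\<close>

definition hyp2F1c :: "real \<Rightarrow> real \<Rightarrow> real \<Rightarrow> complex \<Rightarrow> complex" where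
  "hyp2F1c p q r = eval_fps (fps_hypergeo [of_real p, of_real q] [of_real r] 1)"

text \<open>Ratio test with coefficient ratios tending to 1. It covers every \<open>r\<close>: if
  \<open>r + n = 0\<close>, division by zero makes the ratio, and with it all later coefficients,
  equal to 0.\<close>

lemma fps_hypergeo_conv_radius:
  fixes p q r :: real
  shows "fps_conv_radius (fps_hypergeo [of_real p, of_real q] [of_real r] 1 :: 'a :: {banach, real_normed_field} fps) \<ge> 1"
proof -
  let ?f = "fps_hypergeo [of_real p, of_real q] [of_real r] 1 :: 'a fps"
  define \<rho> where "\<rho> n = (p + real n) * (q + real n) / ((r + real n) * (real n + 1))" for n
  have rec: "fps_nth ?f (Suc n) = of_real (\<rho> n) * fps_nth ?f n" for n
    by (subst fps_hypergeo_rec) (simp add: \<rho>_def add_ac mult_ac)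
  have \<rho>: "\<rho> \<longlonglongrightarrow> 1" unfolding \<rho>_def by real_asymp
  show ?thesis
    unfolding fps_conv_radius_def
  proof (rule conv_radius_geI_ex)
    fix x :: real assume x: "0 < x" "ereal x < 1"
    then have x1: "x < 1" by simp
    have "(\<lambda>n. \<bar>\<rho> n\<bar> * x) \<longlonglongrightarrow> \<bar>1\<bar> * x" by (intro tendsto_intros \<rho>)
    moreover have "\<bar>1\<bar> * x < (1 + x) / 2" using x1 by simp
    ultimately have "\<forall>\<^sub>F n in sequentially. \<bar>\<rho> n\<bar> * x < (1 + x) / 2" by (rule order_tendstoD(2))
    then obtain N where N: "\<And>n. n \<ge> N \<Longrightarrow> \<bar>\<rho> n\<bar> * x \<le> (1 + x) / 2"
      unfolding eventually_sequentially by (meson less_imp_le)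
    have "summable (\<lambda>n. fps_nth ?f n * of_real x ^ n)"
    proof (rule summable_ratio_test[of "(1 + x) / 2" N])
      show "(1 + x) / 2 < 1" using x1 by simp
      fix n assume n: "n \<ge> N"
      have "norm (fps_nth ?f (Suc n) * of_real x ^ Suc n) = (\<bar>\<rho> n\<bar> * x) * norm (fps_nth ?f n * of_real x ^ n)"
        unfolding rec using x by (simp add: norm_mult norm_power mult_ac del: fps_hypergeo_nth)
      also have "\<dots> \<le> ((1 + x) / 2) * norm (fps_nth ?f n * of_real x ^ n)"
        by (intro mult_right_mono N n) simp
      finally show "norm (fps_nth ?f (Suc n) * of_real x ^ Suc n) \<le> (1 + x) / 2 * norm (fps_nth ?f n * of_real x ^ n)" .
    qed
    then show "\<exists>z. norm z = x \<and> summable (\<lambda>n. fps_nth ?f n * z ^ n)"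
      using x by (intro exI[of _ "of_real x"]) auto
  qed
qed

lemma hyp2F1_of_real:
  assumes "\<bar>x\<bar> < 1"
  shows "of_real (hyp2F1 p q r x) = hyp2F1c p q r (of_real x)"
proof -
  let ?f = "fps_hypergeo [p, q] [r] 1 :: real fps"
  let ?g = "fps_hypergeo [of_real p, of_real q] [of_real r] 1 :: complex fps"
  have "fps_conv_radius ?f \<ge> 1" using fps_hypergeo_conv_radius[of p q r, where ?'a = real] by simp
  moreover have "ereal (norm x) < 1" using assms by simp
  ultimately have "ereal (norm x) < fps_conv_radius ?f" by (rule less_le_trans[rotated])
  then have "summable (\<lambda>n. fps_nth ?f n * x ^ n)" by (rule summable_fps)
  then have "of_real (\<Sum>n. fps_nth ?f n * x ^ n) = (\<Sum>n. of_real (fps_nth ?f n * x ^ n) :: complex)"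
    by (rule suminf_of_real)
  also have "\<dots> = (\<Sum>n. fps_nth ?g n * of_real x ^ n)"
    by (intro suminf_cong) (simp add: pochhammer_of_real)
  finally show ?thesis by (simp add: hyp2F1_def hyp2F1c_def eval_fps_def)
qed

lemma hyp2F1c_0 [simp]: "hyp2F1c p q r 0 = 1"
  by (simp add: hyp2F1c_def eval_fps_at_0)

lemma hyp2F1c_nth: "fps_nth (fps_hypergeo [of_real p, of_real q] [of_real r] 1 :: complex fps) n =
   of_real (pochhammer p n * pochhammer q n / (pochhammer r n * fact n))"
  by (simp add: pochhammer_of_real)

lemma hyp2F1c_norm_less:
  assumes "norm z < 1"
  shows "ereal (norm z) < fps_conv_radius (fps_hypergeo [of_real p, of_real q] [of_real r] 1 :: complex fps)"
proof -
  have "ereal (norm z) < 1" using assms by simp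
  then show ?thesis using fps_hypergeo_conv_radius[of p q r, where ?'a = complex] by (rule less_le_trans)
qed

lemma hyp2F1c_fps_deriv:
  assumes "r \<notin> \<int>"
  shows "fps_deriv (fps_hypergeo [of_real p, of_real q] [of_real r] 1 :: complex fps) =
     fps_const (of_real (p * q / r)) * fps_hypergeo [of_real (p + 1), of_real (q + 1)] [of_real (r + 1)] 1"
proof (rule fps_ext)
  fix n
  have r: "r \<noteq> 0" using assms by auto
  have eq: "(1 + real n) * (pochhammer p (Suc n) * pochhammer q (Suc n) / (pochhammer r (Suc n) * fact (Suc n)))
      = p * q / r * (pochhammer (p + 1) n * pochhammer (q + 1) n / (pochhammer (r + 1) n * fact n))"
    by (simp add: pochhammer_rec divide_simps)
  have on: "of_nat (n + 1) = complex_of_real (1 + real n)" by simp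
  show "fps_nth (fps_deriv (fps_hypergeo [of_real p, of_real q] [of_real r] 1 :: complex fps)) n =
     fps_nth (fps_const (of_real (p * q / r)) * fps_hypergeo [of_real (p + 1), of_real (q + 1)] [of_real (r + 1)] 1) n"
    unfolding fps_deriv_nth fps_mult_left_const_nth hyp2F1c_nth on of_real_mult[symmetric]
    using eq by (simp only: Suc_eq_plus1)
qed

lemma hyp2F1c_has_field_derivative:
  assumes "r \<notin> \<int>" "norm z < 1"
  shows "(hyp2F1c p q r has_field_derivative of_real (p * q / r) * hyp2F1c (p + 1) (q + 1) (r + 1) z) (at z)"
proof -
  have "(hyp2F1c p q r has_field_derivative eval_fps (fps_deriv (fps_hypergeo [of_real p, of_real q] [of_real r] 1)) z) (at z)"
    unfolding hyp2F1c_def by (rule has_field_derivative_eval_fps[OF hyp2F1c_norm_less[OF assms(2)]])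
  also have "eval_fps (fps_deriv (fps_hypergeo [of_real p, of_real q] [of_real r] 1)) z =
      of_real (p * q / r) * hyp2F1c (p + 1) (q + 1) (r + 1) z"
    unfolding hyp2F1c_fps_deriv[OF assms(1)] hyp2F1c_def
    by (subst eval_fps_mult) (use hyp2F1c_norm_less[OF assms(2), of "p + 1" "q + 1" "r + 1"] in simp_all)
  finally show ?thesis .
qed

text \<open>The hypergeometric equation for \<open>F = hyp2F1c p q r\<close>, divided by \<open>p q / r\<close> so that it also holds
  when \<open>p q = 0\<close>.\<close>

lemma hyp2F1c_ode:
  assumes r: "r \<notin> \<int>" "r + 1 \<notin> \<int>" and z: "norm z < 1"
    and G': "(hyp2F1c (p + 1) (q + 1) (r + 1) has_field_derivative G') (at z)"
  shows "z * (1 - z) * G' + (of_real r - of_real (p + q + 1) * z) * hyp2F1c (p + 1) (q + 1) (r + 1) z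
    = of_real r * hyp2F1c p q r z"
proof -
  define FF where "FF = (fps_hypergeo [of_real p, of_real q] [of_real r] 1 :: complex fps)"
  define GG where "GG = (fps_hypergeo [of_real (p + 1), of_real (q + 1)] [of_real (r + 1)] 1 :: complex fps)"
  define g where "g n = pochhammer (p + 1) n * pochhammer (q + 1) n / (pochhammer (r + 1) n * fact n)" for n
  define f where "f n = pochhammer p n * pochhammer q n / (pochhammer r n * fact n)" for n
  have Fn: "fps_nth FF n = of_real (f n)" and Gn: "fps_nth GG n = of_real (g n)" for n
    unfolding f_def g_def FF_def GG_def hyp2F1c_nth by simp_all
  have r0': "r + real n \<noteq> 0" for n
  proof
    assume "r + real n = 0"
    then have "r = - of_nat n" by simp
    then show False using r(1) by simp
  qed
  have r0: "r \<noteq> 0" "r + real n \<noteq> 0" for n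
    using r0' r0'[of 0] by simp_all
  have f_Suc: "(1 + real n) * (r * f (Suc n)) = p * q * g n" for n
  proof -
    have "f (Suc n) = (p * pochhammer (p + 1) n) * (q * pochhammer (q + 1) n) / ((r * pochhammer (r + 1) n) * ((1 + real n) * fact n))"
      by (simp add: f_def pochhammer_rec)
    also have "\<dots> = (p * q / (r * (1 + real n))) * g n"
      by (simp add: g_def mult_ac)
    finally show ?thesis using r0(1) by (simp add: add_eq_0_iff)
  qed
  have g_Suc: "(r + 1 + real n) * ((1 + real n) * g (Suc n)) = (p + 1 + real n) * (q + 1 + real n) * g n" for n
  proof -
    have nz: "r + 1 + real n \<noteq> 0" using r0(2)[of "Suc n"] by (simp add: add_ac)
    have "g (Suc n) = (pochhammer (p + 1) n * (p + 1 + real n)) * (pochhammer (q + 1) n * (q + 1 + real n))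
        / ((pochhammer (r + 1) n * (r + 1 + real n)) * ((1 + real n) * fact n))"
      by (simp add: g_def pochhammer_Suc)
    also have "\<dots> = ((p + 1 + real n) * (q + 1 + real n) / ((r + 1 + real n) * (1 + real n))) * g n"
      by (simp add: g_def mult_ac)
    finally show ?thesis using nz by (simp add: add_eq_0_iff)
  qed
  have key: "fps_X * (1 - fps_X) * fps_deriv GG + (fps_const (of_real r) - fps_const (of_real (p + q + 1)) * fps_X) * GG
     = fps_const (of_real r) * FF"
  proof (rule fps_ext)
    fix n
    have e: "fps_X * (1 - fps_X) * fps_deriv GG + (fps_const (of_real r) - fps_const (of_real (p + q + 1)) * fps_X) * GG
      = fps_const (of_real r) * GG + fps_X * (fps_deriv GG - fps_X * fps_deriv GG - fps_const (of_real (p + q + 1)) * GG)"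
      by (simp add: algebra_simps)
    show "fps_nth (fps_X * (1 - fps_X) * fps_deriv GG + (fps_const (of_real r) - fps_const (of_real (p + q + 1)) * fps_X) * GG) n
       = fps_nth (fps_const (of_real r) * FF) n"
    proof (cases n)
      case 0
      then show ?thesis unfolding e by (simp add: Fn Gn f_def g_def del: fps_hypergeo_nth)
    next
      case (Suc m)
      have nm: "1 + real m \<noteq> 0" by linarith
      have "fps_nth (fps_X * fps_deriv GG) m = of_real (real m * g m)"
        by (cases m) (simp_all add: Gn del: fps_hypergeo_nth)
      then have "fps_nth (fps_const (of_real r) * GG + fps_X * (fps_deriv GG - fps_X * fps_deriv GG - fps_const (of_real (p + q + 1)) * GG)) n
        = of_real (r * g (Suc m) + ((1 + real m) * g (Suc m) - real m * g m - (p + q + 1) * g m))"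
        using Suc by (simp add: Gn del: fps_hypergeo_nth)
      also have "r * g (Suc m) + ((1 + real m) * g (Suc m) - real m * g m - (p + q + 1) * g m) = r * f (Suc m)"
      proof -
        have "(1 + real m) * (r * g (Suc m) + ((1 + real m) * g (Suc m) - real m * g m - (p + q + 1) * g m))
           = (r + 1 + real m) * ((1 + real m) * g (Suc m)) - (1 + real m) * (real m + p + q + 1) * g m"
          by (simp add: algebra_simps)
        also have "\<dots> = p * q * g m" unfolding g_Suc by (simp add: algebra_simps)
        also have "\<dots> = (1 + real m) * (r * f (Suc m))" by (rule f_Suc[symmetric])
        finally show ?thesis using nm by simp
      qed
      finally show ?thesis unfolding e using Suc by (simp add: Fn del: fps_hypergeo_nth)
    qed
  qed
  have RG: "ereal (norm z) < fps_conv_radius GG" and RF: "ereal (norm z) < fps_conv_radius FF"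
    unfolding FF_def GG_def using hyp2F1c_norm_less[OF z] by blast+
  have RG': "ereal (norm z) < fps_conv_radius (fps_deriv GG)"
    using RG fps_conv_radius_deriv[of GG] by simp
  have "G' = eval_fps (fps_deriv GG) z"
    using DERIV_unique[OF G'] has_field_derivative_eval_fps[OF RG] unfolding hyp2F1c_def GG_def by blast
  have R1: "ereal (norm z) < fps_conv_radius (fps_X * (1 - fps_X) :: complex fps)"
    "ereal (norm z) < fps_conv_radius (fps_const (of_real r) - fps_const (of_real (p + q + 1)) * fps_X :: complex fps)"
    "ereal (norm z) < fps_conv_radius (1 - fps_X :: complex fps)"
    "ereal (norm z) < fps_conv_radius (fps_const (of_real (p + q + 1)) * fps_X :: complex fps)"
  proof -
    have b: "fps_conv_radius (1 - fps_X :: complex fps) = \<infinity>"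
      using fps_conv_radius_diff[of "1 :: complex fps" fps_X] by simp
    have d: "fps_conv_radius (fps_const (of_real (p + q + 1)) * fps_X :: complex fps) = \<infinity>"
      using fps_conv_radius_mult[of "fps_const (of_real (p + q + 1)) :: complex fps" fps_X] by simp
    have a: "fps_conv_radius (fps_X * (1 - fps_X) :: complex fps) = \<infinity>"
      using fps_conv_radius_mult[of "fps_X :: complex fps" "1 - fps_X"] b by simp
    have c: "fps_conv_radius (fps_const (of_real r) - fps_const (of_real (p + q + 1)) * fps_X :: complex fps) = \<infinity>"
      using fps_conv_radius_diff[of "fps_const (of_real r) :: complex fps" "fps_const (of_real (p + q + 1)) * fps_X"] d by simp
    show "ereal (norm z) < fps_conv_radius (fps_X * (1 - fps_X) :: complex fps)"
      "ereal (norm z) < fps_conv_radius (fps_const (of_real r) - fps_const (of_real (p + q + 1)) * fps_X :: complex fps)"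
      "ereal (norm z) < fps_conv_radius (1 - fps_X :: complex fps)"
      "ereal (norm z) < fps_conv_radius (fps_const (of_real (p + q + 1)) * fps_X :: complex fps)"
      unfolding a b c d by simp_all
  qed
  have m: "ereal (norm z) < fps_conv_radius (f * g)" if "ereal (norm z) < fps_conv_radius f" "ereal (norm z) < fps_conv_radius g"
    for f g :: "complex fps"
    using fps_conv_radius_mult[of f g] that by (metis less_le_trans min_less_iff_conj)
  have "eval_fps (fps_X * (1 - fps_X) * fps_deriv GG + (fps_const (of_real r) - fps_const (of_real (p + q + 1)) * fps_X) * GG) z
     = z * (1 - z) * eval_fps (fps_deriv GG) z + (of_real r - of_real (p + q + 1) * z) * eval_fps GG z"
    using RG RG' R1 m by (simp add: eval_fps_add eval_fps_mult eval_fps_diff)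
  moreover have "eval_fps (fps_const (of_real r) * FF) z = of_real r * eval_fps FF z"
    using RF by (simp add: eval_fps_mult)
  ultimately show ?thesis
    unfolding key \<open>G' = _\<close> hyp2F1c_def FF_def[symmetric] GG_def[symmetric] by simp
qed

section \<open>Frobenius solutions at the origin and their Wronskian\<close>

definition frob0 :: "real \<Rightarrow> real \<Rightarrow> real \<Rightarrow> complex \<Rightarrow> complex" where
  "frob0 a b c = hyp2F1c c (- c - a - b - 1) (- a)"

definition dfrob0 :: "real \<Rightarrow> real \<Rightarrow> real \<Rightarrow> complex \<Rightarrow> complex" where
  "dfrob0 a b c x = of_real (c * (- c - a - b - 1) / (- a)) * hyp2F1c (c + 1) (- c - a - b) (1 - a) x"

text \<open>The solution with exponent \<open>1 + a\<close> is \<open>x^(1+a)\<close> times a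
  hypergeometric series with parameters \<open>c + a + 1\<close>, \<open>-c - b\<close>,
  \<open>2 + a\<close>. Euler's transformation extracts \<open>(1 - x)^(1+b)\<close> from it and
  leaves this factor.\<close>

definition frob1_factor :: "real \<Rightarrow> real \<Rightarrow> real \<Rightarrow> complex \<Rightarrow> complex" where
  "frob1_factor a b c = hyp2F1c (1 - c) (2 + c + a + b) (2 + a)"

text \<open>The quasi-derivative of the second solution: in the variable \<open>s = -x\<close>, the
  derivative of \<open>frob1\<close> divided by the weight \<open>ode_weight\<close>. Dividing out
  the weight leaves a series analytic at 0.\<close>

definition frob1_quasi :: "real \<Rightarrow> real \<Rightarrow> real \<Rightarrow> complex \<Rightarrow> complex" where
  "frob1_quasi a b c x = of_real (1 + a) * hyp2F1c (- c) (1 + c + a + b) (1 + a) x"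

lemma Ints_shift: "(a::real) \<notin> \<int> \<Longrightarrow> of_int k - a \<notin> \<int>" "(a::real) \<notin> \<int> \<Longrightarrow> of_int k + a \<notin> \<int>"
  by (metis Ints_diff Ints_of_int add_diff_cancel_left' diff_diff_eq2 diff_add_cancel)+

lemma nonint_simps:
  assumes "(a::real) \<notin> \<int>"
  shows "- a \<notin> \<int>" "1 - a \<notin> \<int>" "- a + 1 \<notin> \<int>" "2 - a \<notin> \<int>" "1 + a \<notin> \<int>" "2 + a \<notin> \<int>" "1 + a + 1 \<notin> \<int>" "3 + a \<notin> \<int>" "a \<noteq> 0" "1 + a \<noteq> 0" "- a + 1 + 1 \<notin> \<int>" "a - 1 \<notin> \<int>"
proof -
  show "- a \<notin> \<int>" "1 - a \<notin> \<int>" "2 - a \<notin> \<int>" "- a + 1 \<notin> \<int>" "- a + 1 + 1 \<notin> \<int>"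
    using Ints_shift(1)[OF assms, of 0] Ints_shift(1)[OF assms, of 1] Ints_shift(1)[OF assms, of 2] by (simp_all add: algebra_simps)
  show 1: "1 + a \<notin> \<int>" "2 + a \<notin> \<int>" "3 + a \<notin> \<int>" "1 + a + 1 \<notin> \<int>" "a - 1 \<notin> \<int>"
    using Ints_shift(2)[OF assms, of 1] Ints_shift(2)[OF assms, of 2] Ints_shift(2)[OF assms, of 3] Ints_shift(2)[OF assms, of "-1"] by (simp_all add: algebra_simps)
  show "a \<noteq> 0" "1 + a \<noteq> 0" using assms 1(1) by (metis Ints_0)+
qed

lemma frob0_deriv:
  assumes "a \<notin> \<int>" "norm x < 1"
  shows "(frob0 a b c has_field_derivative dfrob0 a b c x) (at x)"
proof -
  have e: "- c - a - b - 1 + 1 = - c - a - b" "- a + 1 = 1 - a" by simp_all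
  show ?thesis
    unfolding frob0_def dfrob0_def
    by (rule hyp2F1c_has_field_derivative[of "- a" x c "- c - a - b - 1", unfolded e])
       (use nonint_simps[OF assms(1)] assms(2) in auto)
qed

lemma dfrob0_deriv:
  assumes a: "a \<notin> \<int>" and x: "norm x < 1"
  obtains D' where "(dfrob0 a b c has_field_derivative D') (at x)"
    "x * (1 - x) * D' = of_real (c * (- c - a - b - 1)) * frob0 a b c x + (of_real a - of_real (a + b) * x) * dfrob0 a b c x"
proof -
  let ?q = "- c - a - b - 1"
  obtain G' where G': "(hyp2F1c (c + 1) (?q + 1) (- a + 1) has_field_derivative G') (at x)"
    using hyp2F1c_has_field_derivative[of "- a + 1" x] nonint_simps[OF a] x by blast
  have "x * (1 - x) * G' + (of_real (- a) - of_real (c + ?q + 1) * x) * hyp2F1c (c + 1) (?q + 1) (- a + 1) x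
    = of_real (- a) * hyp2F1c c ?q (- a) x"
    by (rule hyp2F1c_ode[OF _ _ x G']) (use nonint_simps[OF a] in auto)
  then have ode: "x * (1 - x) * G' = (of_real a - of_real (a + b) * x) * hyp2F1c (c + 1) (?q + 1) (- a + 1) x + of_real (- a) * hyp2F1c c ?q (- a) x"
    by (simp add: algebra_simps)
  define k where "k = complex_of_real (c * ?q / (- a))"
  have dfrob0: "dfrob0 a b c = (\<lambda>x. k * hyp2F1c (c + 1) (?q + 1) (- a + 1) x)"
  proof -
    have e: "- c - a - b - 1 + 1 = - c - a - b" "- a + 1 = 1 - a" by simp_all
    show ?thesis unfolding dfrob0_def[abs_def] k_def e ..
  qed
  have k: "k * of_real (- a) = of_real (c * ?q)"
    unfolding k_def of_real_mult[symmetric] using nonint_simps(9)[OF a] by simp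
  show ?thesis
  proof (rule that)
    show "(dfrob0 a b c has_field_derivative k * G') (at x)"
      unfolding dfrob0 by (rule DERIV_cmult[OF G'])
    have "x * (1 - x) * (k * G') = k * (x * (1 - x) * G')" by simp
    also have "\<dots> = (k * of_real (- a)) * hyp2F1c c ?q (- a) x + (of_real a - of_real (a + b) * x) * (k * hyp2F1c (c + 1) (?q + 1) (- a + 1) x)"
      unfolding ode by algebra
    finally show "x * (1 - x) * (k * G') = of_real (c * ?q) * frob0 a b c x + (of_real a - of_real (a + b) * x) * dfrob0 a b c x"
      unfolding k dfrob0 frob0_def .
  qed
qed

lemma frob1_quasi_deriv:
  assumes a: "a \<notin> \<int>" and x: "norm x < 1"
  shows "(frob1_quasi a b c has_field_derivative of_real (c * (- c - a - b - 1)) * frob1_factor a b c x) (at x)"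
proof -
  have "(frob1_quasi a b c has_field_derivative of_real (1 + a) * (of_real (- c * (1 + c + a + b) / (1 + a)) * hyp2F1c (- c + 1) (1 + c + a + b + 1) (1 + a + 1) x)) (at x)"
    unfolding frob1_quasi_def[abs_def]
    by (intro DERIV_cmult hyp2F1c_has_field_derivative x) (use nonint_simps[OF a] in auto)
  also have "of_real (1 + a) * (of_real (- c * (1 + c + a + b) / (1 + a)) * hyp2F1c (- c + 1) (1 + c + a + b + 1) (1 + a + 1) x)
     = of_real ((1 + a) * (- c * (1 + c + a + b) / (1 + a))) * frob1_factor a b c x"
    by (simp add: frob1_factor_def algebra_simps)
  also have "(1 + a) * (- c * (1 + c + a + b) / (1 + a)) = c * (- c - a - b - 1)"
    using nonint_simps(10)[OF a] by (simp add: field_simps)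
  finally show ?thesis .
qed

lemma frob1_factor_deriv:
  assumes a: "a \<notin> \<int>" and x: "norm x < 1"
  obtains K' where "(frob1_factor a b c has_field_derivative K') (at x)"
    "x * (1 - x) * K' = frob1_quasi a b c x - (of_real (1 + a) - of_real (2 + a + b) * x) * frob1_factor a b c x"
proof -
  obtain G' where G': "(hyp2F1c (- c + 1) (1 + c + a + b + 1) (1 + a + 1) has_field_derivative G') (at x)"
    using hyp2F1c_has_field_derivative[of "1 + a + 1" x] nonint_simps[OF a] x by blast
  have "x * (1 - x) * G' + (of_real (1 + a) - of_real (- c + (1 + c + a + b) + 1) * x) * hyp2F1c (- c + 1) (1 + c + a + b + 1) (1 + a + 1) x
    = of_real (1 + a) * hyp2F1c (- c) (1 + c + a + b) (1 + a) x"
    by (rule hyp2F1c_ode[OF _ _ x G']) (use nonint_simps[OF a] in auto)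
  moreover have frob1_factor: "frob1_factor a b c = hyp2F1c (- c + 1) (1 + c + a + b + 1) (1 + a + 1)"
    by (simp add: frob1_factor_def algebra_simps)
  moreover have "- c + (1 + c + a + b) + 1 = 2 + a + b" by simp
  ultimately show ?thesis
    using G' by (intro that[of G']) (simp_all add: frob1_quasi_def eq_diff_eq add.assoc)
qed

text \<open>The Wronskian of the two Frobenius solutions with the weight divided out. The two
  equations make its derivative vanish, and since no fractional power is left, the constant can be
  read off at 0.\<close>

lemma hyper_wronskian:
  assumes a: "a \<notin> \<int>" and x: "norm x < 1"
  shows "frob0 a b c x * frob1_quasi a b c x - x * (1 - x) * dfrob0 a b c x * frob1_factor a b c x = of_real (1 + a)"
proof -
  let ?W = "\<lambda>x. frob0 a b c x * frob1_quasi a b c x - x * (1 - x) * dfrob0 a b c x * frob1_factor a b c x"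
  have "\<exists>k. \<forall>x\<in>ball 0 1. ?W x = k"
  proof (rule has_field_derivative_zero_constant)
    fix x :: complex assume "x \<in> ball 0 1"
    then have x: "norm x < 1" by simp
    obtain D' where D': "(dfrob0 a b c has_field_derivative D') (at x)"
      "x * (1 - x) * D' = of_real (c * (- c - a - b - 1)) * frob0 a b c x + (of_real a - of_real (a + b) * x) * dfrob0 a b c x"
      using dfrob0_deriv[OF a x] by blast
    obtain K' where K': "(frob1_factor a b c has_field_derivative K') (at x)"
      "x * (1 - x) * K' = frob1_quasi a b c x - (of_real (1 + a) - of_real (2 + a + b) * x) * frob1_factor a b c x"
      using frob1_factor_deriv[OF a x] by blast
    define F D K T \<kappa> A B where "F = frob0 a b c x" and "D = dfrob0 a b c x" and "K = frob1_factor a b c x" and "T = frob1_quasi a b c x"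
      and "\<kappa> = complex_of_real (c * (- c - a - b - 1))" and "A = complex_of_real a" and "B = complex_of_real b"
    have dx: "((\<lambda>x. x * (1 - x)) has_field_derivative 1 - 2 * x) (at x)"
      by (auto intro!: derivative_eq_intros)
    have "(?W has_field_derivative (D * T + \<kappa> * K * F) - (((1 - 2 * x) * D + D' * (x * (1 - x))) * K + K' * (x * (1 - x) * D))) (at x)"
      unfolding F_def D_def K_def T_def \<kappa>_def
      by (intro DERIV_diff DERIV_mult frob0_deriv frob1_quasi_deriv D'(1) K'(1) dx a x)
    moreover have "(D * T + \<kappa> * K * F) - (((1 - 2 * x) * D + D' * (x * (1 - x))) * K + K' * (x * (1 - x) * D)) = 0"
      using D'(2) K'(2)
      unfolding F_def[symmetric] D_def[symmetric] K_def[symmetric] T_def[symmetric] \<kappa>_def[symmetric]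
        of_real_add of_real_1 of_real_numeral A_def[symmetric] B_def[symmetric] by algebra
    ultimately show "(?W has_field_derivative 0) (at x within ball 0 1)"
      by (metis has_field_derivative_at_within)
  qed simp
  then obtain k where k: "\<And>x. norm x < 1 \<Longrightarrow> ?W x = k" by auto
  have "k = ?W 0" using k[of 0] by simp
  also have "\<dots> = of_real (1 + a)" by (simp add: frob0_def frob1_quasi_def)
  finally show ?thesis using k[OF x] by simp
qed

text \<open>A branch of the logarithm that is holomorphic across the negative real axis and agrees with
  the principal branch on the closed upper half plane: the cut is the negative imaginary axis.\<close>

definition ln_up :: "complex \<Rightarrow> complex" where
  "ln_up s = Ln (- \<i> * s) + \<i> * of_real (pi / 2)"

definition powr_up :: "real \<Rightarrow> complex \<Rightarrow> complex" where
  "powr_up e s = exp (of_real e * ln_up s)"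

lemma ln_up_deriv:
  assumes "Re s \<noteq> 0 \<or> Im s > 0"
  shows "(ln_up has_field_derivative 1 / s) (at s)"
proof -
  have nz: "s \<noteq> 0" using assms by auto
  have "- \<i> * s \<notin> \<real>\<^sub>\<le>\<^sub>0" using assms by (auto simp: complex_nonpos_Reals_iff)
  then have "((\<lambda>s. Ln (- \<i> * s)) has_field_derivative inverse (- \<i> * s) * (- \<i>)) (at s)"
    by (intro DERIV_chain2[where f = Ln and g = "\<lambda>s. - \<i> * s"] has_field_derivative_Ln)
       (auto intro!: derivative_eq_intros)
  moreover have "inverse (- \<i> * s) * (- \<i>) = 1 / s"
  proof -
    have "(inverse (- \<i> * s) * (- \<i>)) * s = 1"
      unfolding mult.assoc by (rule left_inverse) (use nz in simp)
    then show ?thesis using nz by (metis nonzero_eq_divide_eq)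
  qed
  ultimately have "((\<lambda>s. Ln (- \<i> * s)) has_field_derivative 1 / s) (at s)" by simp
  from DERIV_add[OF this DERIV_const]
  show ?thesis unfolding ln_up_def[abs_def] by simp
qed

lemma powr_up_deriv:
  assumes "Re s \<noteq> 0 \<or> Im s > 0"
  shows "(powr_up e has_field_derivative of_real e * powr_up e s / s) (at s)"
proof -
  have "(powr_up e has_field_derivative exp (of_real e * ln_up s) * (of_real e * (1 / s))) (at s)"
    unfolding powr_up_def[abs_def] by (intro DERIV_chain2[OF DERIV_exp] DERIV_cmult ln_up_deriv assms)
  then show ?thesis by (simp add: powr_up_def mult_ac)
qed

lemma powr_up_Suc:
  assumes "Re s \<noteq> 0 \<or> Im s > 0"
  shows "powr_up (1 + e) s = s * powr_up e s"
proof -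
  have "s \<noteq> 0" using assms by auto
  then have "exp (Ln (- \<i> * s)) = - \<i> * s" by (intro exp_Ln) simp
  moreover have "exp (\<i> * of_real (pi / 2)) = \<i>"
    using cis_conv_exp[of "pi / 2"] cis_pi_half by (simp only:)
  ultimately have "exp (ln_up s) = - \<i> * s * \<i>" unfolding ln_up_def exp_add by (simp only:)
  then have "exp (ln_up s) = s" by (simp add: complex_eq_iff)
  then show ?thesis by (simp add: powr_up_def distrib_right exp_add)
qed

lemma powr_up_nonzero [simp]: "powr_up e s \<noteq> 0" by (simp add: powr_up_def)

lemma ln_up_pos: "x > 0 \<Longrightarrow> ln_up (of_real x) = of_real (ln x)"
proof -
  assume x: "x > 0"
  have "Ln (- \<i> * of_real x) = Ln (of_real x * (- \<i>))" by (simp add: mult.commute)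
  also have "\<dots> = of_real (ln x) + Ln (- \<i>)" using x by (subst Ln_times_of_real) (auto simp: Ln_of_real)
  finally show ?thesis by (simp add: ln_up_def)
qed

lemma ln_up_neg: "x > 0 \<Longrightarrow> ln_up (- of_real x) = of_real (ln x) + \<i> * of_real pi"
proof -
  assume x: "x > 0"
  have "Ln (- \<i> * - of_real x) = Ln (of_real x * \<i>)" by (simp add: mult.commute)
  also have "\<dots> = of_real (ln x) + Ln \<i>" using x by (subst Ln_times_of_real) (auto simp: Ln_of_real)
  finally show ?thesis by (simp add: ln_up_def field_simps)
qed

lemma powr_up_pos: "x > 0 \<Longrightarrow> powr_up e (of_real x) = of_real (x powr e)"
  by (simp add: powr_up_def ln_up_pos powr_def exp_of_real flip: of_real_mult)

lemma powr_up_neg: "x > 0 \<Longrightarrow> powr_up e (- of_real x) = of_real (x powr e) * exp (\<i> * of_real (pi * e))"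
  by (simp add: powr_up_def ln_up_neg powr_def distrib_left exp_add mult_ac flip: exp_of_real)

section \<open>The second solution on the slit disc\<close>

definition ode_weight :: "real \<Rightarrow> real \<Rightarrow> complex \<Rightarrow> complex" where
  "ode_weight a b s = powr_up a s * (1 + s) powr of_real b"

definition frob1 :: "real \<Rightarrow> real \<Rightarrow> real \<Rightarrow> complex \<Rightarrow> complex" where
  "frob1 a b c s = powr_up (1 + a) s * (1 + s) powr of_real (1 + b) * frob1_factor a b c (- s)"

text \<open>The unit disc without the cut of \<open>ln_up\<close>. It contains the interval (-1,0),
  so the Frobenius solutions are holomorphic at the points where boundary values are taken.\<close>

definition slit_disc :: "complex set" where
  "slit_disc = {s. norm s < 1 \<and> (Re s \<noteq> 0 \<or> Im s > 0)}"

lemma one_plus_slit: "norm (s::complex) < 1 \<Longrightarrow> 1 + s \<notin> \<real>\<^sub>\<le>\<^sub>0" "norm (s::complex) < 1 \<Longrightarrow> 1 + s \<noteq> 0"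
proof -
  show *: "norm (s::complex) < 1 \<Longrightarrow> 1 + s \<notin> \<real>\<^sub>\<le>\<^sub>0"
    using abs_Re_le_cmod[of s] by (auto simp: complex_nonpos_Reals_iff)
  then show "norm (s::complex) < 1 \<Longrightarrow> 1 + s \<noteq> 0" by auto
qed

lemma ode_weight_nonzero: "s \<in> slit_disc \<Longrightarrow> ode_weight a b s \<noteq> 0"
  using one_plus_slit(2) by (simp add: ode_weight_def slit_disc_def)

lemma ode_weight_deriv:
  assumes "s \<in> slit_disc"
  shows "(ode_weight a b has_field_derivative ode_weight a b s * (of_real a / s + of_real b / (1 + s))) (at s)"
proof -
  have s: "Re s \<noteq> 0 \<or> Im s > 0" "1 + s \<notin> \<real>\<^sub>\<le>\<^sub>0" "1 + s \<noteq> 0" using assms one_plus_slit by (auto simp: slit_disc_def)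
  have "(1 + s) powr (of_real b - 1) = (1 + s) powr of_real b / (1 + s)"
    using s(3) by (simp add: powr_diff)
  then have "((\<lambda>s. (1 + s) powr of_real b) has_field_derivative of_real b * (1 + s) powr of_real b / (1 + s)) (at s)"
    using s(2) by (auto intro!: derivative_eq_intros)
  from DERIV_mult[OF powr_up_deriv[OF s(1)] this]
  show ?thesis unfolding ode_weight_def[abs_def] by (rule DERIV_cong) (simp add: field_simps)
qed

lemma frob1_conv_ode_weight:
  assumes "s \<in> slit_disc"
  shows "frob1 a b c s = ode_weight a b s * (s * (1 + s)) * frob1_factor a b c (- s)"
proof -
  have s: "Re s \<noteq> 0 \<or> Im s > 0" "1 + s \<noteq> 0" using assms one_plus_slit by (auto simp: slit_disc_def)
  have "(1 + s) powr of_real (1 + b) = (1 + s) powr of_real b * (1 + s)"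
    using s(2) by (simp add: powr_add mult.commute)
  then show ?thesis by (simp add: frob1_def ode_weight_def powr_up_Suc[OF s(1)] mult_ac)
qed

lemma frob1_deriv:
  assumes a: "a \<notin> \<int>" and s: "s \<in> slit_disc"
  shows "(frob1 a b c has_field_derivative ode_weight a b s * frob1_quasi a b c (- s)) (at s)"
proof -
  have n: "norm (- s) < 1" and s': "Re s \<noteq> 0 \<or> Im s > 0" "1 + s \<notin> \<real>\<^sub>\<le>\<^sub>0" "1 + s \<noteq> 0" "s \<noteq> 0"
    using s one_plus_slit by (auto simp: slit_disc_def)
  obtain K' where K': "(frob1_factor a b c has_field_derivative K') (at (- s))"
      "(- s) * (1 - (- s)) * K' = frob1_quasi a b c (- s) - (of_real (1 + a) - of_real (2 + a + b) * (- s)) * frob1_factor a b c (- s)"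
    using frob1_factor_deriv[OF a n] by blast
  have dK: "((\<lambda>s. frob1_factor a b c (- s)) has_field_derivative K' * (- 1)) (at s)"
    by (rule DERIV_chain2[where f = "frob1_factor a b c" and g = "\<lambda>s. - s"]) (auto intro!: derivative_eq_intros K'(1))
  have dp: "((\<lambda>s. (1 + s) powr of_real (1 + b)) has_field_derivative of_real (1 + b) * (1 + s) powr of_real b) (at s)"
    using s'(2) by (auto intro!: derivative_eq_intros)
  have e: "(1 + s) powr of_real (1 + b) = (1 + s) powr of_real b * (1 + s)"
    using s'(3) by (simp add: powr_add mult.commute)
  have dpw: "(powr_up (1 + a) has_field_derivative of_real (1 + a) * powr_up a s) (at s)"
    using powr_up_deriv[OF s'(1), of "1 + a"] s'(4) by (simp add: powr_up_Suc[OF s'(1)])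
  define P Q K T A B where "P = powr_up a s" and "Q = (1 + s) powr of_real b" and "K = frob1_factor a b c (- s)" and "T = frob1_quasi a b c (- s)"
    and "A = complex_of_real a" and "B = complex_of_real b"
  have "(frob1 a b c has_field_derivative (of_real (1 + a) * P * (Q * (1 + s)) + of_real (1 + b) * Q * (s * P)) * K + K' * (- 1) * (s * P * (Q * (1 + s)))) (at s)"
    using DERIV_mult[OF DERIV_mult[OF dpw dp] dK]
    unfolding frob1_def[abs_def] e powr_up_Suc[OF s'(1)] P_def Q_def K_def .
  moreover have "(of_real (1 + a) * P * (Q * (1 + s)) + of_real (1 + b) * Q * (s * P)) * K + K' * (- 1) * (s * P * (Q * (1 + s))) = P * Q * T"
    using K'(2) unfolding K_def[symmetric] T_def[symmetric] of_real_add of_real_1 of_real_numeral A_def[symmetric] B_def[symmetric]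
    by algebra
  ultimately show ?thesis by (simp add: P_def Q_def T_def ode_weight_def)
qed

section \<open>Connection formula at the origin\<close>

lemma Beta_weight_integrable:
  assumes "p > -1" "q > -1"
  shows "(\<lambda>t::real. t powr p * (1 - t) powr q) integrable_on {0..1}"
    "integral {0..1} (\<lambda>t. t powr p * (1 - t) powr q) = Beta (p + 1) (q + 1)"
  using has_integral_Beta_real[of "p + 1" "q + 1"] assms by (auto simp: has_integral_iff)

text \<open>\<open>(s + t)^(-c) <= t^(-c)\<close> removes \<open>s\<close> altogether, leaving a
  weight that is integrable at 0 when \<open>a > -1\<close>.\<close>

lemma euler_int_dominated:
  fixes t s a c q :: real
  assumes "t \<in> {0..1}" "s > 0" "c \<ge> 0"
  shows "t powr (c + a) * (1 - t) powr q * (s + t) powr (- c) \<le> t powr a * (1 - t) powr q"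
proof (cases "t = 0")
  case False
  then have t: "t > 0" using assms by (simp add: less_le)
  have "(s + t) powr (- c) \<le> t powr (- c)"
    using t assms by (intro powr_mono2') auto
  then have "t powr (c + a) * (s + t) powr (- c) \<le> t powr (c + a) * t powr (- c)"
    by (intro mult_left_mono) auto
  also have "\<dots> = t powr a" using t by (simp flip: powr_add)
  finally show ?thesis
    using mult_right_mono[of "t powr (c + a) * (s + t) powr (- c)" "t powr a" "(1 - t) powr q"] by (simp add: mult_ac)
qed simp

lemma euler_int_limit_0:
  assumes a: "a > -1" "c \<ge> 0" "c + a > 0" "c + b > 0"
  shows "(\<lambda>n. euler_int (c + a) (c + b) c (1 / real (n + 2))) \<longlonglongrightarrow> Beta (a + 1) (c + b + 1)"
proof -
  let ?s = "\<lambda>n. 1 / real (n + 2)"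
  have "(\<lambda>n. integral {0..1} (\<lambda>t. t powr (c + a) * (1 - t) powr (c + b) * (?s n + t) powr (- c)))
      \<longlonglongrightarrow> integral {0..1} (\<lambda>t. t powr a * (1 - t) powr (c + b))"
  proof (rule dominated_convergence)
    show "(\<lambda>t. t powr (c + a) * (1 - t) powr (c + b) * (?s n + t) powr (- c)) integrable_on {0..1}" for n
      using euler_int_has_integral[of "c + a" "c + b" "?s n" c] a by (auto simp: has_integral_iff)
    show "(\<lambda>t. t powr a * (1 - t) powr (c + b)) integrable_on {0..1}"
      using a by (intro Beta_weight_integrable) auto
    show "norm (t powr (c + a) * (1 - t) powr (c + b) * (?s n + t) powr (- c)) \<le> t powr a * (1 - t) powr (c + b)"
      if "t \<in> {0..1}" for n t
      using euler_int_dominated[OF that, of "?s n" c a "c + b"] a by simp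
    fix t :: real assume t: "t \<in> {0..1}"
    show "(\<lambda>n. t powr (c + a) * (1 - t) powr (c + b) * (?s n + t) powr (- c)) \<longlonglongrightarrow> t powr a * (1 - t) powr (c + b)"
    proof (cases "t = 0")
      case False
      then have t0: "t > 0" using t by (simp add: less_le)
      have "?s \<longlonglongrightarrow> 0" by real_asymp
      then have "(\<lambda>n. t powr (c + a) * (1 - t) powr (c + b) * (?s n + t) powr (- c)) \<longlonglongrightarrow>
          t powr (c + a) * (1 - t) powr (c + b) * (0 + t) powr (- c)"
        using t0 by (intro tendsto_intros) auto
      also have "t powr (c + a) * (1 - t) powr (c + b) * (0 + t) powr (- c) = t powr a * (1 - t) powr (c + b)"
        using t0 by (simp add: mult.commute mult.left_commute flip: powr_add)
      finally show ?thesis .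
    qed simp
  qed
  then show ?thesis
    using Beta_weight_integrable(2)[of a "c + b"] a by (simp add: euler_int_def add.commute)
qed

text \<open>From \<open>s (s + t)^(-(c+1)) <= (s + t)^(-c)\<close> the dominating function is the
  same as for \<open>euler_int_limit_0\<close>, while the factor \<open>s\<close> sends the
  integrand to 0 at each \<open>t\<close>.\<close>

lemma euler_int_limit_1:
  assumes a: "a > -1" "c \<ge> 0" "c + a > 0" "c + b > 0"
  shows "(\<lambda>n. 1 / real (n + 2) * euler_int (c + a) (c + b) (c + 1) (1 / real (n + 2))) \<longlonglongrightarrow> 0"
proof -
  let ?s = "\<lambda>n. 1 / real (n + 2)"
  let ?f = "\<lambda>n t. ?s n * (t powr (c + a) * (1 - t) powr (c + b) * (?s n + t) powr (- (c + 1)))"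
  have "(\<lambda>n. integral {0..1} (?f n)) \<longlonglongrightarrow> integral {0..1} (\<lambda>t::real. 0::real)"
  proof (rule dominated_convergence)
    show "?f n integrable_on {0..1}" for n
      using has_integral_mult_right[OF euler_int_has_integral[of "c + a" "c + b" "?s n" "c + 1"], of "?s n"] a
      by (auto simp: has_integral_iff)
    show "(\<lambda>t. t powr a * (1 - t) powr (c + b)) integrable_on {0..1}"
      using a by (intro Beta_weight_integrable) auto
    show "norm (?f n t) \<le> t powr a * (1 - t) powr (c + b)" if t: "t \<in> {0..1}" for n t
    proof -
      have st: "0 < ?s n" "0 < ?s n + t" using t by (auto intro: add_pos_nonneg)
      have "(?s n + t) powr (- c) = (?s n + t) powr (- (c + 1)) * (?s n + t)"
        using powr_add_one[of "?s n + t" "- (c + 1)"] st by simp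
      then have "?s n * (?s n + t) powr (- (c + 1)) \<le> (?s n + t) powr (- c)"
        using t st mult_left_mono[of "?s n" "?s n + t" "(?s n + t) powr (- (c + 1))"] by (simp add: mult.commute)
      then have "t powr (c + a) * (1 - t) powr (c + b) * (?s n * (?s n + t) powr (- (c + 1))) \<le>
          t powr (c + a) * (1 - t) powr (c + b) * (?s n + t) powr (- c)"
        by (intro mult_left_mono) auto
      also have "\<dots> \<le> t powr a * (1 - t) powr (c + b)"
        using euler_int_dominated[OF t, of "?s n" c a "c + b"] a by simp
      finally show ?thesis using st by (simp add: mult_ac)
    qed
    fix t :: real assume t: "t \<in> {0..1}"
    show "(\<lambda>n. ?f n t) \<longlonglongrightarrow> 0"
    proof (cases "t = 0")
      case False
      then have t0: "t > 0" using t by (simp add: less_le)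
      have "?s \<longlonglongrightarrow> 0" by real_asymp
      then have "(\<lambda>n. ?f n t) \<longlonglongrightarrow> 0 * (t powr (c + a) * (1 - t) powr (c + b) * (0 + t) powr (- (c + 1)))"
        using t0 by (intro tendsto_intros) auto
      then show ?thesis by simp
    qed simp
  qed
  then show ?thesis
    by (simp add: euler_int_def)
qed

lemma subst_range:
  fixes s v :: real
  assumes "s > 0" "v \<in> {0..1 / (1 + s)}"
  shows "v < 1" "0 \<le> v" "0 \<le> s * v / (1 - v)" "s * v / (1 - v) \<le> 1"
proof -
  have "v * (1 + s) \<le> 1 / (1 + s) * (1 + s)" using assms by (intro mult_right_mono) auto
  then have *: "v + s * v \<le> 1" using assms by (simp add: distrib_left mult.commute)
  show v0: "0 \<le> v" using assms by auto
  have "1 / (1 + s) < 1" using assms by simp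
  then show v1: "v < 1" using assms(2) unfolding atLeastAtMost_iff by linarith
  show "0 \<le> s * v / (1 - v)" using v0 v1 assms by simp
  show "s * v / (1 - v) \<le> 1" using v1 * by (simp add: pos_divide_le_eq)
qed

text \<open>Obtained by the substitution \<open>v = t / (s + t)\<close>, which lets \<open>s \<rightarrow> 0\<close> by dominated convergence.\<close>

lemma euler_int_subst:
  assumes p: "0 < p" "0 < q" "0 < s"
  shows "((\<lambda>v. v powr p * (1 - v) powr (r - p - 2) * (1 - s * v / (1 - v)) powr q) has_integral s powr (r - p - 1) * euler_int p q r s) {0..1 / (1 + s)}"
proof -
  let ?g = "\<lambda>v. s * v / (1 - v)"
  let ?f = "\<lambda>t. t powr p * (1 - t) powr q * (s + t) powr (- r)"
  have lt1: "v < 1" "v \<ge> 0" "?g v \<ge> 0" "?g v \<le> 1" if "v \<in> {0..1 / (1 + s)}" for v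
    using subst_range[OF p(3) that] by auto
  have "((\<lambda>v. (s / (1 - v)\<^sup>2) *\<^sub>R ?f (?g v)) has_integral integral {?g 0..?g (1 / (1 + s))} ?f) {0..1 / (1 + s)}"
  proof (rule has_integral_substitution)
    show "continuous_on {0..1} ?f" using p by (rule euler_int_integrand_continuous)
    show "?g ` {0..1 / (1 + s)} \<subseteq> {0..1}"
    proof (rule image_subsetI)
      fix v assume "v \<in> {0..1 / (1 + s)}"
      from lt1(3,4)[OF this] show "?g v \<in> {0..1}" unfolding atLeastAtMost_iff by blast
    qed
    show "0 \<le> 1 / (1 + s)" using p by simp
    then show "?g 0 \<le> ?g (1 / (1 + s))" using lt1(3)[of "1 / (1 + s)"] by simp
    fix v assume v: "v \<in> {0..1 / (1 + s)}"
    have "(?g has_real_derivative (s * (1 - v) - s * v * (- 1)) / ((1 - v) * (1 - v))) (at v)"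
    proof (rule DERIV_divide)
      show "((\<lambda>v. s * v) has_real_derivative s) (at v)" "((\<lambda>v. 1 - v) has_real_derivative - 1) (at v)"
        by (auto intro!: derivative_eq_intros)
      show "1 - v \<noteq> 0" using lt1[OF v] by simp
    qed
    then show "(?g has_real_derivative s / (1 - v)\<^sup>2) (at v within {0..1 / (1 + s)})"
    proof (rule has_field_derivative_at_within[OF DERIV_cong])
      show "(s * (1 - v) - s * v * (- 1)) / ((1 - v) * (1 - v)) = s / (1 - v)\<^sup>2"
        by (simp add: power2_eq_square right_diff_distrib)
    qed
  qed
  also have "?g 0 = 0" by simp
  also have "?g (1 / (1 + s)) = 1"
  proof -
    have "1 - 1 / (1 + s) = s / (1 + s)" using p by (simp add: field_simps)
    then show ?thesis using p by simp
  qed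
  finally have "((\<lambda>v. s powr (r - p - 1) * ((s / (1 - v)\<^sup>2) *\<^sub>R ?f (?g v))) has_integral s powr (r - p - 1) * euler_int p q r s) {0..1 / (1 + s)}"
    unfolding euler_int_def by (rule has_integral_mult_right)
  moreover have "s powr (r - p - 1) * ((s / (1 - v)\<^sup>2) *\<^sub>R ?f (?g v)) =
      v powr p * (1 - v) powr (r - p - 2) * (1 - s * v / (1 - v)) powr q" if v: "v \<in> {0..1 / (1 + s)}" for v
  proof -
    define u where "u = 1 - v"
    have u: "u > 0" using lt1[OF v] by (simp add: u_def)
    have "s + ?g v = s / u" using u by (simp add: u_def field_simps)
    then have "(s + ?g v) powr (- r) = s powr (- r) * u powr r"
      using p u by (simp add: powr_divide powr_minus_divide)
    moreover have "(?g v) powr p = s powr p * v powr p * u powr (- p)"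
      using p u lt1[OF v] by (simp add: u_def[symmetric] powr_divide powr_mult powr_minus_divide)
    moreover have "s / u\<^sup>2 = s powr 1 * u powr (- 2)"
      using p u by (simp add: powr_minus_divide)
    ultimately have "s powr (r - p - 1) * ((s / u\<^sup>2) * ?f (?g v)) =
      (s powr (r - p - 1) * s powr 1 * s powr p * s powr (- r)) * (u powr (- 2) * u powr (- p) * u powr r) * (v powr p * (1 - ?g v) powr q)"
      by (simp only: mult_ac)
    also have "s powr (r - p - 1) * s powr 1 * s powr p * s powr (- r) = 1"
      using p by (simp only: powr_add[symmetric]) simp
    also have "u powr (- 2) * u powr (- p) * u powr r = u powr (r - p - 2)"
      by (simp only: powr_add[symmetric]) (simp add: algebra_simps)
    finally show ?thesis by (simp add: u_def mult_ac)
  qed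
  ultimately show ?thesis by (rule has_integral_eq[rotated])
qed

text \<open>For \<open>r = c + 1\<close> and \<open>p = c + a\<close> the substitution leaves the
  exponent \<open>-a - 1\<close> on \<open>1 - v\<close>, integrable at 1 because
  \<open>a < 0\<close>. Extension by zero beyond \<open>1 / (1 + s)\<close> fixes the interval for
  dominated convergence.\<close>

lemma euler_int_limit_2:
  assumes a: "-1 < a" "a < 0" "c > 0" "c + a > 0" "c + b > 0"
  shows "(\<lambda>n. (1 / real (n + 2)) powr (- a) * euler_int (c + a) (c + b) (c + 1) (1 / real (n + 2))) \<longlonglongrightarrow> Beta (c + a + 1) (- a)"
proof -
  let ?s = "\<lambda>n. 1 / real (n + 2)"
  define f where "f n v = (if v \<in> {0..1 / (1 + ?s n)} then v powr (c + a) * (1 - v) powr (- a - 1) * (1 - ?s n * v / (1 - v)) powr (c + b) else 0)" for n v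
  have fi: "(f n has_integral (?s n) powr (- a) * euler_int (c + a) (c + b) (c + 1) (?s n)) {0..1}" for n
  proof -
    have sn: "?s n > 0" by simp
    have e: "c + 1 - (c + a) - 2 = - a - 1" "c + 1 - (c + a) - 1 = - a" by simp_all
    have "((\<lambda>v. v powr (c + a) * (1 - v) powr (- a - 1) * (1 - ?s n * v / (1 - v)) powr (c + b)) has_integral
        ?s n powr (- a) * euler_int (c + a) (c + b) (c + 1) (?s n)) {0..1 / (1 + ?s n)}"
      using euler_int_subst[OF a(4,5) sn, of "c + 1"] unfolding e .
    then show ?thesis
      unfolding f_def by (subst has_integral_restrict) (auto simp: divide_simps)
  qed
  have "(\<lambda>n. integral {0..1} (f n)) \<longlonglongrightarrow> integral {0..1} (\<lambda>v. v powr (c + a) * (1 - v) powr (- a - 1))"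
  proof (rule dominated_convergence)
    show "f n integrable_on {0..1}" for n using fi by blast
    show "(\<lambda>v. v powr (c + a) * (1 - v) powr (- a - 1)) integrable_on {0..1}"
      using a by (intro Beta_weight_integrable) auto
    show "norm (f n v) \<le> v powr (c + a) * (1 - v) powr (- a - 1)" if v: "v \<in> {0..1}" for n v
    proof (cases "v \<in> {0..1 / (1 + ?s n)}")
      case True
      have sn: "?s n > 0" by simp
      have "0 \<le> 1 - ?s n * v / (1 - v)" "1 - ?s n * v / (1 - v) \<le> 1"
        using subst_range[OF sn True] by auto
      then have "(1 - ?s n * v / (1 - v)) powr (c + b) \<le> 1"
        using a by (intro powr_le1) auto
      then show ?thesis
        using True by (simp add: f_def mult_left_le del: of_nat_add)
    qed (auto simp: f_def)
    fix v :: real assume v: "v \<in> {0..1}"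
    show "(\<lambda>n. f n v) \<longlonglongrightarrow> v powr (c + a) * (1 - v) powr (- a - 1)"
    proof (cases "v = 1")
      case True
      \<comment> \<open>The point 1 lies outside every interval of integration, and the limit
        function is 0 there because \<open>0 powr x = 0\<close>, whatever the exponent.\<close>
      have "f n v = 0" for n using True by (simp add: f_def divide_simps)
      then show ?thesis using True by simp
    next
      case False
      then have v1: "v < 1" using v by auto
      have s0: "?s \<longlonglongrightarrow> 0" by real_asymp
      have "(\<lambda>n. 1 / (1 + ?s n)) \<longlonglongrightarrow> 1 / (1 + 0)" using s0 by (intro tendsto_intros) auto
      then have "\<forall>\<^sub>F n in sequentially. v < 1 / (1 + ?s n)" using v1 by (intro order_tendstoD(1)) auto
      then have ev: "\<forall>\<^sub>F n in sequentially. v powr (c + a) * (1 - v) powr (- a - 1) * (1 - ?s n * v / (1 - v)) powr (c + b) = f n v"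
        by eventually_elim (use v in \<open>auto simp: f_def\<close>)
      have "(\<lambda>n. v powr (c + a) * (1 - v) powr (- a - 1) * (1 - ?s n * v / (1 - v)) powr (c + b))
          \<longlonglongrightarrow> v powr (c + a) * (1 - v) powr (- a - 1) * (1 - 0 * v / (1 - v)) powr (c + b)"
        using s0 v1 by (intro tendsto_intros) auto
      then have "(\<lambda>n. v powr (c + a) * (1 - v) powr (- a - 1) * (1 - ?s n * v / (1 - v)) powr (c + b))
          \<longlonglongrightarrow> v powr (c + a) * (1 - v) powr (- a - 1)" by simp
      then show ?thesis using ev by (rule Lim_transform_eventually)
    qed
  qed
  also have "integral {0..1} (\<lambda>v. v powr (c + a) * (1 - v) powr (- a - 1)) = Beta (c + a + 1) (- a)"
    using Beta_weight_integrable(2)[of "c + a" "- a - 1"] a by simp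
  also have "(\<lambda>n. integral {0..1} (f n)) = (\<lambda>n. (?s n) powr (- a) * euler_int (c + a) (c + b) (c + 1) (?s n))"
    using fi by (auto simp: has_integral_iff)
  finally show ?thesis .
qed

text \<open>Here the principal powers of the Euler integral and the upper branch of the Frobenius
  solutions are holomorphic together; convexity makes Wronskians constant.\<close>

definition right_half_disc :: "complex set" where "right_half_disc = {s. norm s < 1 \<and> Re s > 0}"

lemma right_half_disc_slit_disc: "s \<in> right_half_disc \<Longrightarrow> s \<in> slit_disc" by (auto simp: right_half_disc_def slit_disc_def)

lemma convex_right_half_disc: "convex right_half_disc"
proof -
  have eq: "right_half_disc = ball 0 1 \<inter> {s. Re s > 0}" by (auto simp: right_half_disc_def)
  show ?thesis unfolding eq by (intro convex_Int convex_ball convex_halfspace_Re_gt)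
qed

lemma open_right_half_disc: "open right_half_disc"
proof -
  have eq: "right_half_disc = ball 0 1 \<inter> {s. Re s > 0}" by (auto simp: right_half_disc_def)
  show ?thesis unfolding eq by (intro open_Int open_ball open_halfspace_Re_gt)
qed

section \<open>Wronskians and the connection coefficients\<close>

lemma wronskian_const:
  fixes f1 f2 q1 q2 w g :: "complex \<Rightarrow> complex"
  assumes "convex S"
    and y: "\<And>s. s \<in> S \<Longrightarrow> (f1 has_field_derivative w s * q1 s) (at s)" "\<And>s. s \<in> S \<Longrightarrow> (f2 has_field_derivative w s * q2 s) (at s)"
    and q: "\<And>s. s \<in> S \<Longrightarrow> (q1 has_field_derivative g s * f1 s) (at s)" "\<And>s. s \<in> S \<Longrightarrow> (q2 has_field_derivative g s * f2 s) (at s)"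
  obtains C where "\<And>s. s \<in> S \<Longrightarrow> f1 s * q2 s - f2 s * q1 s = C"
proof -
  have "\<exists>C. \<forall>s\<in>S. f1 s * q2 s - f2 s * q1 s = C"
  proof (rule has_field_derivative_zero_constant[OF assms(1)])
    fix s assume s: "s \<in> S"
    have "((\<lambda>s. f1 s * q2 s - f2 s * q1 s) has_field_derivative
       (w s * q1 s * q2 s + g s * f2 s * f1 s) - (w s * q2 s * q1 s + g s * f1 s * f2 s)) (at s)"
      by (intro DERIV_diff DERIV_mult y q s)
    then have "((\<lambda>s. f1 s * q2 s - f2 s * q1 s) has_field_derivative 0) (at s)"
      by (rule DERIV_cong) (simp add: algebra_simps)
    then show "((\<lambda>s. f1 s * q2 s - f2 s * q1 s) has_field_derivative 0) (at s within S)"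
      by (rule has_field_derivative_at_within)
  qed
  then show thesis using that by blast
qed

text \<open>The logarithmic derivative of the weight is
  \<open>(a + (a + b) s) / (s (1 + s))\<close>. With \<open>u = y'\<close> the numerator is
  therefore the part of the hypergeometric equation containing \<open>y''\<close> and
  \<open>y'\<close>.\<close>

lemma ode_weight_quotient_deriv:
  assumes s: "s \<in> slit_disc" and u: "(u has_field_derivative u') (at s)"
  shows "((\<lambda>s. u s / ode_weight a b s) has_field_derivative
     (s * (1 + s) * u' - (of_real a + of_real (a + b) * s) * u s) / (ode_weight a b s * (s * (1 + s)))) (at s)"
proof -
  have nz: "ode_weight a b s \<noteq> 0" "s \<noteq> 0" "1 + s \<noteq> 0" using ode_weight_nonzero[OF s] one_plus_slit(2) s by (auto simp: slit_disc_def)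
  define w A B where "w = ode_weight a b s" and "A = complex_of_real a" and "B = complex_of_real b"
  have "((\<lambda>s. u s / ode_weight a b s) has_field_derivative
     (u' * ode_weight a b s - u s * (ode_weight a b s * (of_real a / s + of_real b / (1 + s)))) / (ode_weight a b s * ode_weight a b s)) (at s)"
    by (intro DERIV_divide u ode_weight_deriv s nz)
  moreover have "(u' * w - u s * (w * (A / s + B / (1 + s)))) / (w * w) =
     (s * (1 + s) * u' - (A + (A + B) * s) * u s) / (w * (s * (1 + s)))"
  proof -
    have "A / s + B / (1 + s) = (A + (A + B) * s) / (s * (1 + s))"
      using nz(2,3) by (simp add: add_frac_eq algebra_simps)
    moreover have "u' = s * (1 + s) * u' / (s * (1 + s))" using nz(2,3) by simp
    ultimately have "u' - u s * (A / s + B / (1 + s)) = (s * (1 + s) * u' - (A + (A + B) * s) * u s) / (s * (1 + s))"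
      by (simp only: diff_divide_distrib) simp
    moreover have "(u' * w - u s * (w * (A / s + B / (1 + s)))) / (w * w) = (u' - u s * (A / s + B / (1 + s))) / w"
      using nz(1) by (simp add: w_def[symmetric] field_simps)
    ultimately show ?thesis by simp
  qed
  ultimately show ?thesis unfolding w_def A_def B_def of_real_add by (simp only:)
qed

text \<open>The hypergeometric equation as a first-order system \<open>y' = w q\<close>, \<open>q' = g y\<close> with \<open>w\<close> the weight
  \<open>s\<^sup>a (1 + s)\<^sup>b\<close>: in this form Wronskians \<open>y\<^sub>1 q\<^sub>2 - y\<^sub>2 q\<^sub>1\<close> are constant.\<close>

definition ode_const :: "real \<Rightarrow> real \<Rightarrow> real \<Rightarrow> complex" where
  "ode_const a b c = of_real (c * (- c - a - b - 1))"

lemma frob0_system: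
  assumes a: "a \<notin> \<int>" and s: "s \<in> slit_disc"
  shows "((\<lambda>s. frob0 a b c (- s)) has_field_derivative ode_weight a b s * (- dfrob0 a b c (- s) / ode_weight a b s)) (at s)"
    and "((\<lambda>s. - dfrob0 a b c (- s) / ode_weight a b s) has_field_derivative
        (- ode_const a b c / (ode_weight a b s * (s * (1 + s)))) * frob0 a b c (- s)) (at s)"
proof -
  have n: "norm (- s) < 1" using s by (auto simp: slit_disc_def)
  have "((\<lambda>s. frob0 a b c (- s)) has_field_derivative dfrob0 a b c (- s) * (- 1)) (at s)"
    by (rule DERIV_chain2[where f = "frob0 a b c" and g = "\<lambda>s. - s"]) (auto intro!: derivative_eq_intros frob0_deriv a n[simplified])
  then show "((\<lambda>s. frob0 a b c (- s)) has_field_derivative ode_weight a b s * (- dfrob0 a b c (- s) / ode_weight a b s)) (at s)"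
    using ode_weight_nonzero[OF s] by simp
  obtain D' where D': "(dfrob0 a b c has_field_derivative D') (at (- s))"
    "(- s) * (1 - (- s)) * D' = of_real (c * (- c - a - b - 1)) * frob0 a b c (- s) + (of_real a - of_real (a + b) * (- s)) * dfrob0 a b c (- s)"
    using dfrob0_deriv[OF a n] by blast
  have "((\<lambda>s. dfrob0 a b c (- s)) has_field_derivative D' * (- 1)) (at s)"
    by (rule DERIV_chain2[where f = "dfrob0 a b c" and g = "\<lambda>s. - s"]) (auto intro!: derivative_eq_intros D'(1))
  from DERIV_minus[OF this] have "((\<lambda>s. - dfrob0 a b c (- s)) has_field_derivative D') (at s)" by simp
  from ode_weight_quotient_deriv[OF s this]
  show "((\<lambda>s. - dfrob0 a b c (- s) / ode_weight a b s) has_field_derivative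
        (- ode_const a b c / (ode_weight a b s * (s * (1 + s)))) * frob0 a b c (- s)) (at s)"
  proof (rule DERIV_cong)
    have "s * (1 + s) * D' - (of_real a + of_real (a + b) * s) * (- dfrob0 a b c (- s)) = - ode_const a b c * frob0 a b c (- s)"
      using D'(2) unfolding ode_const_def[symmetric] by algebra
    then show "(s * (1 + s) * D' - (of_real a + of_real (a + b) * s) * (- dfrob0 a b c (- s))) / (ode_weight a b s * (s * (1 + s))) =
      (- ode_const a b c / (ode_weight a b s * (s * (1 + s)))) * frob0 a b c (- s)" by simp
  qed
qed

lemma frob1_system:
  assumes a: "a \<notin> \<int>" and s: "s \<in> slit_disc"
  shows "(frob1 a b c has_field_derivative ode_weight a b s * frob1_quasi a b c (- s)) (at s)"
    and "((\<lambda>s. frob1_quasi a b c (- s)) has_field_derivative (- ode_const a b c / (ode_weight a b s * (s * (1 + s)))) * frob1 a b c s) (at s)"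
proof -
  have n: "norm (- s) < 1" using s by (auto simp: slit_disc_def)
  have nz: "ode_weight a b s \<noteq> 0" "s \<noteq> 0" "1 + s \<noteq> 0" using ode_weight_nonzero[OF s] one_plus_slit(2) s by (auto simp: slit_disc_def)
  show "(frob1 a b c has_field_derivative ode_weight a b s * frob1_quasi a b c (- s)) (at s)" by (rule frob1_deriv[OF a s])
  have "((\<lambda>s. frob1_quasi a b c (- s)) has_field_derivative of_real (c * (- c - a - b - 1)) * frob1_factor a b c (- s) * (- 1)) (at s)"
    by (rule DERIV_chain2[where f = "frob1_quasi a b c" and g = "\<lambda>s. - s"]) (auto intro!: derivative_eq_intros frob1_quasi_deriv[OF a n] simp del: of_real_mult)
  then show "((\<lambda>s. frob1_quasi a b c (- s)) has_field_derivative (- ode_const a b c / (ode_weight a b s * (s * (1 + s)))) * frob1 a b c s) (at s)"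
  proof (rule DERIV_cong)
    show "of_real (c * (- c - a - b - 1)) * frob1_factor a b c (- s) * (- 1) = (- ode_const a b c / (ode_weight a b s * (s * (1 + s)))) * frob1 a b c s"
      unfolding frob1_conv_ode_weight[OF s] ode_const_def[symmetric] using nz by simp
  qed
qed

lemma euler_intc_system:
  assumes p: "c + a > 0" "c + b > 0" and s: "s \<in> right_half_disc"
  shows "(euler_intc (c + a) (c + b) c has_field_derivative ode_weight a b s * (- of_real c * euler_intc (c + a) (c + b) (c + 1) s / ode_weight a b s)) (at s)"
    and "((\<lambda>s. - of_real c * euler_intc (c + a) (c + b) (c + 1) s / ode_weight a b s) has_field_derivative
      (- ode_const a b c / (ode_weight a b s * (s * (1 + s)))) * euler_intc (c + a) (c + b) c s) (at s)"
proof -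
  have sl: "s \<notin> \<real>\<^sub>\<le>\<^sub>0" using s by (auto simp: right_half_disc_def slit_plane_iff)
  have sd: "s \<in> slit_disc" by (rule right_half_disc_slit_disc[OF s])
  show "(euler_intc (c + a) (c + b) c has_field_derivative ode_weight a b s * (- of_real c * euler_intc (c + a) (c + b) (c + 1) s / ode_weight a b s)) (at s)"
    using euler_intc_has_field_derivative[OF p sl, of c] ode_weight_nonzero[OF sd] by simp
  have "(euler_intc (c + a) (c + b) (c + 1) has_field_derivative - of_real (c + 1) * euler_intc (c + a) (c + b) (c + 1 + 1) s) (at s)"
    by (rule euler_intc_has_field_derivative[OF p sl])
  moreover have "c + 1 + 1 = c + 2" by simp
  ultimately have "(euler_intc (c + a) (c + b) (c + 1) has_field_derivative - of_real (c + 1) * euler_intc (c + a) (c + b) (c + 2) s) (at s)" by (simp only:)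
  from ode_weight_quotient_deriv[OF sd DERIV_cmult[OF this, of "- of_real c"]]
  show "((\<lambda>s. - of_real c * euler_intc (c + a) (c + b) (c + 1) s / ode_weight a b s) has_field_derivative
      (- ode_const a b c / (ode_weight a b s * (s * (1 + s)))) * euler_intc (c + a) (c + b) c s) (at s)"
  proof (rule DERIV_cong)
    define A B C where "A = complex_of_real a" and "B = complex_of_real b" and "C = complex_of_real c"
    have "s * (1 + s) * (- of_real c * (- of_real (c + 1) * euler_intc (c + a) (c + b) (c + 2) s)) -
       (of_real a + of_real (a + b) * s) * (- of_real c * euler_intc (c + a) (c + b) (c + 1) s) =
      - ode_const a b c * euler_intc (c + a) (c + b) c s"
      using euler_intc_ode[OF p sl]
      unfolding ode_const_def of_real_mult of_real_diff of_real_minus of_real_add of_real_1 A_def[symmetric] B_def[symmetric] C_def[symmetric]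
      by algebra
    then show "(s * (1 + s) * (- of_real c * (- of_real (c + 1) * euler_intc (c + a) (c + b) (c + 2) s)) -
       (of_real a + of_real (a + b) * s) * (- of_real c * euler_intc (c + a) (c + b) (c + 1) s)) / (ode_weight a b s * (s * (1 + s))) =
      (- ode_const a b c / (ode_weight a b s * (s * (1 + s)))) * euler_intc (c + a) (c + b) c s"
      by simp
  qed
qed

lemma hyp2F1c_continuous_0:
  assumes "r \<notin> \<int>"
  shows "(\<lambda>n. hyp2F1c p q r (- of_real (1 / real (n + 2)))) \<longlonglongrightarrow> 1"
proof -
  have "isCont (hyp2F1c p q r) 0"
    using hyp2F1c_has_field_derivative[OF assms, of 0] by (intro DERIV_isCont) auto
  moreover have "(\<lambda>n. - complex_of_real (1 / real (n + 2))) \<longlonglongrightarrow> 0"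
  proof -
    have "(\<lambda>n. 1 / real (n + 2)) \<longlonglongrightarrow> 0" by real_asymp
    from tendsto_minus[OF tendsto_of_real[OF this, where 'a = complex]] show ?thesis by simp
  qed
  ultimately show ?thesis using isCont_tendsto_compose[of 0 "hyp2F1c p q r"] by fastforce
qed

text \<open>The offset 2 keeps every point of the sequence strictly inside the unit disc, starting
  at 1/2.\<close>

lemma recip_in_right_half_disc: "complex_of_real (1 / real (n + 2)) \<in> right_half_disc"
proof -
  have "0 < 1 / real (n + 2)" "1 / real (n + 2) < 1" by simp_all
  then show ?thesis unfolding right_half_disc_def mem_Collect_eq norm_of_real Re_complex_of_real by linarith
qed

text \<open>Cramer's rule with determinant \<open>1 + a\<close> from \<open>hyper_wronskian\<close>.
  The Wronskian of \<open>I_c\<close> with \<open>frob1\<close> is evaluated as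
  \<open>s -> 0\<close> and gives the Beta value; the one with \<open>frob0\<close> is kept as the
  constant \<open>C\<close>, and its formula is handed on.\<close>

lemma connection_form:
  assumes a: "a \<notin> \<int>" "a > -1" and c: "c > 0" "c + a > 0" "c + b > 0"
  obtains C where
    "\<And>s. s \<in> right_half_disc \<Longrightarrow> of_real (1 + a) * euler_intc (c + a) (c + b) c s =
        of_real ((1 + a) * Beta (a + 1) (c + b + 1)) * frob0 a b c (- s) - C * frob1 a b c s"
    "\<And>s. s \<in> right_half_disc \<Longrightarrow> C = (of_real c * euler_intc (c + a) (c + b) (c + 1) s * frob0 a b c (- s) - euler_intc (c + a) (c + b) c s * dfrob0 a b c (- s)) / ode_weight a b s"
proof -
  define I J where "I = euler_intc (c + a) (c + b) c" and "J = euler_intc (c + a) (c + b) (c + 1)"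
  obtain C1 where C1: "\<And>s. s \<in> right_half_disc \<Longrightarrow> I s * (- dfrob0 a b c (- s) / ode_weight a b s) - frob0 a b c (- s) * (- of_real c * J s / ode_weight a b s) = C1"
    using wronskian_const[OF convex_right_half_disc euler_intc_system(1)[OF c(2,3)] frob0_system(1)[OF a(1) right_half_disc_slit_disc] euler_intc_system(2)[OF c(2,3)] frob0_system(2)[OF a(1) right_half_disc_slit_disc]]
    unfolding I_def J_def by metis
  obtain C2 where C2: "\<And>s. s \<in> right_half_disc \<Longrightarrow> I s * frob1_quasi a b c (- s) - frob1 a b c s * (- of_real c * J s / ode_weight a b s) = C2"
    using wronskian_const[OF convex_right_half_disc euler_intc_system(1)[OF c(2,3)] frob1_system(1)[OF a(1) right_half_disc_slit_disc] euler_intc_system(2)[OF c(2,3)] frob1_system(2)[OF a(1) right_half_disc_slit_disc]]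
    unfolding I_def J_def by metis
  let ?s = "\<lambda>n. 1 / real (n + 2)"
  have s0: "?s \<longlonglongrightarrow> 0" by real_asymp
  \<comment> \<open>The weight has cancelled, so every term has a limit at 0: \<open>I_c\<close>
    tends to a Beta value and \<open>s I_(c+1)\<close> to 0.\<close>
  have C2': "C2 = I s * frob1_quasi a b c (- s) + of_real c * (s * J s) * (1 + s) * frob1_factor a b c (- s)" if s: "s \<in> right_half_disc" for s
  proof -
    have "ode_weight a b s \<noteq> 0" using ode_weight_nonzero right_half_disc_slit_disc s by blast
    then show ?thesis unfolding C2[OF s, symmetric] frob1_conv_ode_weight[OF right_half_disc_slit_disc[OF s]] by simp
  qed
  have "(\<lambda>n. I (of_real (?s n)) * frob1_quasi a b c (- of_real (?s n)) + of_real c * (of_real (?s n) * J (of_real (?s n))) * (1 + of_real (?s n)) * frob1_factor a b c (- of_real (?s n)))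
      \<longlonglongrightarrow> of_real (Beta (a + 1) (c + b + 1)) * (of_real (1 + a) * 1) + of_real c * of_real 0 * (1 + of_real 0) * 1"
  proof (intro tendsto_add tendsto_mult tendsto_const tendsto_of_real s0)
    have "(\<lambda>n. complex_of_real (euler_int (c + a) (c + b) c (?s n))) \<longlonglongrightarrow> of_real (Beta (a + 1) (c + b + 1))"
      using c a by (intro tendsto_of_real euler_int_limit_0) auto
    then show "(\<lambda>n. I (of_real (?s n))) \<longlonglongrightarrow> of_real (Beta (a + 1) (c + b + 1))"
      unfolding I_def using c by (subst euler_intc_of_real) auto
    show "(\<lambda>n. frob1_quasi a b c (- of_real (?s n))) \<longlonglongrightarrow> of_real (1 + a) * 1"
      unfolding frob1_quasi_def by (intro tendsto_mult tendsto_const hyp2F1c_continuous_0 nonint_simps a)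
    have "(\<lambda>n. complex_of_real (?s n * euler_int (c + a) (c + b) (c + 1) (?s n))) \<longlonglongrightarrow> of_real 0"
      using c a by (intro tendsto_of_real euler_int_limit_1) auto
    then show "(\<lambda>n. of_real (?s n) * J (of_real (?s n))) \<longlonglongrightarrow> of_real 0"
      unfolding J_def using c by (subst euler_intc_of_real) (auto simp del: of_nat_add)
    show "(\<lambda>n. frob1_factor a b c (- of_real (?s n))) \<longlonglongrightarrow> 1"
      unfolding frob1_factor_def by (intro hyp2F1c_continuous_0 nonint_simps a)
  qed
  then have "(\<lambda>n. C2) \<longlonglongrightarrow> of_real (Beta (a + 1) (c + b + 1)) * (of_real (1 + a) * 1) + of_real c * of_real 0 * (1 + of_real 0) * 1"
    unfolding C2'[OF recip_in_right_half_disc, symmetric] .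
  then have C2v: "C2 = of_real ((1 + a) * Beta (a + 1) (c + b + 1))"
    unfolding LIMSEQ_const_iff by (simp add: mult.commute)
  show thesis
  proof (rule that[of C1])
    fix s assume s: "s \<in> right_half_disc"
    have sd: "s \<in> slit_disc" by (rule right_half_disc_slit_disc[OF s])
    have n: "norm (- s) < 1" using s by (simp add: right_half_disc_def)
    have w: "frob0 a b c (- s) * frob1_quasi a b c (- s) - (- dfrob0 a b c (- s) / ode_weight a b s) * frob1 a b c s = of_real (1 + a)"
      unfolding frob1_conv_ode_weight[OF sd] using hyper_wronskian[OF a(1) n, of b c] ode_weight_nonzero[OF sd] by (simp add: algebra_simps)
    have "X * i = C2 * F - C1 * Y"
      if "F * T - q * Y = X" "i * q - F * Q = C1" "i * T - Y * Q = C2" for F T q Y X Q i :: complex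
      unfolding that[symmetric] by (simp add: algebra_simps)
    from this[OF w C1[OF s] C2[OF s]]
    show "of_real (1 + a) * euler_intc (c + a) (c + b) c s =
        of_real ((1 + a) * Beta (a + 1) (c + b + 1)) * frob0 a b c (- s) - C1 * frob1 a b c s"
      unfolding C2v I_def .
    show "C1 = (of_real c * euler_intc (c + a) (c + b) (c + 1) s * frob0 a b c (- s) - euler_intc (c + a) (c + b) c s * dfrob0 a b c (- s)) / ode_weight a b s"
      unfolding C1[OF s, symmetric] I_def J_def by (simp add: diff_divide_distrib mult_ac)
  qed
qed

lemma solve_linear:
  fixes d x u F g Y :: complex
  assumes "d * x = d * u * F - g * Y" "d \<noteq> 0"
  shows "x = u * F - g / d * Y"
proof -
  have "d * x = d * (u * F - g / d * Y)" using assms by (simp add: right_diff_distrib mult.assoc)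
  then show ?thesis using assms(2) by simp
qed

text \<open>For \<open>a < 0\<close> the weight blows up like \<open>s^a\<close>. In the formula for
  \<open>C\<close> this makes the term with \<open>I_c\<close> vanish in the limit, and
  \<open>s^(-a) I_(c+1)\<close> converges by \<open>euler_int_limit_2\<close>.\<close>

lemma euler_intc_connection_neg:
  assumes a: "a \<notin> \<int>" "a > -1" and a0: "a < 0" and c: "c > 0" "c + a > 0" "c + b > 0" and s: "s \<in> right_half_disc"
  shows "euler_intc (c + a) (c + b) c s = of_real (Beta (a + 1) (c + b + 1)) * frob0 a b c (- s)
    - of_real (Gamma (c + a + 1) * Gamma (- a) / Gamma c / (1 + a)) * frob1 a b c s"
proof -
  let ?C = "\<lambda>a c. Gamma (c + a + 1) * Gamma (- a) / Gamma c :: real"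
  have a1: "complex_of_real (1 + a) \<noteq> 0" by (subst of_real_eq_0_iff) (use a(2) in simp)
  obtain C where C: "\<And>s. s \<in> right_half_disc \<Longrightarrow> of_real (1 + a) * euler_intc (c + a) (c + b) c s =
      of_real ((1 + a) * Beta (a + 1) (c + b + 1)) * frob0 a b c (- s) - C * frob1 a b c s"
    "\<And>s. s \<in> right_half_disc \<Longrightarrow> C = (of_real c * euler_intc (c + a) (c + b) (c + 1) s * frob0 a b c (- s) - euler_intc (c + a) (c + b) c s * dfrob0 a b c (- s)) / ode_weight a b s"
    using connection_form[OF a c] by blast
  let ?s = "\<lambda>n. 1 / real (n + 2)"
  have s0: "?s \<longlonglongrightarrow> 0" by real_asymp
  have Cn: "C = (of_real c * of_real (?s n powr (- a) * euler_int (c + a) (c + b) (c + 1) (?s n)) * frob0 a b c (- of_real (?s n))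
      - of_real (?s n powr (- a)) * of_real (euler_int (c + a) (c + b) c (?s n)) * dfrob0 a b c (- of_real (?s n))) / of_real ((1 + ?s n) powr b)" for n
  proof -
    have sp: "?s n > 0" by simp
    have "1 + complex_of_real (?s n) = of_real (1 + ?s n)" by simp
    then have "(1 + complex_of_real (?s n)) powr of_real b = of_real ((1 + ?s n) powr b)"
      using sp by (simp only: powr_of_real)
    then have w: "ode_weight a b (of_real (?s n)) = of_real (?s n powr a) * of_real ((1 + ?s n) powr b)"
      unfolding ode_weight_def powr_up_pos[OF sp] by simp
    have i: "1 / complex_of_real (?s n powr a) = of_real (?s n powr (- a))"
      by (simp only: powr_minus_divide of_real_divide of_real_1)
    have "X / (P * Q) = (1 / P) * X / Q" for X P Q :: complex by simp
    from C(2)[OF recip_in_right_half_disc[of n], unfolded w, unfolded this, unfolded i]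
    show ?thesis
      using c sp by (simp only: euler_intc_of_real of_real_mult right_diff_distrib mult_ac)
  qed
  have "(\<lambda>n. (of_real c * of_real (?s n powr (- a) * euler_int (c + a) (c + b) (c + 1) (?s n)) * frob0 a b c (- of_real (?s n))
      - of_real (?s n powr (- a)) * of_real (euler_int (c + a) (c + b) c (?s n)) * dfrob0 a b c (- of_real (?s n))) / of_real ((1 + ?s n) powr b))
    \<longlonglongrightarrow> (of_real c * of_real (Beta (c + a + 1) (- a)) * 1
      - of_real 0 * of_real (Beta (a + 1) (c + b + 1)) * (of_real (c * (- c - a - b - 1) / (- a)) * 1)) / complex_of_real 1"
  proof (intro tendsto_divide tendsto_diff tendsto_mult[of _ "of_real c * of_real (Beta (c + a + 1) (- a))"] tendsto_mult[of _ "of_real 0 * of_real (Beta (a + 1) (c + b + 1))"])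
    show "(\<lambda>n. of_real c * complex_of_real (?s n powr (- a) * euler_int (c + a) (c + b) (c + 1) (?s n))) \<longlonglongrightarrow> of_real c * of_real (Beta (c + a + 1) (- a))"
      using a a0 c by (intro tendsto_mult tendsto_const tendsto_of_real euler_int_limit_2) auto
    show "(\<lambda>n. frob0 a b c (- of_real (?s n))) \<longlonglongrightarrow> 1"
      unfolding frob0_def by (intro hyp2F1c_continuous_0 nonint_simps a)
    have "(\<lambda>n. ?s n powr (- a)) \<longlonglongrightarrow> 0" using a0 by real_asymp
    then show "(\<lambda>n. complex_of_real (?s n powr (- a)) * of_real (euler_int (c + a) (c + b) c (?s n))) \<longlonglongrightarrow> of_real 0 * of_real (Beta (a + 1) (c + b + 1))"
      using a c by (intro tendsto_mult tendsto_of_real euler_int_limit_0) auto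
    show "(\<lambda>n. dfrob0 a b c (- of_real (?s n))) \<longlonglongrightarrow> of_real (c * (- c - a - b - 1) / (- a)) * 1"
      unfolding dfrob0_def by (intro tendsto_mult tendsto_const hyp2F1c_continuous_0 nonint_simps a)
    have "(\<lambda>n. (1 + ?s n) powr b) \<longlonglongrightarrow> (1 + 0) powr b"
      using s0 by (intro tendsto_intros) auto
    then show "(\<lambda>n. complex_of_real ((1 + ?s n) powr b)) \<longlonglongrightarrow> of_real 1"
      by (intro tendsto_of_real) simp
  qed simp
  then have "(\<lambda>n. C) \<longlonglongrightarrow> (of_real c * of_real (Beta (c + a + 1) (- a)) * 1
      - of_real 0 * of_real (Beta (a + 1) (c + b + 1)) * (of_real (c * (- c - a - b - 1) / (- a)) * 1)) / complex_of_real 1"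
    unfolding Cn[symmetric] .
  then have "C = of_real (c * Beta (c + a + 1) (- a))"
    unfolding LIMSEQ_const_iff by simp
  also have "c * Beta (c + a + 1) (- a) = ?C a c"
  proof -
    have "Gamma (c + 1) = c * Gamma c"
      by (rule Gamma_plus1) (use c in auto)
    then show ?thesis using c by (simp add: Beta_def)
  qed
  finally have Cv: "C = of_real (?C a c)" .
  show ?thesis
    using solve_linear[OF C(1)[OF s, unfolded Cv of_real_mult of_real_divide] a1]
    unfolding of_real_mult of_real_divide .
qed

lemma hyper_shift:
  assumes "a \<notin> \<int>" "s \<in> slit_disc"
  shows "dfrob0 a b c (- s) = of_real (c * (- c - a - b - 1) / (- a)) * frob0 (a - 1) (b - 1) (c + 1) (- s)"
    and "ode_weight a b s * frob1_quasi a b c (- s) = of_real (1 + a) * frob1 (a - 1) (b - 1) (c + 1) s"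
proof -
  have e1: "- (c + 1) - (a - 1) - (b - 1) - 1 = - c - a - b" "- (a - 1) = 1 - a" by simp_all
  show "dfrob0 a b c (- s) = of_real (c * (- c - a - b - 1) / (- a)) * frob0 (a - 1) (b - 1) (c + 1) (- s)"
    unfolding dfrob0_def frob0_def e1 ..
  have e2: "1 - (c + 1) = - c" "2 + (c + 1) + (a - 1) + (b - 1) = 1 + c + a + b" "2 + (a - 1) = 1 + a"
    "1 + (a - 1) = a" "1 + (b - 1) = b" by simp_all
  show "ode_weight a b s * frob1_quasi a b c (- s) = of_real (1 + a) * frob1 (a - 1) (b - 1) (c + 1) s"
    unfolding frob1_def frob1_factor_def frob1_quasi_def ode_weight_def e2 by simp
qed

text \<open>For \<open>a > 0\<close> the coefficient of the second solution is invisible in the limit \<open>s \<rightarrow> 0\<close>.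
  Differentiation turns the parameters \<open>(a, b, c)\<close> into \<open>(a - 1, b - 1, c + 1)\<close>, so it is found by
  descending to \<open>-1 < a < 0\<close>.\<close>

lemma euler_intc_connection:
  assumes "a \<notin> \<int>" "a > -1" and "c > 0" "c + a > 0" "c + b > 0" and "s \<in> right_half_disc"
  shows "euler_intc (c + a) (c + b) c s = of_real (Beta (a + 1) (c + b + 1)) * frob0 a b c (- s)
    - of_real (Gamma (c + a + 1) * Gamma (- a) / Gamma c / (1 + a)) * frob1 a b c s"
proof -
  \<comment> \<open>The descent lowers \<open>a\<close> and \<open>b\<close> by 1 and raises
    \<open>c\<close> by 1. The hypotheses involve \<open>b\<close> only through
    \<open>c + b\<close>, which the shift leaves fixed, so they pass to the next step.\<close>
  have main: "euler_intc (c + a) (c + b) c s = of_real (Beta (a + 1) (c + b + 1)) * frob0 a b c (- s)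
    - of_real (Gamma (c + a + 1) * Gamma (- a) / Gamma c / (1 + a)) * frob1 a b c s"
    if "a < real N" "a \<notin> \<int>" "a > -1" "c > 0" "c + a > 0" "c + b > 0" "s \<in> right_half_disc" for N a b c s
    using that
  proof (induction N arbitrary: a b c s)
    case (0 a b c s)
    then show ?case by (intro euler_intc_connection_neg) auto
  next
    case (Suc N a b c s)
    note a = Suc.prems(2,3) and c = Suc.prems(4-6) and s = Suc.prems(7)
    show ?case
    proof (cases "a < 0")
      case True
      then show ?thesis by (intro euler_intc_connection_neg a c s)
    next
      case False
      then have a0: "a > 0" using nonint_simps(9)[OF a(1)] by simp
      have a1: "complex_of_real (1 + a) \<noteq> 0" by (subst of_real_eq_0_iff) (use a(2) in simp)
      obtain C where C: "\<And>s. s \<in> right_half_disc \<Longrightarrow> of_real (1 + a) * euler_intc (c + a) (c + b) c s =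
          of_real ((1 + a) * Beta (a + 1) (c + b + 1)) * frob0 a b c (- s) - C * frob1 a b c s"
        using connection_form[OF a c] by blast
      define F1 Y1 where "F1 s = frob0 (a - 1) (b - 1) (c + 1) (- s)" and "Y1 = frob1 (a - 1) (b - 1) (c + 1)" for s
      define \<beta> where "\<beta> = Gamma (c + a + 1) * Gamma (1 - a) / Gamma (c + 1) / a"
      have IH: "euler_intc (c + a) (c + b) (c + 1) s = of_real (Beta a (c + b + 1)) * F1 s - of_real \<beta> * Y1 s" if "s \<in> right_half_disc" for s
      proof -
        have e: "c + 1 + (a - 1) = c + a" "c + 1 + (b - 1) = c + b" "a - 1 + 1 = a" "1 + (a - 1) = a" "- (a - 1) = 1 - a"
          by simp_all
        have "euler_intc (c + 1 + (a - 1)) (c + 1 + (b - 1)) (c + 1) s = of_real (Beta (a - 1 + 1) (c + 1 + (b - 1) + 1)) * frob0 (a - 1) (b - 1) (c + 1) (- s)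
            - of_real (Gamma (c + 1 + (a - 1) + 1) * Gamma (- (a - 1)) / Gamma (c + 1) / (1 + (a - 1))) * frob1 (a - 1) (b - 1) (c + 1) s"
          by (rule Suc.IH) (use Suc.prems that a0 nonint_simps(12)[OF a(1)] in auto)
        then show ?thesis unfolding e F1_def Y1_def \<beta>_def .
      qed
      define k where "k = complex_of_real (c * (- c - a - b - 1) / (- a))"
      define M where "M = of_real (Beta (a + 1) (c + b + 1)) * k - of_real (c * Beta a (c + b + 1))"
      \<comment> \<open>The derivative of the connection formula is compared with the formula for
        the shifted parameters. As \<open>s -> 0\<close>, \<open>Y1\<close> tends to 0 like
        \<open>s^a\<close> and \<open>F1\<close> to 1, so \<open>M = 0\<close>; dividing by the
        power factor of \<open>Y1\<close> then gives \<open>C = -c \<beta>\<close>.\<close>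
      have rel: "(C + of_real (c * \<beta>)) * Y1 s = - M * F1 s" if s: "s \<in> right_half_disc" for s
      proof -
        have sd: "s \<in> slit_disc" by (rule right_half_disc_slit_disc[OF s])
        have w: "ode_weight a b s \<noteq> 0" by (rule ode_weight_nonzero[OF sd])
        have "((\<lambda>s. of_real ((1 + a) * Beta (a + 1) (c + b + 1)) * frob0 a b c (- s) - C * frob1 a b c s) has_field_derivative
            of_real ((1 + a) * Beta (a + 1) (c + b + 1)) * (ode_weight a b s * (- dfrob0 a b c (- s) / ode_weight a b s)) - C * (ode_weight a b s * frob1_quasi a b c (- s))) (at s)"
          by (intro DERIV_diff DERIV_cmult frob0_system(1) frob1_system(1) a sd)
        then have "((\<lambda>s. of_real (1 + a) * euler_intc (c + a) (c + b) c s) has_field_derivative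
            of_real ((1 + a) * Beta (a + 1) (c + b + 1)) * (ode_weight a b s * (- dfrob0 a b c (- s) / ode_weight a b s)) - C * (ode_weight a b s * frob1_quasi a b c (- s))) (at s)"
          by (rule has_field_derivative_transform_within_open[OF _ open_right_half_disc s]) (rule C[symmetric])
        moreover have "((\<lambda>s. of_real (1 + a) * euler_intc (c + a) (c + b) c s) has_field_derivative
            of_real (1 + a) * (ode_weight a b s * (- of_real c * euler_intc (c + a) (c + b) (c + 1) s / ode_weight a b s))) (at s)"
          by (intro DERIV_cmult euler_intc_system(1) c s)
        ultimately have "of_real ((1 + a) * Beta (a + 1) (c + b + 1)) * (ode_weight a b s * (- dfrob0 a b c (- s) / ode_weight a b s)) - C * (ode_weight a b s * frob1_quasi a b c (- s))
            = of_real (1 + a) * (ode_weight a b s * (- of_real c * euler_intc (c + a) (c + b) (c + 1) s / ode_weight a b s))"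
          by (rule DERIV_unique)
        then have "of_real (1 + a) * of_real (Beta (a + 1) (c + b + 1)) * (- (k * F1 s)) - C * (of_real (1 + a) * Y1 s)
            = of_real (1 + a) * (- of_real c * (of_real (Beta a (c + b + 1)) * F1 s - of_real \<beta> * Y1 s))"
          unfolding hyper_shift(2)[OF a(1) sd] using w
          by (simp only: nonzero_mult_div_cancel_left times_divide_eq_right hyper_shift(1)[OF a(1) sd] IH[OF s] k_def F1_def Y1_def of_real_mult not_False_eq_True)
        then have "of_real (1 + a) * ((C + of_real (c * \<beta>)) * Y1 s) = of_real (1 + a) * (- M * F1 s)"
          unfolding M_def of_real_mult by algebra
        then show ?thesis using a1 by (simp only: mult_cancel_left) simp
      qed
      let ?s = "\<lambda>n. 1 / real (n + 2)"
      have s0: "?s \<longlonglongrightarrow> 0" by real_asymp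
      define g where "g n = complex_of_real (?s n powr a) * of_real ((1 + ?s n) powr b)" for n
      define h where "h n = frob1_factor (a - 1) (b - 1) (c + 1) (- complex_of_real (?s n))" for n
      have Yn: "Y1 (of_real (?s n)) = g n * h n" for n
      proof -
        have sp: "?s n > 0" by simp
        have e2: "1 + (a - 1) = a" "1 + (b - 1) = b" by simp_all
        have "1 + complex_of_real (?s n) = of_real (1 + ?s n)" by simp
        then have "(1 + complex_of_real (?s n)) powr of_real b = of_real ((1 + ?s n) powr b)"
          using sp by (simp only: powr_of_real)
        then show ?thesis unfolding Y1_def frob1_def g_def h_def e2 powr_up_pos[OF sp] by simp
      qed
      have h: "h \<longlonglongrightarrow> 1"
        unfolding h_def frob1_factor_def by (intro hyp2F1c_continuous_0) (use nonint_simps[OF a(1)] in simp)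
      have F: "(\<lambda>n. F1 (of_real (?s n))) \<longlonglongrightarrow> 1"
        unfolding F1_def frob0_def by (intro hyp2F1c_continuous_0) (use nonint_simps[OF a(1)] in simp)
      have "g \<longlonglongrightarrow> of_real 0 * of_real ((1 + 0) powr b)"
        unfolding g_def
      proof (intro tendsto_mult tendsto_of_real)
        show "(\<lambda>n. ?s n powr a) \<longlonglongrightarrow> 0" using a0 by real_asymp
        show "(\<lambda>n. (1 + ?s n) powr b) \<longlonglongrightarrow> (1 + 0) powr b" using s0 by (intro tendsto_intros) auto
      qed
      then have g: "g \<longlonglongrightarrow> 0" by simp
      have "(\<lambda>n. (C + of_real (c * \<beta>)) * (g n * h n)) \<longlonglongrightarrow> (C + of_real (c * \<beta>)) * (0 * 1)"
        by (intro tendsto_mult tendsto_const g h)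
      moreover have "(\<lambda>n. - M * F1 (of_real (?s n))) \<longlonglongrightarrow> - M * 1"
        by (intro tendsto_mult tendsto_const F)
      ultimately have "- M * 1 = (C + of_real (c * \<beta>)) * (0 * 1)"
        unfolding rel[OF recip_in_right_half_disc, symmetric] Yn by (rule LIMSEQ_unique[rotated])
      then have M: "M = 0" by simp
      have gn: "g n \<noteq> 0" for n
      proof -
        have p: "?s n > 0" by simp
        have "?s n powr a > 0" unfolding powr_gt_zero using p by linarith
        moreover have "(1 + ?s n) powr b > 0" unfolding powr_gt_zero using p by linarith
        ultimately have "?s n powr a > 0" "(1 + ?s n) powr b > 0" by blast+
        then show ?thesis unfolding g_def by (simp only: mult_eq_0_iff of_real_eq_0_iff) linarith
      qed
      have "(C + of_real (c * \<beta>)) * h n = 0" for n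
        using rel[OF recip_in_right_half_disc[of n]] gn[of n] unfolding Yn M by simp
      moreover have "(\<lambda>n. (C + of_real (c * \<beta>)) * h n) \<longlonglongrightarrow> (C + of_real (c * \<beta>)) * 1"
        by (intro tendsto_mult tendsto_const h)
      ultimately have "(\<lambda>n. 0::complex) \<longlonglongrightarrow> (C + of_real (c * \<beta>)) * 1" by (simp only:)
      then have "C + of_real (c * \<beta>) = 0" by (simp only: LIMSEQ_const_iff mult_1_right)
      then have "C = of_real (- (c * \<beta>))" by (simp add: eq_neg_iff_add_eq_0)
      also have "- (c * \<beta>) = Gamma (c + a + 1) * Gamma (- a) / Gamma c"
      proof -
        have "Gamma (- a + 1) = (- a) * Gamma (- a)"
          by (rule Gamma_plus1) (use a in \<open>auto dest: nonpos_Ints_Int simp: minus_in_Ints_iff\<close>)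
        then have "Gamma (1 - a) = - a * Gamma (- a)" by (simp add: add.commute)
        moreover have "Gamma (c + 1) = c * Gamma c"
          by (rule Gamma_plus1) (use c in auto)
        ultimately show ?thesis unfolding \<beta>_def using a0 c by simp
      qed
      finally have Cv: "C = of_real (Gamma (c + a + 1) * Gamma (- a) / Gamma c)" .
      show ?thesis
        using solve_linear[OF C[OF s, unfolded Cv of_real_mult of_real_divide] a1]
        unfolding of_real_mult of_real_divide .
    qed
  qed
  obtain N :: nat where "a < real N" using reals_Archimedean2 by blast
  from main[OF this assms] show ?thesis .
qed

section \<open>Stieltjes inversion\<close>

lemma poisson_kernel_integral:
  assumes "u \<le> v" "e > 0"
  shows "(\<integral>\<^sup>+x. ennreal (e / ((t - x)\<^sup>2 + e\<^sup>2)) * indicator {u..v} x \<partial>lborel) =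
    ennreal (arctan ((v - t) / e) - arctan ((u - t) / e))"
proof (rule nn_integral_FTC_Icc)
  show "(\<lambda>x. e / ((t - x)\<^sup>2 + e\<^sup>2)) \<in> borel_measurable borel" by measurable
  fix x
  have "(arctan has_real_derivative inverse (1 + ((x - t) / e)\<^sup>2)) (at ((x - t) / e))" by (rule DERIV_arctan)
  moreover have "((\<lambda>x. (x - t) / e) has_real_derivative 1 / e) (at x)"
    using assms by (auto intro!: derivative_eq_intros)
  ultimately have "((\<lambda>x. arctan ((x - t) / e)) has_real_derivative inverse (1 + ((x - t) / e)\<^sup>2) * (1 / e)) (at x)"
    by (rule DERIV_chain2)
  moreover have "inverse (1 + ((x - t) / e)\<^sup>2) * (1 / e) = e / ((t - x)\<^sup>2 + e\<^sup>2)"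
  proof -
    have "1 + ((x - t) / e)\<^sup>2 = ((t - x)\<^sup>2 + e\<^sup>2) / e\<^sup>2"
      using assms by (simp add: power_divide add_divide_distrib power2_commute)
    then show ?thesis using assms by (simp add: power2_eq_square)
  qed
  ultimately show "DERIV (\<lambda>x. arctan ((x - t) / e)) x :> e / ((t - x)\<^sup>2 + e\<^sup>2)"
    by (simp only:)
  show "0 \<le> e / ((t - x)\<^sup>2 + e\<^sup>2)" using assms by simp
qed (use assms in auto)

text \<open>The convention \<open>1 / (s + t)\<close> places a point \<open>x\<close> of the
  spectrum at \<open>s = -x\<close>; just above it the negative imaginary part is the Poisson kernel
  integrated against the measure.\<close>

lemma stieltjes_Im:
  assumes "prob_space \<nu>" "sets \<nu> = sets borel" and e: "e > 0"
  shows "integrable \<nu> (\<lambda>t. e / ((t - x)\<^sup>2 + e\<^sup>2))"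
    "(\<integral>t. e / ((t - x)\<^sup>2 + e\<^sup>2) \<partial>\<nu>) = - Im (stieltjes \<nu> (Complex (- x) e))"
proof -
  interpret prob_space \<nu> by fact
  have [measurable_cong]: "sets \<nu> = sets borel" by fact
  have Im: "Im (1 / (Complex (- x) e + of_real t)) = - (e / ((t - x)\<^sup>2 + e\<^sup>2))" for t
    by (simp add: Im_divide power2_eq_square algebra_simps)
  have "integrable \<nu> (\<lambda>t. 1 / (Complex (- x) e + of_real t))"
  proof (rule integrable_const_bound[of _ "1 / e"])
    have "e \<le> norm (Complex (- x) e + of_real t)" for t
      using abs_Im_le_cmod[of "Complex (- x) e + of_real t"] e by simp
    then show "AE t in \<nu>. norm (1 / (Complex (- x) e + of_real t)) \<le> 1 / e"
      using e by (auto simp: norm_divide intro!: frac_le)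
  qed simp
  from integrable_Im[OF this] integral_Im[OF this]
  have "integrable \<nu> (\<lambda>t. - (e / ((t - x)\<^sup>2 + e\<^sup>2)))" "(\<integral>t. - (e / ((t - x)\<^sup>2 + e\<^sup>2)) \<partial>\<nu>) = Im (stieltjes \<nu> (Complex (- x) e))"
    unfolding Im stieltjes_def by simp_all
  then show "integrable \<nu> (\<lambda>t. e / ((t - x)\<^sup>2 + e\<^sup>2))"
    "(\<integral>t. e / ((t - x)\<^sup>2 + e\<^sup>2) \<partial>\<nu>) = - Im (stieltjes \<nu> (Complex (- x) e))"
    by simp_all
qed

text \<open>The Poisson kernel is positive, so the order of integration changes by Tonelli's
  theorem, and the inner integral in \<open>x\<close> is a difference of arctangents.\<close>

lemma poisson_fubini:
  assumes \<nu>: "prob_space \<nu>" "sets \<nu> = sets borel" and e: "e > 0" and uv: "u \<le> v"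
    and cont: "continuous_on {u..v} (\<lambda>x. Im (stieltjes \<nu> (Complex (- x) e)))"
  shows "(\<integral>t. arctan ((v - t) / e) - arctan ((u - t) / e) \<partial>\<nu>) =
    (LBINT x:{u..v}. - Im (stieltjes \<nu> (Complex (- x) e)))"
proof -
  interpret prob_space \<nu> by fact
  have [measurable_cong]: "sets \<nu> = sets borel" by fact
  interpret lborel_\<nu>: pair_sigma_finite lborel \<nu> ..
  let ?k = "\<lambda>x t. e / ((t - x)\<^sup>2 + e\<^sup>2)"
  have mono: "0 \<le> arctan ((v - t) / e) - arctan ((u - t) / e)" for t
    using uv e by (simp add: arctan_le_iff divide_right_mono)
  have nnP: "0 \<le> - Im (stieltjes \<nu> (Complex (- x) e))" for x
    unfolding stieltjes_Im(2)[OF \<nu> e, symmetric] using e by (intro integral_nonneg_AE) auto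
  have "ennreal (\<integral>t. arctan ((v - t) / e) - arctan ((u - t) / e) \<partial>\<nu>) =
      (\<integral>\<^sup>+t. ennreal (arctan ((v - t) / e) - arctan ((u - t) / e)) \<partial>\<nu>)"
  proof (rule nn_integral_eq_integral[symmetric])
    show "integrable \<nu> (\<lambda>t. arctan ((v - t) / e) - arctan ((u - t) / e))"
    proof (rule integrable_const_bound[of _ pi])
      show "AE t in \<nu>. norm (arctan ((v - t) / e) - arctan ((u - t) / e)) \<le> pi"
      proof (rule AE_I2)
        fix t
        show "norm (arctan ((v - t) / e) - arctan ((u - t) / e)) \<le> pi"
          using arctan_bounded[of "(v - t) / e"] arctan_bounded[of "(u - t) / e"] mono[of t] by simp
      qed
    qed simp
    show "AE t in \<nu>. 0 \<le> arctan ((v - t) / e) - arctan ((u - t) / e)" using mono by simp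
  qed
  also have "\<dots> = (\<integral>\<^sup>+t. (\<integral>\<^sup>+x. ennreal (?k x t) * indicator {u..v} x \<partial>lborel) \<partial>\<nu>)"
    using poisson_kernel_integral[OF uv e] by simp
  also have "\<dots> = (\<integral>\<^sup>+x. (\<integral>\<^sup>+t. ennreal (?k x t) * indicator {u..v} x \<partial>\<nu>) \<partial>lborel)"
    by (rule lborel_\<nu>.Fubini') measurable
  also have "\<dots> = (\<integral>\<^sup>+x. ennreal (indicator {u..v} x *\<^sub>R - Im (stieltjes \<nu> (Complex (- x) e))) \<partial>lborel)"
  proof (rule nn_integral_cong)
    fix x
    have "(\<integral>\<^sup>+t. ennreal (?k x t) \<partial>\<nu>) = ennreal (- Im (stieltjes \<nu> (Complex (- x) e)))"
      unfolding stieltjes_Im(2)[OF \<nu> e, symmetric]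
      by (rule nn_integral_eq_integral[OF stieltjes_Im(1)[OF \<nu> e]]) (use e in auto)
    then show "(\<integral>\<^sup>+t. ennreal (?k x t) * indicator {u..v} x \<partial>\<nu>) = ennreal (indicator {u..v} x *\<^sub>R - Im (stieltjes \<nu> (Complex (- x) e)))"
      by (subst nn_integral_multc) (auto simp: indicator_def)
  qed
  also have "\<dots> = ennreal (LBINT x:{u..v}. - Im (stieltjes \<nu> (Complex (- x) e)))"
    unfolding set_lebesgue_integral_def
  proof (rule nn_integral_eq_integral)
    have "continuous_on {u..v} (\<lambda>x. - Im (stieltjes \<nu> (Complex (- x) e)))" by (intro continuous_on_minus cont)
    then show "integrable lborel (\<lambda>x. indicator {u..v} x *\<^sub>R - Im (stieltjes \<nu> (Complex (- x) e)))"
      by (intro borel_integrable_compact) auto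
    show "AE x in lborel. 0 \<le> indicator {u..v} x *\<^sub>R - Im (stieltjes \<nu> (Complex (- x) e))"
      using nnP by (intro AE_I2 scaleR_nonneg_nonneg) auto
  qed
  finally have eq: "ennreal (\<integral>t. arctan ((v - t) / e) - arctan ((u - t) / e) \<partial>\<nu>) =
    ennreal (LBINT x:{u..v}. - Im (stieltjes \<nu> (Complex (- x) e)))" .
  have n1: "0 \<le> (\<integral>t. arctan ((v - t) / e) - arctan ((u - t) / e) \<partial>\<nu>)"
    using mono by (intro integral_nonneg_AE AE_I2)
  have n2: "0 \<le> (LBINT x:{u..v}. - Im (stieltjes \<nu> (Complex (- x) e)))"
    unfolding set_lebesgue_integral_def using nnP by (intro integral_nonneg_AE AE_I2 scaleR_nonneg_nonneg) auto
  from eq show ?thesis unfolding ennreal_inj[OF n1 n2] .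
qed

text \<open>At an end point one arctangent is constantly 0, so the limit gives end points half the
  weight of interior points.\<close>

lemma arctan_step_limit:
  assumes e: "e0 > 0" and uv: "u < v"
  shows "(\<lambda>n. arctan ((v - t) / (e0 / real (Suc n))) - arctan ((u - t) / (e0 / real (Suc n)))) \<longlonglongrightarrow>
    pi * (indicator {u<..<v} t + (indicator {u} t + indicator {v} t) / 2)"
proof -
  define sg where "sg y = (if y > 0 then pi / 2 else if y < 0 then - pi / 2 else 0)" for y :: real
  have A: "(\<lambda>n. arctan (y / (e0 / real (Suc n)))) \<longlonglongrightarrow> sg y" for y
  proof -
    have eq: "y / (e0 / real (Suc n)) = (y / e0) * real (Suc n)" for n by simp
    have top: "filterlim (\<lambda>n. z * real (Suc n)) at_top sequentially" if "z > 0" for z using that by real_asymp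
    have bot: "filterlim (\<lambda>n. z * real (Suc n)) at_bot sequentially" if "z < 0" for z using that by real_asymp
    consider "y > 0" | "y < 0" | "y = 0" by linarith
    then show ?thesis
    proof cases
      case 1
      then show ?thesis unfolding eq sg_def using filterlim_compose[OF tendsto_arctan_at_top top[of "y / e0"]] e by simp
    next
      case 2
      then have "y / e0 < 0" using e by (simp add: divide_less_0_iff)
      from filterlim_compose[OF tendsto_arctan_at_bot bot[OF this]] show ?thesis unfolding eq sg_def using 2 by simp
    qed (simp add: sg_def)
  qed
  have "sg (v - t) - sg (u - t) = pi * (indicator {u<..<v} t + (indicator {u} t + indicator {v} t) / 2)"
    using uv by (auto simp: sg_def indicator_def)
  then show ?thesis using tendsto_diff[OF A[of "v - t"] A[of "u - t"]] by simp
qed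

text \<open>Stieltjes-Perron inversion for a transform that extends continuously, as
  \<open>R\<close>, to a closed rectangle touching the cut. Dominated convergence uses the bound
  \<open>pi\<close> on the measure side and the maximum of \<open>R\<close> on the Lebesgue side.
  The half masses at the end points are disposed of by \<open>nu_no_atom\<close>.\<close>

lemma stieltjes_inversion:
  assumes \<nu>: "prob_space \<nu>" "sets \<nu> = sets borel" and uv: "u < v" and e0: "e0 > 0"
    and R: "continuous_on (cbox (Complex (- v) 0) (Complex (- u) e0)) R"
    and eq: "\<And>x e. x \<in> {u..v} \<Longrightarrow> 0 < e \<Longrightarrow> e \<le> e0 \<Longrightarrow> stieltjes \<nu> (Complex (- x) e) = R (Complex (- x) e)"
  shows "measure \<nu> {u<..<v} + (measure \<nu> {u} + measure \<nu> {v}) / 2 =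
    (LBINT x:{u..v}. - Im (R (Complex (- x) 0)) / pi)"
proof -
  interpret prob_space \<nu> by fact
  have [measurable_cong]: "sets \<nu> = sets borel" by fact
  define e where "e n = e0 / real (Suc n)" for n
  have e: "0 < e n" "e n \<le> e0" for n using e0 by (auto simp: e_def divide_le_eq mult_le_cancel_left1)
  have elim: "e \<longlonglongrightarrow> 0" unfolding e_def by real_asymp
  have box: "Complex (- x) d \<in> cbox (Complex (- v) 0) (Complex (- u) e0)" if "x \<in> {u..v}" "0 \<le> d" "d \<le> e0" for x d
    using that by (auto simp: in_cbox_complex_iff)
  obtain B where B: "\<And>z. z \<in> cbox (Complex (- v) 0) (Complex (- u) e0) \<Longrightarrow> norm (R z) \<le> B"
    using compact_imp_bounded[OF compact_continuous_image[OF R compact_cbox]] unfolding bounded_iff by auto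
  have contR: "continuous_on {u..v} (\<lambda>x. Im (R (Complex (- x) d)))" if "0 \<le> d" "d \<le> e0" for d
  proof (intro continuous_on_Im continuous_on_compose2[OF R])
    show "continuous_on {u..v} (\<lambda>x. Complex (- x) d)"
      unfolding Complex_eq by (intro continuous_intros)
  qed (use box that in auto)
  have contP: "continuous_on {u..v} (\<lambda>x. Im (stieltjes \<nu> (Complex (- x) (e n))))" for n
    by (rule continuous_on_eq[OF contR[of "e n"]]) (use e[of n] eq in \<open>auto simp: less_imp_le\<close>)
  have L: "(\<lambda>n. \<integral>t. arctan ((v - t) / e n) - arctan ((u - t) / e n) \<partial>\<nu>) \<longlonglongrightarrow>
    (\<integral>t. pi * (indicator {u<..<v} t + (indicator {u} t + indicator {v} t) / 2) \<partial>\<nu>)"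
  proof (rule integral_dominated_convergence[where w = "\<lambda>_. pi"])
    show "AE t in \<nu>. norm (arctan ((v - t) / e n) - arctan ((u - t) / e n)) \<le> pi" for n
    proof (rule AE_I2)
      fix t
      show "norm (arctan ((v - t) / e n) - arctan ((u - t) / e n)) \<le> pi"
        using arctan_bounded[of "(v - t) / e n"] arctan_bounded[of "(u - t) / e n"] by (simp add: abs_le_iff)
    qed
    show "AE t in \<nu>. (\<lambda>n. arctan ((v - t) / e n) - arctan ((u - t) / e n)) \<longlonglongrightarrow> pi * (indicator {u<..<v} t + (indicator {u} t + indicator {v} t) / 2)"
      unfolding e_def by (intro AE_I2 arctan_step_limit e0 uv)
  qed simp_all
  have Rl: "(\<lambda>n. LBINT x:{u..v}. - Im (stieltjes \<nu> (Complex (- x) (e n)))) \<longlonglongrightarrow> (LBINT x:{u..v}. - Im (R (Complex (- x) 0)))"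
    unfolding set_lebesgue_integral_def
  proof (rule integral_dominated_convergence[where w = "\<lambda>x. indicator {u..v} x *\<^sub>R B"])
    have meas: "(\<lambda>x. indicator {u..v} x *\<^sub>R - f x) \<in> borel_measurable lborel" if "continuous_on {u..v} f" for f :: "real \<Rightarrow> real"
      using borel_integrable_compact[of "{u..v}" "\<lambda>x. - f x"] continuous_on_minus[OF that] by (auto intro: borel_measurable_integrable)
    show "(\<lambda>x. indicator {u..v} x *\<^sub>R - Im (R (Complex (- x) 0))) \<in> borel_measurable lborel"
      using e0 by (intro meas contR) auto
    show "(\<lambda>x. indicator {u..v} x *\<^sub>R - Im (stieltjes \<nu> (Complex (- x) (e n)))) \<in> borel_measurable lborel" for n
      by (intro meas contP)
    show "integrable lborel (\<lambda>x. indicator {u..v} x *\<^sub>R B)"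
      by (intro borel_integrable_compact) auto
    show "AE x in lborel. norm (indicator {u..v} x *\<^sub>R - Im (stieltjes \<nu> (Complex (- x) (e n)))) \<le> indicator {u..v} x *\<^sub>R B" for n
    proof (rule AE_I2)
      fix x
      show "norm (indicator {u..v} x *\<^sub>R - Im (stieltjes \<nu> (Complex (- x) (e n)))) \<le> indicator {u..v} x *\<^sub>R B"
      proof (cases "x \<in> {u..v}")
        case True
        then have "\<bar>Im (R (Complex (- x) (e n)))\<bar> \<le> B"
          using order_trans[OF abs_Im_le_cmod B[OF box]] e[of n] by (simp add: less_imp_le)
        then show ?thesis using True eq[OF True e] by simp
      qed simp
    qed
    show "AE x in lborel. (\<lambda>n. indicator {u..v} x *\<^sub>R - Im (stieltjes \<nu> (Complex (- x) (e n)))) \<longlonglongrightarrow> indicator {u..v} x *\<^sub>R - Im (R (Complex (- x) 0))"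
    proof (rule AE_I2)
      fix x
      show "(\<lambda>n. indicator {u..v} x *\<^sub>R - Im (stieltjes \<nu> (Complex (- x) (e n)))) \<longlonglongrightarrow> indicator {u..v} x *\<^sub>R - Im (R (Complex (- x) 0))"
      proof (cases "x \<in> {u..v}")
        case True
        have "(\<lambda>n. R (Complex (- x) (e n))) \<longlonglongrightarrow> R (Complex (- x) 0)"
        proof (rule continuous_on_tendsto_compose[OF R])
          show "(\<lambda>n. Complex (- x) (e n)) \<longlonglongrightarrow> Complex (- x) 0"
            by (intro tendsto_Complex tendsto_const elim)
        qed (use box[OF True] e e0 in \<open>auto simp: less_imp_le\<close>)
        then show ?thesis using True eq[OF True e] by (simp add: tendsto_Im tendsto_minus)
      qed simp
    qed
  qed
  have "(\<lambda>n. \<integral>t. arctan ((v - t) / e n) - arctan ((u - t) / e n) \<partial>\<nu>) = (\<lambda>n. LBINT x:{u..v}. - Im (stieltjes \<nu> (Complex (- x) (e n))))"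
    using poisson_fubini[OF \<nu> e(1) less_imp_le[OF uv] contP] by auto
  then have "(\<integral>t. pi * (indicator {u<..<v} t + (indicator {u} t + indicator {v} t) / 2) \<partial>\<nu>) = (LBINT x:{u..v}. - Im (R (Complex (- x) 0)))"
    using LIMSEQ_unique[OF L] Rl by simp
  moreover have "(\<integral>t. pi * (indicator {u<..<v} t + (indicator {u} t + indicator {v} t) / 2) \<partial>\<nu>) =
      pi * (measure \<nu> {u<..<v} + (measure \<nu> {u} + measure \<nu> {v}) / 2)"
  proof -
    have i: "integrable \<nu> (\<lambda>t. indicator A t :: real)" if "A \<in> sets borel" for A
      using that by (intro integrable_const_bound[of _ 1]) (auto simp: indicator_def)
    have m: "(\<integral>t. indicator A t \<partial>\<nu>) = measure \<nu> A" if "A \<in> sets borel" for A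
      using that by simp
    show ?thesis
      by (simp add: i m Bochner_Integration.integral_add)
  qed
  ultimately show ?thesis
    unfolding set_integral_divide_zero by (simp add: nonzero_eq_divide_eq mult.commute)
qed

section \<open>Boundary values of the transform on the cut\<close>

text \<open>The right-hand side of the connection formula. It continues \<open>I_c\<close> from the
  upper half disc across (-1,0), where the Euler integral itself has its cut.\<close>

definition euler_cont :: "real \<Rightarrow> real \<Rightarrow> real \<Rightarrow> complex \<Rightarrow> complex" where
  "euler_cont a b c s = of_real (Beta (a + 1) (c + b + 1)) * frob0 a b c (- s)
    - of_real (Gamma (c + a + 1) * Gamma (- a) / Gamma c / (1 + a)) * frob1 a b c s"

definition deuler_cont :: "real \<Rightarrow> real \<Rightarrow> real \<Rightarrow> complex \<Rightarrow> complex" where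
  "deuler_cont a b c s = - (of_real (Beta (a + 1) (c + b + 1)) * dfrob0 a b c (- s))
    - of_real (Gamma (c + a + 1) * Gamma (- a) / Gamma c / (1 + a)) * (ode_weight a b s * frob1_quasi a b c (- s))"

lemma euler_cont_deriv:
  assumes a: "a \<notin> \<int>" and s: "s \<in> slit_disc"
  shows "(euler_cont a b c has_field_derivative deuler_cont a b c s) (at s)"
proof -
  have "(euler_cont a b c has_field_derivative
      of_real (Beta (a + 1) (c + b + 1)) * (ode_weight a b s * (- dfrob0 a b c (- s) / ode_weight a b s))
      - of_real (Gamma (c + a + 1) * Gamma (- a) / Gamma c / (1 + a)) * (ode_weight a b s * frob1_quasi a b c (- s))) (at s)"
    unfolding euler_cont_def[abs_def] by (intro DERIV_diff DERIV_cmult frob0_system(1) frob1_system(1) a s)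
  then show ?thesis using ode_weight_nonzero[OF s, of a b] by (simp add: deuler_cont_def)
qed

lemma deuler_cont_isCont:
  assumes a: "a \<notin> \<int>" and s: "s \<in> slit_disc"
  shows "isCont (deuler_cont a b c) s"
proof -
  have n: "norm (- s) < 1" using s by (auto simp: slit_disc_def)
  obtain D' where D': "(dfrob0 a b c has_field_derivative D') (at (- s))" using dfrob0_deriv[OF a n] by blast
  have "isCont (\<lambda>s. dfrob0 a b c (- s)) s"
    by (rule isCont_o2[where f = "\<lambda>s. - s" and g = "dfrob0 a b c"]) (auto intro!: DERIV_isCont D' continuous_intros)
  moreover have "isCont (ode_weight a b) s" by (rule DERIV_isCont[OF ode_weight_deriv[OF s]])
  moreover have "isCont (\<lambda>s. frob1_quasi a b c (- s)) s" by (rule DERIV_isCont[OF frob1_system(2)[OF a s]])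
  ultimately show ?thesis unfolding deuler_cont_def[abs_def] by (intro continuous_intros)
qed

text \<open>A common zero of \<^term>\<open>euler_cont\<close> and \<^term>\<open>deuler_cont\<close> would make the Wronskian with \<^term>\<open>frob1\<close> vanish.\<close>

lemma euler_cont_deuler_cont_not_both_zero:
  assumes a: "a \<notin> \<int>" "a > -1" and c: "c + b > 0" and s: "s \<in> slit_disc" and Q: "euler_cont a b c s = 0"
  shows "deuler_cont a b c s \<noteq> 0"
proof
  assume deuler_cont: "deuler_cont a b c s = 0"
  have n: "norm (- s) < 1" using s by (auto simp: slit_disc_def)
  define \<alpha> \<gamma> where "\<alpha> = complex_of_real (Beta (a + 1) (c + b + 1))"
    and "\<gamma> = complex_of_real (Gamma (c + a + 1) * Gamma (- a) / Gamma c / (1 + a))"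
  have W: "frob0 a b c (- s) * frob1_quasi a b c (- s) + s * (1 + s) * dfrob0 a b c (- s) * frob1_factor a b c (- s) = of_real (1 + a)"
    using hyper_wronskian[OF a(1) n, of b c] by simp
  have e1: "\<alpha> * frob0 a b c (- s) = \<gamma> * (ode_weight a b s * (s * (1 + s)) * frob1_factor a b c (- s))"
    using Q unfolding euler_cont_def frob1_conv_ode_weight[OF s] \<alpha>_def[symmetric] \<gamma>_def[symmetric] by simp
  have e2: "\<alpha> * dfrob0 a b c (- s) = - (\<gamma> * (ode_weight a b s * frob1_quasi a b c (- s)))"
  proof -
    have "- (\<alpha> * dfrob0 a b c (- s)) = \<gamma> * (ode_weight a b s * frob1_quasi a b c (- s))"
      using deuler_cont unfolding deuler_cont_def \<alpha>_def[symmetric] \<gamma>_def[symmetric] by simp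
    then show ?thesis by (metis minus_minus)
  qed
  have "\<alpha> * of_real (1 + a) = (\<alpha> * frob0 a b c (- s)) * frob1_quasi a b c (- s) + s * (1 + s) * (\<alpha> * dfrob0 a b c (- s)) * frob1_factor a b c (- s)"
    unfolding W[symmetric] by (simp add: algebra_simps)
  also have "\<dots> = 0" unfolding e1 e2 by (simp add: algebra_simps)
  finally have "\<alpha> = 0 \<or> 1 + a = 0" unfolding mult_eq_0_iff of_real_eq_0_iff .
  moreover have "Beta (a + 1) (c + b + 1) \<noteq> 0"
  proof -
    have "Gamma (a + 1) > 0" "Gamma (c + b + 1) > 0" "Gamma (a + 1 + (c + b + 1)) > 0"
      using a c by (auto intro: Gamma_real_pos)
    then show ?thesis by (simp add: Beta_def)
  qed
  ultimately show False using a by (simp add: \<alpha>_def)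
qed

text \<open>The right and the upper half disc overlap, so the connection formula spreads to their
  union. At a zero of \<open>euler_cont\<close> the transform identity would force
  \<open>I_(c+1)\<close>, hence also the derivative, to vanish, which the Wronskian forbids.\<close>

lemma stieltjes_euler_cont:
  assumes a: "a \<notin> \<int>" "a > -1" and b: "b \<ge> -1" and c: "c > 0" "c + a > 0" "c + b > 0"
    and \<nu>: "is_spectral_measure (J_III a b c) \<nu>" and supp: "AE x in \<nu>. x \<in> {0..1}"
    and s: "norm s < 1" "Im s > 0"
  shows "euler_cont a b c s \<noteq> 0" "stieltjes \<nu> s = - deuler_cont a b c s / (of_real c * euler_cont a b c s)"
proof -
  define S where "S = right_half_disc \<union> {s. norm s < 1 \<and> Im s > 0}"
  define UD where "UD = {s::complex. norm s < 1 \<and> Im s > 0}"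
  have UD_eq: "UD = ball 0 1 \<inter> {s. Im s > 0}" by (auto simp: UD_def)
  have "open UD" "convex UD" unfolding UD_eq
    by (intro open_Int open_ball open_halfspace_Im_gt convex_Int convex_ball convex_halfspace_Im_gt)+
  then have S: "open S" "connected S"
  proof -
    show "open S" unfolding S_def UD_def[symmetric] using \<open>open UD\<close> open_right_half_disc by blast
    have ii: "Complex (1/2) (1/2) \<in> right_half_disc \<inter> UD"
    proof -
      have "cmod (Complex (1/2) (1/2)) < 1" by (simp add: cmod_def power2_eq_square real_sqrt_lt_1_iff)
      then show ?thesis by (simp add: right_half_disc_def UD_def)
    qed
    show "connected S" unfolding S_def UD_def[symmetric]
      by (rule connected_Un) (use convex_connected[OF \<open>convex UD\<close>] convex_connected[OF convex_right_half_disc] ii in auto)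
  qed
  have S_slit_disc: "s \<in> slit_disc" and S_slit: "s \<notin> \<real>\<^sub>\<le>\<^sub>0" if "s \<in> S" for s
    using that by (auto simp: S_def right_half_disc_def slit_disc_def slit_plane_iff)
  have euler_intc_euler_cont: "euler_intc (c + a) (c + b) c s = euler_cont a b c s" if "s \<in> S" for s
  proof (rule analytic_continuation_open[of right_half_disc S "euler_intc (c + a) (c + b) c" "euler_cont a b c"])
    show "right_half_disc \<noteq> {}" using recip_in_right_half_disc by blast
    show "euler_intc (c + a) (c + b) c holomorphic_on S"
      by (rule holomorphic_on_subset[OF euler_intc_holomorphic]) (use c S_slit in auto)
    show "euler_cont a b c holomorphic_on S"
      using S(1) euler_cont_deriv[OF a(1) S_slit_disc] by (auto simp: holomorphic_on_open)
    show "euler_intc (c + a) (c + b) c z = euler_cont a b c z" if "z \<in> right_half_disc" for z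
      unfolding euler_cont_def by (rule euler_intc_connection[OF a c that])
  qed (use S open_right_half_disc that in \<open>auto simp: S_def\<close>)
  have sS: "s \<in> S" using s by (simp add: S_def)
  have "(euler_cont a b c has_field_derivative - of_real c * euler_intc (c + a) (c + b) (c + 1) s) (at s)"
    by (rule has_field_derivative_transform_within_open[OF euler_intc_has_field_derivative[OF c(2,3) S_slit[OF sS], of c] S(1) sS euler_intc_euler_cont])
  then have deuler_cont: "deuler_cont a b c s = - of_real c * euler_intc (c + a) (c + b) (c + 1) s"
    using euler_cont_deriv[OF a(1) S_slit_disc[OF sS]] DERIV_unique by blast
  have tr: "euler_intc (c + a) (c + b) (c + 1) s = euler_cont a b c s * stieltjes \<nu> s"
    using spectral_measure_III_transform[OF _ c(2,3) _ b \<nu> supp S_slit[OF sS]] a c euler_intc_euler_cont[OF sS] by simp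
  show Q: "euler_cont a b c s \<noteq> 0"
  proof
    assume Q0: "euler_cont a b c s = 0"
    then have "deuler_cont a b c s = 0" unfolding deuler_cont tr by simp
    then show False using euler_cont_deuler_cont_not_both_zero[OF a c(3) S_slit_disc[OF sS] Q0] by simp
  qed
  show "stieltjes \<nu> s = - deuler_cont a b c s / (of_real c * euler_cont a b c s)" unfolding deuler_cont tr using Q c by simp
qed

definition boundary_density :: "real \<Rightarrow> real \<Rightarrow> real \<Rightarrow> real \<Rightarrow> real" where
  "boundary_density a b c x = - Im (- deuler_cont a b c (of_real (- x)) / (of_real c * euler_cont a b c (of_real (- x)))) / pi"

lemma neg_slit_disc: "x \<in> {0<..<1} \<Longrightarrow> complex_of_real (- x) \<in> slit_disc"
  by (simp add: slit_disc_def)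

lemma exp_i_pi_shift: "exp (\<i> * of_real (pi * (1 + a))) = - exp (\<i> * of_real (pi * a))"
  by (simp add: distrib_left exp_add exp_pi_i mult.commute)

text \<open>After multiplication by the conjugate denominator the terms \<open>A A'\<close> and
  \<open>B B'\<close> are real; the cross terms carry the unit number \<open>E\<close> and its
  conjugate and leave the sine times a determinant.\<close>

lemma Im_ratio:
  fixes A B A' B' th :: real
  defines "E \<equiv> exp (\<i> * complex_of_real th)"
  assumes "of_real A + E * of_real B \<noteq> 0"
  shows "Im ((of_real A' + E * of_real B') / (of_real A + E * of_real B)) =
     sin th * (A * B' - B * A') / (cmod (of_real A + E * of_real B))\<^sup>2"
proof -
  have E: "Re E = cos th" "Im E = sin th" by (simp_all add: E_def exp_Euler cos_of_real sin_of_real)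
  define Z where "Z = complex_of_real A + E * of_real B"
  have "Im ((of_real A' + E * of_real B') / Z) = Im ((of_real A' + E * of_real B') * cnj Z) / (cmod Z)\<^sup>2"
    by (simp add: complex_div_cnj[of _ Z] Im_divide_of_real del: of_real_power flip: of_real_power)
  also have "Im ((of_real A' + E * of_real B') * cnj Z) = sin th * (A * B' - B * A')"
    by (simp add: Z_def E algebra_simps)
  finally show ?thesis unfolding Z_def .
qed

text \<open>On the cut all hypergeometric values are real and the single phase \<open>E\<close>
  comes from the upper branch, so \<open>Im_ratio\<close> applies. Its determinant is the Wronskian,
  and the reflection formula trades \<open>Gamma (-a)\<close> for the sine in
  \<open>V_III\<close>.\<close>

lemma density_III_eq:
  assumes a: "a \<notin> \<int>" "a > -1" and c: "c > 0" "c + a > 0" "c + b > 0" and x: "x \<in> {0<..<1}"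
  shows "euler_cont a b c (of_real (- x)) \<noteq> 0"
    and "boundary_density a b c x = density_III a b c x"
proof -
  have x1: "0 < x" "x < 1" "\<bar>x\<bar> < 1" using x by auto
  have sd: "complex_of_real (- x) \<in> slit_disc" by (rule neg_slit_disc[OF x])
  define F K where "F = hyp2F1 c (- c - a - b - 1) (- a) x" and "K = hyp2F1 (1 - c) (2 + c + a + b) (2 + a) x"
  define D where "D = c * (- c - a - b - 1) / (- a) * hyp2F1 (c + 1) (- c - a - b) (1 - a) x"
  define T where "T = (1 + a) * hyp2F1 (- c) (1 + c + a + b) (1 + a) x"
  have cF: "frob0 a b c (of_real x) = of_real F" and cK: "frob1_factor a b c (of_real x) = of_real K"
    and cD: "dfrob0 a b c (of_real x) = of_real D" and cT: "frob1_quasi a b c (of_real x) = of_real T"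
    unfolding frob0_def frob1_factor_def dfrob0_def frob1_quasi_def F_def K_def D_def T_def
    by (simp_all only: hyp2F1_of_real[OF x1(3), symmetric] of_real_mult)
  define E where "E = exp (\<i> * complex_of_real (pi * a))"
  define \<alpha> \<gamma> where "\<alpha> = Beta (a + 1) (c + b + 1)" and "\<gamma> = Gamma (c + a + 1) * Gamma (- a) / Gamma c / (1 + a)"
  have p1: "(1 + complex_of_real (- x)) powr of_real e = of_real ((1 - x) powr e)" for e
    using powr_of_real[of "1 - x" e] x1 by simp
  have ode_weight: "ode_weight a b (of_real (- x)) = E * of_real (x powr a * (1 - x) powr b)"
    unfolding ode_weight_def p1 unfolding of_real_minus powr_up_neg[OF x1(1)] E_def by simp
  have frob1: "frob1 a b c (of_real (- x)) = - E * of_real (x powr (1 + a) * (1 - x) powr (1 + b) * K)"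
    unfolding frob1_def p1 unfolding of_real_minus powr_up_neg[OF x1(1)] exp_i_pi_shift minus_minus cK E_def by simp
  define A B A' B' where "A = \<alpha> * F" and "B = \<gamma> * (x powr (1 + a) * (1 - x) powr (1 + b) * K)"
    and "A' = \<alpha> * D" and "B' = \<gamma> * (x powr a * (1 - x) powr b * T)"
  have Q: "euler_cont a b c (of_real (- x)) = of_real A + E * of_real B"
    unfolding euler_cont_def frob1 A_def B_def \<alpha>_def[symmetric] \<gamma>_def[symmetric] unfolding of_real_minus minus_minus cF by simp
  have deuler_cont: "deuler_cont a b c (of_real (- x)) = - (of_real A' + E * of_real B')"
    unfolding deuler_cont_def ode_weight A'_def B'_def \<alpha>_def[symmetric] \<gamma>_def[symmetric] unfolding of_real_minus minus_minus cD cT by simp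
  have G: "Gamma (a + 1) > 0" "Gamma (c + b + 1) > 0" "Gamma (c + a + b + 2) > 0" "Gamma (c + a + 1) > 0"
      "Gamma (c + 1) > 0" "Gamma c > 0"
    using a c by (auto intro!: Gamma_real_pos)
  have a1: "1 + a > 0" using a by simp
  have sin: "sin (pi * a) \<noteq> 0"
  proof
    assume "sin (pi * a) = 0"
    then obtain k :: int where "pi * a = of_int k * pi" by (auto simp: sin_zero_iff_int2)
    then have "a = of_int k" by simp
    then show False using a(1) by simp
  qed
  have refl: "Gamma (- a) * Gamma (1 + a) = - pi / sin (pi * a)"
  proof -
    have "complex_of_real (Gamma (- a) * Gamma (1 - (- a))) = of_real (pi / sin (pi * (- a)))"
      using Gamma_reflection_complex[of "of_real (- a)"]
      unfolding Gamma_complex_of_real[symmetric] of_real_mult of_real_diff of_real_divide of_real_1 sin_of_real[symmetric] .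
    then have "Gamma (- a) * Gamma (1 - (- a)) = pi / sin (pi * (- a))" unfolding of_real_eq_iff .
    then show ?thesis by simp
  qed
  have Wron: "F * T - x * (1 - x) * D * K = 1 + a"
  proof -
    have "norm (complex_of_real x) < 1" using x1 by simp
    from hyper_wronskian[OF a(1) this, of b c, unfolded cF cT cD cK]
    have "complex_of_real (F * T - x * (1 - x) * D * K) = of_real (1 + a)" by simp
    then show ?thesis unfolding of_real_eq_iff .
  qed
  have ABW: "A * B' - B * A' = \<alpha> * \<gamma> * (1 + a) * (x powr a * (1 - x) powr b)"
  proof -
    have e: "x powr (1 + a) = x * x powr a" "(1 - x) powr (1 + b) = (1 - x) * (1 - x) powr b"
      using x1 by (simp_all add: powr_add)
    have "A * B' - B * A' = \<alpha> * \<gamma> * (x powr a * (1 - x) powr b) * (F * T - x * (1 - x) * D * K)"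
      unfolding A_def B_def A'_def B'_def e by algebra
    then show ?thesis unfolding Wron by simp
  qed
  show Q0: "euler_cont a b c (of_real (- x)) \<noteq> 0"
  proof
    assume "euler_cont a b c (of_real (- x)) = 0"
    then have Z: "of_real A + E * of_real B = 0" unfolding Q .
    have Im_E: "Im E = sin (pi * a)" by (simp add: E_def exp_Euler cos_of_real sin_of_real del: of_real_mult)
    \<comment> \<open>\<open>A\<close> and \<open>B\<close> are real and \<open>E\<close> is not, so
      a zero would force \<open>A = B = 0\<close>, against the nonzero Wronskian
      \<open>A * B' - B * A'\<close>.\<close>
    have "Im (of_real A + E * of_real B) = 0" unfolding Z by simp
    then have "B = 0" using sin Im_E by simp
    moreover from this have "A = 0" using Z by simp
    ultimately have "\<alpha> * \<gamma> * (1 + a) * (x powr a * (1 - x) powr b) = 0" using ABW by simp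
    moreover have "\<alpha> \<noteq> 0" unfolding \<alpha>_def Beta_def using G a c by (simp add: add_ac less_imp_neq[symmetric])
    moreover have "\<gamma> \<noteq> 0"
    proof -
      have "Gamma (- a) \<noteq> 0" using refl sin by auto
      then show ?thesis unfolding \<gamma>_def using G a1 by simp
    qed
    ultimately show False using x1 a1 by simp
  qed
  define U V where "U = U_III a b c x" and "V = V_III a b c x"
  \<comment> \<open>The reciprocal of the Gamma quotient in front of the density; it is also the
    common factor between \<open>A\<close>, \<open>B\<close> and \<open>U\<close>,
    \<open>V\<close>.\<close>
  define \<rho> where "\<rho> = Gamma (c + b + 1) * Gamma (c + a + 1) / (Gamma (c + a + b + 2) * Gamma (c + 1))"
  have \<rho>: "\<rho> > 0" unfolding \<rho>_def using G by simp
  have \<alpha>: "\<alpha> = Gamma (a + 1) * Gamma (c + b + 1) / Gamma (c + a + b + 2)"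
    unfolding \<alpha>_def Beta_def by (simp add: algebra_simps)
  have Gc: "Gamma (c + 1) = c * Gamma c" by (rule Gamma_plus1) (use c in auto)
  have Ga: "Gamma (2 + a) = (1 + a) * Gamma (1 + a)"
    using Gamma_plus1[of "1 + a"] a1 by (auto simp: add.commute add.left_commute nonpos_Ints_def)
  have AU: "A = \<rho> * U"
  proof -
    have "\<rho> * U = (Gamma (c + b + 1) * Gamma (c + a + 1) / (Gamma (c + a + b + 2) * Gamma (c + 1))) *
        (Gamma (c + 1) * Gamma (a + 1) / Gamma (c + a + 1) * F)"
      by (simp add: \<rho>_def U_def U_III_def F_def add_ac)
    also have "\<dots> = A" unfolding A_def \<alpha> using G by (simp add: field_simps)
    finally show ?thesis by simp
  qed
  have BV: "B = \<rho> * V"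
  proof -
    define X where "X = (1 - x) powr (1 + b) * x powr (1 + a) * K"
    have "\<rho> * V = (Gamma (c + b + 1) * Gamma (c + a + 1) / (Gamma (c + a + b + 2) * Gamma (c + 1))) *
       (- pi * c * Gamma (c + a + b + 2) / (sin (pi * a) * Gamma (c + b + 1) * Gamma (2 + a)) * X)"
      by (simp add: \<rho>_def V_def V_III_def K_def X_def add_ac mult_ac)
    also have "\<dots> = Gamma (c + a + 1) * c / Gamma (c + 1) * ((- pi / sin (pi * a)) / Gamma (2 + a)) * X"
      using G by (simp add: field_simps)
    also have "\<dots> = \<gamma> * X"
    proof -
      have lem: "p * k / (k * q) * ((n * m) / (d * m)) * X = p * n / q / d * X" if "k \<noteq> 0" "m \<noteq> 0" for p k q n m d X :: real
        using that by simp
      have g: "Gamma (1 + a) \<noteq> 0" using G(1) by (simp add: add.commute)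
      show ?thesis
        unfolding refl[symmetric] Ga Gc \<gamma>_def by (rule lem) (use c(1) g in simp_all)
    qed
    also have "\<dots> = B" unfolding B_def X_def by (simp add: mult_ac)
    finally show ?thesis by simp
  qed
  have dens: "density_III a b c x = 1 / \<rho> * (x powr a * (1 - x) powr b / (cmod (of_real U + E * of_real V))\<^sup>2)"
    unfolding density_III_def U_def V_def E_def \<rho>_def by (simp add: mult_ac)
  have "- deuler_cont a b c (of_real (- x)) / (of_real c * euler_cont a b c (of_real (- x))) =
      of_real (1 / c) * ((of_real A' + E * of_real B') / (of_real A + E * of_real B))"
    unfolding Q deuler_cont by simp
  moreover have "Im (of_real r * z) = r * Im z" for r z by simp
  ultimately have "boundary_density a b c x = - (1 / c * Im ((of_real A' + E * of_real B') / (of_real A + E * of_real B))) / pi"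
    unfolding boundary_density_def by (simp only:)
  also have "Im ((of_real A' + E * of_real B') / (of_real A + E * of_real B)) =
      sin (pi * a) * (A * B' - B * A') / (cmod (of_real A + E * of_real B))\<^sup>2"
    using Im_ratio[of A "pi * a" B A' B'] Q0 unfolding Q E_def by simp
  also have "(cmod (of_real A + E * of_real B))\<^sup>2 = \<rho>\<^sup>2 * (cmod (of_real U + E * of_real V))\<^sup>2"
  proof -
    have "of_real A + E * of_real B = of_real \<rho> * (of_real U + E * of_real V)"
      unfolding AU BV by (simp add: algebra_simps)
    then show ?thesis by (simp add: norm_mult power_mult_distrib)
  qed
  also have "- (1 / c * (sin (pi * a) * (A * B' - B * A') / (\<rho>\<^sup>2 * (cmod (of_real U + E * of_real V))\<^sup>2))) / pi
     = (- (1 / (c * pi)) * sin (pi * a) * \<alpha> * \<gamma> * (1 + a)) / \<rho>\<^sup>2 * (x powr a * (1 - x) powr b / (cmod (of_real U + E * of_real V))\<^sup>2)"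
    unfolding ABW by (simp add: mult_ac)
  \<comment> \<open>Reflection cancels the sine of \<open>Im_ratio\<close>, and the Gamma factors
    collect to one \<open>\<rho>\<close>. Against the \<open>\<rho>^2\<close> of the squared modulus
    this leaves the prefactor \<open>1 / \<rho>\<close>.\<close>
  also have "- (1 / (c * pi)) * sin (pi * a) * \<alpha> * \<gamma> * (1 + a) = \<rho>"
  proof -
    have "\<gamma> * (1 + a) = Gamma (c + a + 1) * Gamma (- a) / Gamma c" unfolding \<gamma>_def using a1 by simp
    then have "- (1 / (c * pi)) * sin (pi * a) * \<alpha> * \<gamma> * (1 + a) =
       - (1 / (c * pi)) * sin (pi * a) * \<alpha> * (Gamma (c + a + 1) * Gamma (- a) / Gamma c)"
      by (simp only: mult.assoc)
    also have "\<dots> = - (1 / pi) * sin (pi * a) * (Gamma (- a) * Gamma (1 + a)) * \<rho>"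
    proof -
      have "- (1 / (k * p)) * S * (x * y / z) * (u * v / w) = - (1 / p) * S * (v * x) * (y * u / (z * (k * w)))" for k p S x y z u v w :: real
        by (simp add: divide_inverse mult_ac)
      moreover have "1 + a = a + 1" by simp
      ultimately show ?thesis unfolding \<alpha> \<rho>_def Gc by (simp only:)
    qed
    also have "\<dots> = \<rho>" unfolding refl using sin by simp
    finally show ?thesis .
  qed
  also have "\<rho> / \<rho>\<^sup>2 = 1 / \<rho>" by (simp add: power2_eq_square)
  finally show "boundary_density a b c x = density_III a b c x" unfolding dens .
qed

section \<open>Atoms\<close>

lemma spectral_measure_III_transform_real:
  assumes c: "c \<ge> 0" "c + a > 0" "c + b > 0" "a \<ge> - 1" "b \<ge> - 1"
    and \<nu>: "is_spectral_measure (J_III a b c) \<nu>" and supp: "AE x in \<nu>. x \<in> {0..1}" and s: "s > 0"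
  shows "euler_int (c + a) (c + b) (c + 1) s = euler_int (c + a) (c + b) c s * stieltjes_moment \<nu> 0 s"
proof -
  have "stieltjes \<nu> (of_real s) = of_real (stieltjes_moment \<nu> 0 s)"
    unfolding stieltjes_def stieltjes_moment_def integral_complex_of_real[symmetric] by simp
  then have "complex_of_real (euler_int (c + a) (c + b) (c + 1) s) = of_real (euler_int (c + a) (c + b) c s * stieltjes_moment \<nu> 0 s)"
    using spectral_measure_III_transform[OF c \<nu> supp, of "of_real s"] c s
    by (simp add: euler_intc_of_real slit_plane_iff)
  then show ?thesis unfolding of_real_eq_iff .
qed

lemma stieltjes_moment_atom:
  fixes \<nu> :: "real measure"
  assumes \<nu>: "prob_space \<nu>" "sets \<nu> = sets borel" "AE x in \<nu>. x \<in> {0..1}" and s: "s > 0"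
  shows "measure \<nu> {0} \<le> s * stieltjes_moment \<nu> 0 s"
proof -
  interpret prob_space \<nu> by fact
  have [measurable_cong]: "sets \<nu> = sets borel" by fact
  have "measure \<nu> {0} / s = (\<integral>t. indicator {0} t / s \<partial>\<nu>)" by simp
  also have "\<dots> \<le> (\<integral>t. t ^ 0 / (s + t) \<partial>\<nu>)"
  proof (rule integral_mono_AE)
    show "integrable \<nu> (\<lambda>t. indicator {0} t / s)"
      by (intro integrable_const_bound[of _ "1 / s"]) (use s in \<open>auto simp: indicator_def\<close>)
    show "integrable \<nu> (\<lambda>t. t ^ 0 / (s + t))" by (rule stieltjes_moment_integrable[OF \<nu> s])
    show "AE t in \<nu>. indicator {0} t / s \<le> t ^ 0 / (s + t)"
      using \<nu>(3) by eventually_elim (use s in \<open>auto simp: indicator_def\<close>)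
  qed
  finally show ?thesis using s by (simp add: stieltjes_moment_def pos_divide_le_eq mult.commute)
qed

text \<open>The case \<open>a = -1\<close>, so that \<open>p = c - 1\<close>. On
  \<open>[s, 1/2]\<close> one has \<open>s + t <= 2 t\<close>, which bounds the integrand below by a
  constant over \<open>t\<close>; its integral is a logarithm.\<close>

lemma euler_int_unbounded:
  assumes c: "c > 1" "q > 0" and s: "0 < s" "s < 1 / 2"
  shows "euler_int (c - 1) q c s \<ge> (1/2) powr (c + q) * ln (1 / (2 * s))"
proof -
  have h1: "((\<lambda>t. (1/2) powr (c + q) * (1 / t)) has_integral (1/2) powr (c + q) * (ln (1 / 2) - ln s)) {s..1/2}"
  proof (intro has_integral_mult_right fundamental_theorem_of_calculus)
    fix x assume "x \<in> {s..1/2}"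
    then show "(ln has_vector_derivative 1 / x) (at x within {s..1/2})"
      using s by (auto intro!: derivative_eq_intros simp flip: has_real_derivative_iff_has_vector_derivative)
  qed (use s in auto)
  have le: "(1/2) powr (c + q) * (1 / t) \<le> t powr (c - 1) * (1 - t) powr q * (s + t) powr (- c)" if t: "t \<in> {s..1/2}" for t
  proof -
    have t0: "t > 0" using t s by auto
    have "(2 * t) powr (- c) \<le> (s + t) powr (- c)" using t s c by (intro powr_mono2') auto
    moreover have "(1/2) powr q \<le> (1 - t) powr q" using t c by (intro powr_mono2) auto
    ultimately have "t powr (c - 1) * (1/2) powr q * (2 * t) powr (- c) \<le> t powr (c - 1) * (1 - t) powr q * (s + t) powr (- c)"
      by (intro mult_mono) auto
    moreover have "t powr (c - 1) * (1/2) powr q * (2 * t) powr (- c) = (1/2) powr (c + q) * (1 / t)"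
    proof -
      have "(2 * t) powr (- c) = (1/2) powr c * t powr (- c)"
      proof -
        have "(2 * t) powr (- c) = 2 powr (- c) * t powr (- c)" using t0 by (simp add: powr_mult)
        moreover have "(1/2) powr c = 2 powr (- c)" by (simp add: powr_divide powr_minus_divide)
        ultimately show ?thesis by (simp only:)
      qed
      moreover have "t powr (c - 1) * t powr (- c) = 1 / t"
        using t0 powr_add[of t "c - 1" "- c"] by (simp add: powr_minus_divide)
      moreover have "t powr (c - 1) * (1/2) powr q * ((1/2) powr c * t powr (- c)) =
          (1/2) powr c * (1/2) powr q * (t powr (c - 1) * t powr (- c))"
        by (simp only: mult_ac)
      ultimately show ?thesis by (simp only: powr_add)
    qed
    ultimately show ?thesis by (simp only:)
  qed
  have i: "(\<lambda>t. t powr (c - 1) * (1 - t) powr q * (s + t) powr (- c)) integrable_on {0..1}"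
    using euler_int_has_integral[of "c - 1" q s c] c s by (auto simp: has_integral_iff)
  have i2: "(\<lambda>t. t powr (c - 1) * (1 - t) powr q * (s + t) powr (- c)) integrable_on {s..1/2}"
    by (rule integrable_subinterval_real[OF i]) (use s in auto)
  have "(1/2) powr (c + q) * (ln (1 / 2) - ln s) \<le> integral {s..1/2} (\<lambda>t. t powr (c - 1) * (1 - t) powr q * (s + t) powr (- c))"
    by (rule has_integral_le[OF h1 integrable_integral[OF i2] le])
  also have "\<dots> \<le> euler_int (c - 1) q c s"
    unfolding euler_int_def
    by (rule integral_subset_le[OF _ i2 i]) (use s in auto)
  also have "ln (1 / 2) - ln s = ln (1 / (2 * s))" using s by (simp add: ln_div ln_mult)
  finally show ?thesis .
qed

text \<open>With these exponents \<open>euler_int_subst\<close> has power 0 on \<open>1 - v\<close>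
  and the prefactor \<open>s\<close>, so the integrand is at most 1 on an interval of length at most
  1.\<close>

lemma euler_int_scaled_bounded:
  assumes c: "c > 1" "q > 0" and s: "0 < s"
  shows "s * euler_int (c - 1) q (c + 1) s \<le> 1"
proof -
  have e: "c + 1 - (c - 1) - 2 = 0" "c + 1 - (c - 1) - 1 = 1" by simp_all
  have "((\<lambda>v. v powr (c - 1) * (1 - v) powr 0 * (1 - s * v / (1 - v)) powr q) has_integral s powr 1 * euler_int (c - 1) q (c + 1) s) {0..1 / (1 + s)}"
    using euler_int_subst[of "c - 1" q s "c + 1"] c s unfolding e by simp
  moreover have "((\<lambda>v. 1 :: real) has_integral 1 / (1 + s)) {0..1 / (1 + s)}"
    using has_integral_const_real[of "1::real" 0 "1 / (1 + s)"] s by simp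
  ultimately have "s powr 1 * euler_int (c - 1) q (c + 1) s \<le> 1 / (1 + s)"
  proof (rule has_integral_le)
    fix v assume v: "v \<in> {0..1 / (1 + s)}"
    note r = subst_range[OF s v]
    have "v powr (c - 1) \<le> 1" "(1 - v) powr 0 \<le> 1" "(1 - s * v / (1 - v)) powr q \<le> 1"
      using r c by (auto intro!: powr_le1)
    then have "v powr (c - 1) * (1 - v) powr 0 * (1 - s * v / (1 - v)) powr q \<le> 1 * 1 * 1"
      by (intro mult_mono) auto
    then show "v powr (c - 1) * (1 - v) powr 0 * (1 - s * v / (1 - v)) powr q \<le> 1" by simp
  qed
  also have "1 / (1 + s) \<le> 1" using s by simp
  finally show ?thesis using s by simp
qed

text \<open>An atom of mass \<open>m\<close> at \<open>0\<close> forces \<open>m I\<^sub>c(s) \<le> s I\<^sub>c\<^sub>+\<^sub>1(s)\<close>. For \<open>a > -1\<close> the right side vanishes as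
  \<open>s \<rightarrow> 0\<close>; for \<open>a = -1\<close>, which occurs after exchanging \<open>a\<close> and \<open>b\<close>, it stays bounded while
  \<open>I\<^sub>c\<close> has a logarithmic singularity.\<close>

lemma no_atom_0:
  assumes c: "c > 0" "c + a > 0" "c + b > 0" "a \<ge> - 1" "b \<ge> - 1"
    and \<nu>: "is_spectral_measure (J_III a b c) \<nu>" and supp: "AE x in \<nu>. x \<in> {0..1}"
  shows "measure \<nu> {0} = 0"
proof -
  define m where "m = measure \<nu> {0}"
  have \<nu>': "prob_space \<nu>" "sets \<nu> = sets borel" using \<nu> by (auto simp: is_spectral_measure_def)
  have m0: "m \<ge> 0" by (simp add: m_def)
  have key: "m * euler_int (c + a) (c + b) c s \<le> s * euler_int (c + a) (c + b) (c + 1) s" if s: "s > 0" for s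
  proof -
    have "m * euler_int (c + a) (c + b) c s \<le> (s * stieltjes_moment \<nu> 0 s) * euler_int (c + a) (c + b) c s"
      unfolding m_def using stieltjes_moment_atom[OF \<nu>' supp s] euler_int_nonneg[of "c + a" "c + b" s c] c s by (intro mult_right_mono) auto
    also have "\<dots> = s * euler_int (c + a) (c + b) (c + 1) s"
      using spectral_measure_III_transform_real[OF less_imp_le[OF c(1)] c(2-5) \<nu> supp s] by simp
    finally show ?thesis .
  qed
  have "m \<le> 0"
  proof (cases "a > -1")
    case True
    have "(\<lambda>n. m * euler_int (c + a) (c + b) c (1 / real (n + 2))) \<longlonglongrightarrow> m * Beta (a + 1) (c + b + 1)"
      using True c by (intro tendsto_mult tendsto_const euler_int_limit_0) auto
    moreover have "(\<lambda>n. 1 / real (n + 2) * euler_int (c + a) (c + b) (c + 1) (1 / real (n + 2))) \<longlonglongrightarrow> 0"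
      using True c by (intro euler_int_limit_1) auto
    ultimately have "m * Beta (a + 1) (c + b + 1) \<le> 0"
      by (rule LIMSEQ_le) (intro exI allI impI key, simp)
    moreover have "Beta (a + 1) (c + b + 1) > 0"
      unfolding Beta_def using True c by (intro divide_pos_pos mult_pos_pos Gamma_real_pos) auto
    ultimately show ?thesis by (simp add: mult_le_0_iff)
  next
    case False
    then have a: "a = -1" using c by simp
    have c1: "c > 1" using c a by simp
    define K where "K = (1/2 :: real) powr (c + (c + b))"
    have K: "K > 0" by (simp add: K_def)
    show ?thesis
    proof (rule ccontr)
      assume "\<not> m \<le> 0"
      then have m: "m > 0" by simp
      \<comment> \<open>The offset 3 makes \<open>s = 1 / (n + 3)\<close> strictly less than 1/2, as
        \<open>euler_int_unbounded\<close> requires.\<close>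
      have "filterlim (\<lambda>n. m * (K * ln (1 / (2 * (1 / real (n + 3)))))) at_top sequentially"
        using m K by real_asymp
      then have "\<forall>\<^sub>F n in sequentially. m * (K * ln (1 / (2 * (1 / real (n + 3))))) > 1"
        by (rule filterlim_at_top_dense[THEN iffD1, rule_format])
      then obtain n where n: "m * (K * ln (1 / (2 * (1 / real (n + 3))))) > 1"
        by (auto simp: eventually_sequentially)
      define s where "s = 1 / real (n + 3)"
      have s: "0 < s" "s < 1 / 2" by (simp_all add: s_def divide_simps)
      have "1 < m * (K * ln (1 / (2 * s)))" using n by (simp add: s_def)
      also have "\<dots> \<le> m * euler_int (c - 1) (c + b) c s"
        unfolding K_def using euler_int_unbounded[OF c1 c(3) s] m by (intro mult_left_mono) auto
      also have "\<dots> \<le> s * euler_int (c - 1) (c + b) (c + 1) s" using key[OF s(1)] a by simp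
      also have "\<dots> \<le> 1" by (rule euler_int_scaled_bounded[OF c1 c(3) s(1)])
      finally show False by simp
    qed
  qed
  then show ?thesis using m0 unfolding m_def by linarith
qed

text \<open>The moments of the reflected measure are the integrals of \<open>(1 - x)^k\<close>, that
  is, the Hausdorff differences evaluated in \<open>moments_III_flip\<close>.\<close>

lemma spectral_measure_III_flip:
  assumes c: "c \<ge> 0" "c + a > 0" "c + b > 0"
    and \<nu>: "is_spectral_measure (J_III a b c) \<nu>" and supp: "AE x in \<nu>. x \<in> {0..1}"
  shows "is_spectral_measure (J_III b a c) (distr \<nu> borel (\<lambda>x. 1 - x))"
    and "AE x in distr \<nu> borel (\<lambda>x. 1 - x). x \<in> {0..1}"
    and "measure (distr \<nu> borel (\<lambda>x. 1 - x)) {0} = measure \<nu> {1}"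
proof -
  interpret prob_space \<nu> using \<nu> by (simp add: is_spectral_measure_def)
  have sets [measurable_cong]: "sets \<nu> = sets borel" using \<nu> by (simp add: is_spectral_measure_def)
  have space: "space \<nu> = UNIV" using sets_eq_imp_space_eq[OF sets] by simp
  let ?\<mu> = "distr \<nu> borel (\<lambda>x. 1 - x)"
  have int: "integrable \<nu> (\<lambda>x. x ^ k)" and mom: "(\<integral>x. x ^ k \<partial>\<nu>) = inf_mat_pow (J_III a b c) k 0 0" for k
    using \<nu> by (simp_all add: is_spectral_measure_def)
  have expand: "(1 - x) ^ k = (\<Sum>l\<le>k. (-1) ^ l * real (k choose l) * x ^ l)" for x :: real and k
    using binomial_ring[of "- x" 1 k] by (simp add: power_minus[of x] mult_ac)
  have "integrable ?\<mu> (\<lambda>x. x ^ k)" for k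
    by (subst integrable_distr_eq) (auto simp: expand int)
  moreover have "(\<integral>x. x ^ k \<partial>?\<mu>) = inf_mat_pow (J_III b a c) k 0 0" for k
  proof -
    have "(\<integral>x. x ^ k \<partial>?\<mu>) = (\<integral>x. (\<Sum>l\<le>k. (-1) ^ l * real (k choose l) * x ^ l) \<partial>\<nu>)"
      by (subst integral_distr) (auto simp: expand)
    also have "\<dots> = (\<Sum>l\<le>k. (-1) ^ l * real (k choose l) * inf_mat_pow (J_III a b c) l 0 0)"
      by (simp add: int mom)
    also have "\<dots> = hausdorff_diff (\<lambda>k. inf_mat_pow (J_III a b c) k 0 0) 0 k"
      by (simp add: hausdorff_diff_def)
    also have "\<dots> = inf_mat_pow (J_III b a c) k 0 0" by (rule moments_III_flip[OF c])
    finally show ?thesis .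
  qed
  ultimately show "is_spectral_measure (J_III b a c) ?\<mu>"
    by (auto simp: is_spectral_measure_def intro: prob_space_distr)
  have "AE x in \<nu>. 1 - x \<in> {0..1}" using supp by eventually_elim auto
  then show "AE x in ?\<mu>. x \<in> {0..1}"
    by (subst AE_distr_iff) auto
  have "(\<lambda>x::real. 1 - x) -` {0} \<inter> space \<nu> = {1}" by (auto simp: space)
  then show "measure ?\<mu> {0} = measure \<nu> {1}"
    by (subst measure_distr) auto
qed

lemma no_atom_1:
  assumes c: "c > 0" "c + a > 0" "c + b > 0" "a \<ge> - 1" "b \<ge> - 1"
    and \<nu>: "is_spectral_measure (J_III a b c) \<nu>" and supp: "AE x in \<nu>. x \<in> {0..1}"
  shows "measure \<nu> {1} = 0"
proof -
  have c0: "c \<ge> 0" using c by simp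
  have "measure \<nu> {1} = measure (distr \<nu> borel (\<lambda>x. 1 - x)) {0}"
    by (rule spectral_measure_III_flip(3)[OF c0 c(2,3) \<nu> supp, symmetric])
  also have "\<dots> = 0"
    by (rule no_atom_0[OF c(1,3,2,5,4) spectral_measure_III_flip(1,2)[OF c0 c(2,3) \<nu> supp]])
  finally show ?thesis .
qed

text \<open>The definite description needs uniqueness among all candidates: each of them equals the
  one supported in [0,1].\<close>

lemma spectral_measure_III_eqI:
  assumes "c \<ge> 0" "c + a > 0" "c + b > 0" "a \<ge> - 1" "b \<ge> - 1"
    and \<mu>: "is_spectral_measure (J_III a b c) \<mu>"
  shows "spectral_measure (J_III a b c) = \<mu>"
proof -
  obtain \<nu> where \<nu>: "is_spectral_measure (J_III a b c) \<nu>" "AE x in \<nu>. x \<in> {0..1}"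
    using spectral_measure_III_exists[OF assms(1-5)] by blast
  show ?thesis
    unfolding spectral_measure_def
  proof (rule the_equality)
    show "is_spectral_measure (J_III a b c) \<mu>" by (rule \<mu>)
    fix \<mu>' assume "is_spectral_measure (J_III a b c) \<mu>'"
    then show "\<mu>' = \<mu>"
      using spectral_measure_unique[OF \<nu>] \<mu> by metis
  qed
qed

section \<open>The density\<close>

lemma hyp2F1_0_left [simp]: "hyp2F1 0 q r x = 1"
proof -
  have "fps_hypergeo [0, q] [r] 1 = (1 :: real fps)"
    by (rule fps_ext) (simp add: pochhammer_0_left)
  then show ?thesis by (simp add: hyp2F1_def)
qed

text \<open>For \<open>c = 0\<close> the integral \<open>I_0\<close> is the constant Beta value, and
  \<open>I_1 / I_0\<close> is visibly the Stieltjes transform of the normalised beta weight.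
  Agreement for large \<open>s\<close> already fixes the moments.\<close>

lemma Beta_density:
  fixes a b :: real
  assumes a: "a > 0" "b > 0"
  defines "w \<equiv> \<lambda>x. indicator {0..1} x * (x powr a * (1 - x) powr b) / Beta (a + 1) (b + 1)"
  shows "is_spectral_measure (J_III a b 0) (density lborel (\<lambda>x. ennreal (w x)))"
proof -
  define \<mu> where "\<mu> = density lborel (\<lambda>x. ennreal (w x))"
  have Bp: "Beta (a + 1) (b + 1) > 0"
    unfolding Beta_def using a by (intro divide_pos_pos mult_pos_pos Gamma_real_pos) auto
  have w_meas [measurable]: "w \<in> borel_measurable borel" unfolding w_def by measurable
  have w0: "0 \<le> w x" for x using Bp by (auto simp: w_def indicator_def)
  have sets: "sets \<mu> = sets borel" by (simp add: \<mu>_def)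
  have cont: "continuous_on {0..1} (\<lambda>x. x powr a * (1 - x) powr b * g x / Beta (a + 1) (b + 1))"
    if "continuous_on {0..1} g" for g :: "real \<Rightarrow> real"
    using a that Bp by (intro continuous_on_divide continuous_on_mult continuous_on_powr' continuous_intros) auto
  have E: "(\<integral>x. g x \<partial>\<mu>) = integral {0..1} (\<lambda>x. x powr a * (1 - x) powr b * g x) / Beta (a + 1) (b + 1)"
    if g: "continuous_on {0..1} g" and gm: "g \<in> borel_measurable borel" for g :: "real \<Rightarrow> real"
  proof -
    have "(\<integral>x. g x \<partial>\<mu>) = (\<integral>x. w x * g x \<partial>lborel)"
      unfolding \<mu>_def using gm w0 by (subst integral_density) auto
    also have "\<dots> = (LBINT x:{0..1}. x powr a * (1 - x) powr b * g x / Beta (a + 1) (b + 1))"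
      unfolding set_lebesgue_integral_def by (intro Bochner_Integration.integral_cong) (auto simp: w_def)
    also have "\<dots> = integral {0..1} (\<lambda>x. x powr a * (1 - x) powr b * g x / Beta (a + 1) (b + 1))"
      by (rule set_borel_integral_eq_integral(2))
         (use borel_integrable_compact[OF _ cont[OF g]] in \<open>auto simp: set_integrable_def\<close>)
    finally show ?thesis by (simp add: integral_divide)
  qed
  have prob: "prob_space \<mu>"
  proof
    have wi: "integrable lborel w"
    proof -
      have "integrable lborel (\<lambda>x. indicator {0..1} x *\<^sub>R (x powr a * (1 - x) powr b * 1 / Beta (a + 1) (b + 1)))"
        by (intro borel_integrable_compact cont) auto
      then show ?thesis by (simp add: w_def)
    qed
    have "(\<integral>x. (1::real) \<partial>\<mu>) = 1"
    proof -
      have "integral {0..1} (\<lambda>x. x powr a * (1 - x) powr b * 1) = Beta (a + 1) (b + 1)"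
        using Beta_weight_integrable(2)[of a b] a by simp
      then show ?thesis using Bp E[of "\<lambda>_. 1"] by simp
    qed
    moreover have "(\<integral>x. (1::real) \<partial>\<mu>) = (\<integral>x. w x \<partial>lborel)"
      unfolding \<mu>_def using w0 by (subst integral_density) auto
    ultimately have "(\<integral>x. w x \<partial>lborel) = 1" by simp
    then have "(\<integral>\<^sup>+x. ennreal (w x) \<partial>lborel) = 1"
      using nn_integral_eq_integral[OF wi] w0 by simp
    then show "emeasure \<mu> (space \<mu>) = 1" by (simp add: \<mu>_def emeasure_density)
  qed
  have supp\<mu>: "AE x in \<mu>. x \<in> {0..1}"
    unfolding \<mu>_def by (subst AE_density) (auto simp: w_def indicator_def)
  obtain \<nu> where \<nu>: "is_spectral_measure (J_III a b 0) \<nu>" "AE x in \<nu>. x \<in> {0..1}"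
    using spectral_measure_III_exists[of 0 a b] a by auto
  have \<nu>': "prob_space \<nu>" "sets \<nu> = sets borel" using \<nu>(1) by (auto simp: is_spectral_measure_def)
  define K where "K = max 4 ((a + b + 4) * (a + b + 5))"
  have mom: "(\<integral>t. t ^ k \<partial>\<nu>) = (\<integral>t. t ^ k \<partial>\<mu>)" for k
  proof (rule stieltjes_moments_eq[OF \<nu>' \<nu>(2) prob sets supp\<mu>])
    show "K > 0" by (simp add: K_def)
    fix s assume "s \<ge> K"
    then have s: "s \<ge> 4" "s \<ge> (2 * 0 + a + b + 4) * (2 * 0 + a + b + 5)" by (auto simp: K_def)
    have "euler_int (0 + a) (0 + b) (0 + 1) s = euler_int (0 + a) (0 + b) 0 s * (\<integral>t. 1 / (s + t) \<partial>\<nu>)"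
      by (rule spectral_measure_III_transform_large[OF _ _ _ _ _ \<nu> s]) (use a in auto)
    moreover have "euler_int (0 + a) (0 + b) 0 s = Beta (a + 1) (b + 1)"
    proof -
      have "euler_int a b 0 s = integral {0..1} (\<lambda>t. t powr a * (1 - t) powr b)"
        unfolding euler_int_def using s by (intro integral_cong) auto
      then show ?thesis using Beta_weight_integrable(2)[of a b] a by simp
    qed
    moreover have "(\<integral>t. 1 / (s + t) \<partial>\<mu>) = euler_int a b 1 s / Beta (a + 1) (b + 1)"
    proof -
      have "(\<integral>t. 1 / (s + t) \<partial>\<mu>) = integral {0..1} (\<lambda>x. x powr a * (1 - x) powr b * (1 / (s + x))) / Beta (a + 1) (b + 1)"
        by (rule E) (use s in \<open>auto intro!: continuous_intros\<close>)
      also have "integral {0..1} (\<lambda>x. x powr a * (1 - x) powr b * (1 / (s + x))) = euler_int a b 1 s"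
        unfolding euler_int_def using s by (intro integral_cong) (auto simp: powr_minus_divide)
      finally show ?thesis .
    qed
    ultimately show "(\<integral>t. 1 / (s + t) \<partial>\<nu>) = (\<integral>t. 1 / (s + t) \<partial>\<mu>)" using Bp by simp
  qed
  have "(\<integral>t. t ^ k \<partial>\<nu>) = inf_mat_pow (J_III a b 0) k 0 0" for k
    using \<nu>(1) by (simp add: is_spectral_measure_def)
  then have "(\<integral>t. t ^ k \<partial>\<mu>) = inf_mat_pow (J_III a b 0) k 0 0" for k
    by (simp only: mom)
  moreover have "integrable \<mu> (\<lambda>t. t ^ k)" for k
  proof -
    interpret prob_space \<mu> by (rule prob)
    show ?thesis
    proof (rule integrable_const_bound[of _ 1])
      show "AE t in \<mu>. norm (t ^ k) \<le> 1" using supp\<mu> by eventually_elim (simp add: power_le_one)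
      have [measurable_cong]: "sets \<mu> = sets borel" by (rule sets)
      show "(\<lambda>t. t ^ k) \<in> borel_measurable \<mu>" by measurable
    qed
  qed
  ultimately show ?thesis
    using prob sets unfolding is_spectral_measure_def \<mu>_def[symmetric] by blast
qed

lemma density_III_0:
  assumes a: "a > 0" "b > 0" and x: "x \<in> {0<..<1}"
  shows "density_III a b 0 x = x powr a * (1 - x) powr b / Beta (a + 1) (b + 1)"
proof -
  have "Gamma (1 + a) > 0" using a by (intro Gamma_real_pos) auto
  then have U: "U_III a b 0 x = 1" by (simp add: U_III_def add.commute)
  have V: "V_III a b 0 x = 0" by (simp add: V_III_def)
  show ?thesis unfolding density_III_def U V by (simp add: Beta_def add_ac)
qed

lemma spectral_measure_III_c0:
  assumes a: "a > 0" "b > 0"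
  shows "spectral_measure (J_III a b 0) =
         density lborel (\<lambda>x. ennreal (indicator {0<..<1} x * density_III a b 0 x))"
proof -
  have "(\<lambda>x. ennreal (indicator {0<..<1} x * density_III a b 0 x)) =
     (\<lambda>x. ennreal (indicator {0..1} x * (x powr a * (1 - x) powr b) / Beta (a + 1) (b + 1)))"
  proof
    fix x :: real
    consider "x \<in> {0<..<1}" | "x = 0" | "x = 1" | "x \<notin> {0..1}" by force
    then show "ennreal (indicator {0<..<1} x * density_III a b 0 x) =
      ennreal (indicator {0..1} x * (x powr a * (1 - x) powr b) / Beta (a + 1) (b + 1))"
      by cases (use density_III_0[OF a] in auto)
  qed
  then show ?thesis
    using spectral_measure_III_eqI[OF _ _ _ _ _ Beta_density[OF a]] a by simp
qed

section \<open>The case \<open>c > 0\<close>: identification of the measure\<close>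

context
  fixes a b c :: real and \<nu> :: "real measure"
  assumes a: "a \<notin> \<int>" "a > -1" and b: "b \<ge> -1" and c: "c > 0" "c + a > 0" "c + b > 0"
    and \<nu>: "is_spectral_measure (J_III a b c) \<nu>" and supp: "AE x in \<nu>. x \<in> {0..1}"
begin

lemma boundary_density_isCont:
  assumes x: "x \<in> {0<..<1}"
  shows "isCont (boundary_density a b c) x"
proof -
  have sd: "complex_of_real (- x) \<in> slit_disc" by (rule neg_slit_disc[OF x])
  have m: "isCont (\<lambda>x. complex_of_real (- x)) x" by (intro continuous_intros)
  have "isCont (\<lambda>x. euler_cont a b c (of_real (- x))) x" "isCont (\<lambda>x. deuler_cont a b c (of_real (- x))) x"
    using isCont_o2[OF m DERIV_isCont[OF euler_cont_deriv[OF a(1) sd]]] isCont_o2[OF m deuler_cont_isCont[OF a(1) sd]] by blast+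
  then show ?thesis
    unfolding boundary_density_def[abs_def] using density_III_eq(1)[OF a c x] c
    by (intro continuous_intros) auto
qed

lemma boundary_density_nonneg:
  assumes x: "x \<in> {0<..<1}"
  shows "0 \<le> boundary_density a b c x"
proof -
  have "Gamma (c + 1) > 0" "Gamma (c + a + b + 2) > 0" "Gamma (c + a + 1) > 0" "Gamma (c + b + 1) > 0"
    using a b c by (auto intro!: Gamma_real_pos)
  then show ?thesis unfolding density_III_eq(2)[OF a c x] density_III_def by simp
qed

lemma boundary_density_integrable:
  assumes "0 < u" "v < 1"
  shows "integrable lborel (\<lambda>x. indicator {u..v} x *\<^sub>R boundary_density a b c x)"
proof (rule borel_integrable_compact)
  show "continuous_on {u..v} (boundary_density a b c)"
    by (rule continuous_at_imp_continuous_on) (use assms boundary_density_isCont in auto)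
qed simp

text \<open>The height \<open>(1 - v) / 2\<close> keeps the rectangle inside the unit disc. The
  denominator has no zero on it: on the real edge by \<open>density_III_eq\<close>, above it by
  \<open>stieltjes_euler_cont\<close>.\<close>

lemma nu_interval_half:
  assumes uv: "0 < u" "u < v" "v < 1"
  shows "measure \<nu> {u<..<v} + (measure \<nu> {u} + measure \<nu> {v}) / 2 = (LBINT x:{u..v}. boundary_density a b c x)"
proof -
  have \<nu>': "prob_space \<nu>" "sets \<nu> = sets borel" using \<nu> by (auto simp: is_spectral_measure_def)
  define R where "R s = - deuler_cont a b c s / (of_real c * euler_cont a b c s)" for s
  define e0 where "e0 = (1 - v) / 2"
  have e0: "e0 > 0" using uv by (simp add: e0_def)
  have nrm: "norm z < 1" if "z \<in> cbox (Complex (- v) 0) (Complex (- u) e0)" for z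
  proof -
    have "norm z \<le> \<bar>Re z\<bar> + \<bar>Im z\<bar>" by (rule cmod_le)
    also have "\<dots> \<le> v + e0" using that uv by (auto simp: in_cbox_complex_iff)
    also have "\<dots> < 1" using uv by (simp add: e0_def field_simps)
    finally show ?thesis .
  qed
  have "measure \<nu> {u<..<v} + (measure \<nu> {u} + measure \<nu> {v}) / 2 = (LBINT x:{u..v}. - Im (R (Complex (- x) 0)) / pi)"
  proof (rule stieltjes_inversion[OF \<nu>' uv(2) e0])
    show "continuous_on (cbox (Complex (- v) 0) (Complex (- u) e0)) R"
    proof (rule continuous_at_imp_continuous_on, rule ballI)
      fix z assume z: "z \<in> cbox (Complex (- v) 0) (Complex (- u) e0)"
      have sd: "z \<in> slit_disc" using nrm[OF z] z uv by (auto simp: slit_disc_def in_cbox_complex_iff)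
      have "euler_cont a b c z \<noteq> 0"
      proof (cases "Im z = 0")
        case True
        then have "z = of_real (- (- Re z))" by (simp add: complex_eq_iff)
        moreover have "- Re z \<in> {0<..<1}" using z uv by (auto simp: in_cbox_complex_iff)
        ultimately show ?thesis using density_III_eq(1)[OF a c] by metis
      next
        case False
        then have "Im z > 0" using z by (auto simp: in_cbox_complex_iff)
        then show ?thesis by (rule stieltjes_euler_cont(1)[OF a b c \<nu> supp nrm[OF z]])
      qed
      then show "isCont R z"
        unfolding R_def using c DERIV_isCont[OF euler_cont_deriv[OF a(1) sd]] deuler_cont_isCont[OF a(1) sd]
        by (intro continuous_intros) auto
    qed
    fix x e assume x: "x \<in> {u..v}" and e: "0 < e" "e \<le> e0"
    have "Complex (- x) e \<in> cbox (Complex (- v) 0) (Complex (- u) e0)" using x e by (auto simp: in_cbox_complex_iff)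
    from nrm[OF this] show "stieltjes \<nu> (Complex (- x) e) = R (Complex (- x) e)"
      unfolding R_def by (intro stieltjes_euler_cont(2)[OF a b c \<nu> supp]) (use e in auto)
  qed
  also have "(\<lambda>x. - Im (R (Complex (- x) 0)) / pi) = boundary_density a b c"
    unfolding R_def boundary_density_def[abs_def] by (simp add: complex_of_real_def)
  finally show ?thesis .
qed

text \<open>Half of the mass at \<open>v\<close> is at most the integral over \<open>[u, v]\<close>
  of a density bounded near \<open>v\<close>, which shrinks to 0 as \<open>u\<close> approaches
  \<open>v\<close>.\<close>

lemma nu_no_atom:
  assumes v: "0 < v" "v < 1"
  shows "measure \<nu> {v} = 0"
proof -
  have "continuous_on {v/2..v} (boundary_density a b c)"
    using v by (intro continuous_at_imp_continuous_on ballI boundary_density_isCont) auto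
  from compact_imp_bounded[OF compact_continuous_image[OF this]] obtain B where "\<forall>x\<in>{v/2..v}. \<bar>boundary_density a b c x\<bar> \<le> B"
    unfolding bounded_iff by auto
  then have B: "\<And>x. x \<in> {v/2..v} \<Longrightarrow> \<bar>boundary_density a b c x\<bar> \<le> B" by blast
  have le: "measure \<nu> {v} / 2 \<le> B * (v - u)" if u: "v / 2 \<le> u" "u < v" for u
  proof -
    have "measure \<nu> {v} / 2 \<le> measure \<nu> {u<..<v} + (measure \<nu> {u} + measure \<nu> {v}) / 2"
    proof -
      have "z / 2 \<le> x + (y + z) / 2" if "0 \<le> x" "0 \<le> y" for x y z :: real
        using that by (simp add: add_divide_distrib)
      then show ?thesis by (simp only: measure_nonneg)
    qed
    also have "\<dots> = (LBINT x:{u..v}. boundary_density a b c x)" using u v by (intro nu_interval_half) auto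
    also have "\<dots> \<le> (LBINT x:{u..v}. B)"
      unfolding set_lebesgue_integral_def
    proof (rule integral_mono)
      show "integrable lborel (\<lambda>x. indicator {u..v} x *\<^sub>R boundary_density a b c x)" using u v by (intro boundary_density_integrable) auto
      show "integrable lborel (\<lambda>x. indicator {u..v} x *\<^sub>R B)" by (intro borel_integrable_compact) auto
      fix x show "indicator {u..v} x *\<^sub>R boundary_density a b c x \<le> indicator {u..v} x *\<^sub>R B"
        using B[of x] u by (auto simp: indicator_def abs_le_iff)
    qed
    also have "\<dots> = B * (v - u)" using u by (simp add: set_lebesgue_integral_def)
    finally show ?thesis .
  qed
  have "measure \<nu> {v} / 2 \<le> 0"
  proof (rule LIMSEQ_le_const)
    have "(\<lambda>n. 1 / real (n + 2)) \<longlonglongrightarrow> 0" by real_asymp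
    then have "(\<lambda>n. B * v * (1 / real (n + 2))) \<longlonglongrightarrow> B * v * 0"
      by (intro tendsto_mult tendsto_const)
    then show "(\<lambda>n. B * (v - (v - v / real (n + 2)))) \<longlonglongrightarrow> 0" by simp
    show "\<exists>N. \<forall>n\<ge>N. measure \<nu> {v} / 2 \<le> B * (v - (v - v / real (n + 2)))"
    proof (intro exI allI impI le)
      fix n
      have "v / real (n + 2) \<le> v / 2" using v by (intro divide_left_mono) auto
      then show "v / 2 \<le> v - v / real (n + 2)" by linarith
      show "v - v / real (n + 2) < v" using v by simp
    qed
  qed
  moreover have "0 \<le> measure \<nu> {v}" by simp
  ultimately show ?thesis by linarith
qed

lemma nu_interval:
  assumes uv: "0 < u" "u < v" "v < 1"
  shows "emeasure \<nu> {u..v} = emeasure (density lborel (\<lambda>x. ennreal (indicator {0<..<1} x * density_III a b c x))) {u..v}"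
proof -
  interpret prob_space \<nu> using \<nu> by (simp add: is_spectral_measure_def)
  have sets [measurable_cong]: "sets \<nu> = sets borel" using \<nu> by (simp add: is_spectral_measure_def)
  have dens: "(\<lambda>x. ennreal (indicator {0<..<1} x * density_III a b c x)) = (\<lambda>x. ennreal (indicator {0<..<1} x *\<^sub>R boundary_density a b c x))"
    using density_III_eq(2)[OF a c] by (auto simp: indicator_def)
  have meas: "(\<lambda>x. ennreal (indicator {0<..<1} x *\<^sub>R boundary_density a b c x)) \<in> borel_measurable lborel"
  proof -
    have "continuous_on {0<..<1} (boundary_density a b c)" by (intro continuous_at_imp_continuous_on ballI boundary_density_isCont)
    then have "(\<lambda>x. indicator {0<..<1} x *\<^sub>R boundary_density a b c x) \<in> borel_measurable borel"
      by (intro borel_measurable_continuous_on_indicator) auto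
    then show ?thesis by simp
  qed
  have "{u..v} = {u<..<v} \<union> ({u} \<union> {v})" using uv by auto
  then have "measure \<nu> {u..v} = measure \<nu> ({u<..<v} \<union> ({u} \<union> {v}))" by simp
  also have "\<dots> = measure \<nu> {u<..<v} + (measure \<nu> {u} + measure \<nu> {v})"
  proof -
    have "measure \<nu> ({u} \<union> {v}) = measure \<nu> {u} + measure \<nu> {v}"
      by (rule finite_measure_Union) (use uv in auto)
    moreover have "measure \<nu> ({u<..<v} \<union> ({u} \<union> {v})) = measure \<nu> {u<..<v} + measure \<nu> ({u} \<union> {v})"
      by (rule finite_measure_Union) auto
    ultimately show ?thesis by (simp only:)
  qed
  also have "\<dots> = (LBINT x:{u..v}. boundary_density a b c x)"
    using nu_interval_half[OF uv] nu_no_atom[of u] nu_no_atom[of v] uv by simp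
  finally have "emeasure \<nu> {u..v} = ennreal (LBINT x:{u..v}. boundary_density a b c x)" by (simp add: emeasure_eq_measure)
  also have "\<dots> = (\<integral>\<^sup>+x. ennreal (indicator {u..v} x *\<^sub>R boundary_density a b c x) \<partial>lborel)"
    unfolding set_lebesgue_integral_def
  proof (rule nn_integral_eq_integral[symmetric])
    show "integrable lborel (\<lambda>x. indicator {u..v} x *\<^sub>R boundary_density a b c x)" using uv by (intro boundary_density_integrable) auto
    show "AE x in lborel. 0 \<le> indicator {u..v} x *\<^sub>R boundary_density a b c x"
      using uv boundary_density_nonneg by (intro AE_I2) (auto simp: indicator_def)
  qed
  also have "\<dots> = (\<integral>\<^sup>+x. ennreal (indicator {0<..<1} x *\<^sub>R boundary_density a b c x) * indicator {u..v} x \<partial>lborel)"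
    using uv by (intro nn_integral_cong) (auto simp: indicator_def)
  also have "\<dots> = emeasure (density lborel (\<lambda>x. ennreal (indicator {0<..<1} x * density_III a b c x))) {u..v}"
    unfolding dens using meas by (subst emeasure_density) auto
  finally show ?thesis .
qed

lemma nu_eq_density:
  "\<nu> = density lborel (\<lambda>x. ennreal (indicator {0<..<1} x * density_III a b c x))"
proof (rule measure_eqI_lessThan)
  interpret prob_space \<nu> using \<nu> by (simp add: is_spectral_measure_def)
  let ?\<mu> = "density lborel (\<lambda>x. ennreal (indicator {0<..<1} x * density_III a b c x))"
  show sets: "sets \<nu> = sets borel" using \<nu> by (simp add: is_spectral_measure_def)
  note [measurable_cong] = sets
  show "sets ?\<mu> = sets borel" by simp
  show "emeasure \<nu> {x<..} < \<infinity>" for x using emeasure_real[of "{x<..}"] by (auto simp: less_top[symmetric])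
  have dens: "(\<lambda>x. ennreal (indicator {0<..<1} x * density_III a b c x)) = (\<lambda>x. ennreal (indicator {0<..<1} x *\<^sub>R boundary_density a b c x))"
    using density_III_eq(2)[OF a c] by (auto simp: indicator_def)
  have meas: "(\<lambda>x. ennreal (indicator {0<..<1} x * density_III a b c x)) \<in> borel_measurable lborel"
  proof -
    have "continuous_on {0<..<1} (boundary_density a b c)" by (intro continuous_at_imp_continuous_on ballI boundary_density_isCont)
    then have "(\<lambda>x. indicator {0<..<1} x *\<^sub>R boundary_density a b c x) \<in> borel_measurable borel"
      by (intro borel_measurable_continuous_on_indicator) auto
    then show ?thesis unfolding dens by simp
  qed
  have ae01: "AE x in \<nu>. x \<in> {0<..<1}"
  proof -
    have "measure \<nu> {0} = 0" "measure \<nu> {1} = 0"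
      using no_atom_0[OF c _ b \<nu> supp] no_atom_1[OF c _ b \<nu> supp] a by auto
    then have "{0} \<in> null_sets \<nu>" "{1} \<in> null_sets \<nu>"
      by (auto simp: null_sets_def emeasure_eq_measure)
    from AE_not_in[OF this(1)] AE_not_in[OF this(2)] supp show ?thesis
      by eventually_elim auto
  qed
  fix x :: real
  \<comment> \<open>Neither measure charges the complement of (0,1), so the half line may be
    replaced by \<open>{y<..<1}\<close>.\<close>
  define y where "y = max x 0"
  have nu: "emeasure \<nu> {x<..} = emeasure \<nu> {y<..<1}"
  proof (rule emeasure_eq_AE)
    show "AE t in \<nu>. t \<in> {x<..} \<longleftrightarrow> t \<in> {y<..<1}"
      using ae01 by eventually_elim (auto simp: y_def)
  qed (simp_all add: sets)
  have mu: "emeasure ?\<mu> {x<..} = emeasure ?\<mu> {y<..<1}"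
    using meas by (simp add: emeasure_density) (intro nn_integral_cong, auto simp: indicator_def y_def)
  show "emeasure \<nu> {x<..} = emeasure ?\<mu> {x<..}"
  proof (cases "y < 1")
    case False
    then have "{y<..<1} = {}" by auto
    then show ?thesis unfolding nu mu by simp
  next
    case True
    \<comment> \<open>The offset 3 keeps \<open>d n\<close> below \<open>(1 - y) / 2\<close>, so
      that each \<open>A n\<close> is a proper interval inside (0,1), also when
      \<open>y = 0\<close>.\<close>
    define d where "d n = (1 - y) / real (n + 3)" for n
    define A where "A n = {y + d n..1 - d n}" for n
    have d: "0 < d n" "d n < (1 - y) / 2" for n
      using True unfolding d_def by (simp, intro divide_strict_left_mono) auto
    have inc: "incseq A"
    proof (rule incseq_SucI)
      fix n
      have "d (Suc n) \<le> d n" unfolding d_def using True by (intro divide_left_mono) auto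
      then show "A n \<subseteq> A (Suc n)" by (auto simp: A_def)
    qed
    have UN: "(\<Union>n. A n) = {y<..<1}"
    proof (intro set_eqI iffI)
      fix t assume "t \<in> (\<Union>n. A n)"
      then obtain n where "y + d n \<le> t" "t \<le> 1 - d n" by (auto simp: A_def)
      then show "t \<in> {y<..<1}" using d(1)[of n] unfolding greaterThanLessThan_iff by linarith
    next
      fix t assume t: "t \<in> {y<..<1}"
      have "d \<longlonglongrightarrow> 0" unfolding d_def by real_asymp
      then have "\<forall>\<^sub>F n in sequentially. d n < min (t - y) (1 - t)" using t by (intro order_tendstoD(2)) auto
      then obtain n where "d n < min (t - y) (1 - t)" by (auto simp: eventually_sequentially)
      then have "t \<in> A n" unfolding A_def by auto
      then show "t \<in> (\<Union>n. A n)" by blast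
    qed
    have eq: "emeasure \<nu> (A n) = emeasure ?\<mu> (A n)" for n
      unfolding A_def
    proof (rule nu_interval)
      show "0 < y + d n" using d(1)[of n] by (simp add: y_def)
      show "y + d n < 1 - d n" using d(2)[of n] by (simp add: field_simps)
      show "1 - d n < 1" using d(1)[of n] by simp
    qed
    have sA: "A n \<in> sets borel" for n by (simp add: A_def)
    have "emeasure \<nu> {y<..<1} = (SUP n. emeasure \<nu> (A n))"
      unfolding UN[symmetric] by (rule SUP_emeasure_incseq[symmetric]) (use inc sA sets in auto)
    also have "\<dots> = (SUP n. emeasure ?\<mu> (A n))" unfolding eq ..
    also have "\<dots> = emeasure ?\<mu> {y<..<1}"
      unfolding UN[symmetric] by (rule SUP_emeasure_incseq) (use inc sA in auto)
    finally show ?thesis unfolding nu mu .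
  qed
qed

end

theorem theorem4p4:
  fixes a b c :: real
  assumes "c \<ge> 0" and "c + a > 0" and "c + b > 0"
    and "a \<notin> \<int>"
    and "a > - 1" and "b \<ge> - 1"
  shows "spectral_measure (J_III a b c) =
         density lborel (\<lambda>x. ennreal (indicator {0<..<1} x * density_III a b c x))"
proof (cases "c = 0")
  case True
  have "a > 0" "b > 0" using assms(2,3) unfolding True by simp_all
  then show ?thesis unfolding True by (rule spectral_measure_III_c0)
next
  case False
  then have c: "c > 0" using assms(1) by simp
  have a: "a \<ge> -1" using assms(5) by simp
  obtain \<nu> where \<nu>: "is_spectral_measure (J_III a b c) \<nu>" "AE x in \<nu>. x \<in> {0..1}"
    using spectral_measure_III_exists[OF assms(1-3) a assms(6)] by blast
  have "spectral_measure (J_III a b c) = \<nu>"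
    by (rule spectral_measure_III_eqI[OF assms(1-3) a assms(6) \<nu>(1)])
  also have "\<nu> = density lborel (\<lambda>x. ennreal (indicator {0<..<1} x * density_III a b c x))"
    by (rule nu_eq_density[OF assms(4,5,6) c assms(2,3) \<nu>])
  finally show ?thesis .
qed

end
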